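(* Let $\bullet\in\{*,ш\}$ and let $\mathbf k=(k_1,\dots,k_r)$ be an index ($r\ge1$) with weight $k=\mathrm{wt}(\mathbf k)>r$. Then in $\mathcal Z[T_1,T_2][[s,t]]$, \begin{align*} &\sum_{i=1}^{r}\sum_{j=0}^{k_i-1}\zeta^{s,t,\star,\bullet}_{\widehat{\mathcal S}}(j+1,\mathbf k^{[i]},\mathbf k_{[i-1]},k_i-j;T_1,T_2)\\ &=\sum_{i=1}^{r}\sum_{j=0}^{\infty}\Bigl(\zeta^{s,t,\star,\bullet}_{\widehat{\mathcal S}}(j+1,\mathbf k^{[i]},\mathbf k_{[i]};T_1,T_2)\,t^j+\zeta^{s,t,\star,\bullet}_{\widehat{\mathcal S}}(\mathbf k^{[i]},\mathbf k_{[i]},j+1;T_1,T_2)\,s^j\Bigr)+k\,\zeta^{s,t,\star,\bullet}_{\widehat{\mathcal S}}(k+1;T_1,T_2). \end{align*}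
   Context: $s,t,T,T_1,T_2$ are commuting indeterminates. An index is a finite tuple $\mathbf{k}=(k_1,\dots,k_r)$ of positive integers ($r\ge0$; empty $\varnothing$), $\mathrm{dep}(\mathbf k)=r$, $\mathrm{wt}(\mathbf k)=\sum k_i$; $\mathbf{k}_{[i]}=(k_1,\dots,k_i)$, $\mathbf{k}^{[i]}=(k_{i+1},\dots,k_r)$ ($0\le i\le r$), $\overleftarrow{\mathbf{k}}=(k_r,\dots,k_1)$; commas inside arguments denote concatenation; $\oplus$ is componentwise sum and $b\binom{\mathbf{k}}{\mathbf{l}}=\prod_{i}\binom{k_i+l_i-1}{l_i}$. MZVs $\zeta(\mathbf k)$ for admissible $\mathbf k$ (empty or $k_r\ge2$), $\mathcal Z$ the $\mathbb Q$-algebra they generate. $\zeta^{\bullet}(\mathbf k;T)$ ($\bullet\in\{*,ш\}$): with $\mathfrak H=\mathbb Q\langle e_0,e_1\rangle$, $e_{\mathbf{k}}=e_1e_0^{k_1-1}\cdots e_1e_0^{k_r-1}$, $Z^\bullet_T$ the unique $\mathbb Q$-algebra homomorphism $(\mathbb Q+e_1\mathfrak H,\bullet)\to\mathbb R[T]$ (harmonic product $*$ resp. shuffle product $ш$) with $Z^\bullet_T(e_{\mathbf k})=(-1)^{\mathrm{dep}}\zeta(\mathbf k)$ for admissible $\mathbf k$ and $Z^\bullet_T(e_1)=-T$; $\zeta^\bullet(\mathbf k;T)=(-1)^{\mathrm{dep}(\mathbf k)}Z^\bullet_T(e_{\mathbf k})$. Shifted values $\zeta^{t,\bullet}_{\mathrm{shift}}(\mathbf{k};T)=\sum_{\mathbf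 n\in\mathbb Z_{\ge0}^{\mathrm{dep}(\mathbf k)}}b\binom{\mathbf k}{\mathbf n}\zeta^{\bullet}(\mathbf k\oplus\mathbf n;T)(-t)^{\mathrm{wt}(\mathbf n)}$ (also with $s$ or $-t$ in place of $t$). $\zeta^{s,t,\bullet}_{\widehat{\mathcal S}}(\mathbf k;T_1,T_2)=\sum_{i=0}^{r}(-1)^{\mathrm{wt}(\mathbf k^{[i]})}\zeta^{s,\bullet}_{\mathrm{shift}}(\mathbf k_{[i]};T_1)\zeta^{-t,\bullet}_{\mathrm{shift}}(\overleftarrow{\mathbf k^{[i]}};T_2)$. Star values: $\mathbf l\preceq\mathbf k$ if $\mathbf l$ is obtained from $(k_1\circ\cdots\circ k_r)$ by replacing each $\circ$ by a comma or a plus sign ($\varnothing\preceq\varnothing$); $\zeta^{s,t,\star,\bullet}_{\widehat{\mathcal S}}(\mathbf k;T_1,T_2)=\sum_{\mathbf l\preceq\mathbf k}\zeta^{s,t,\bullet}_{\widehat{\mathcal S}}(\mathbf l;T_1,T_2)$. *)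

theory Defs
  imports "HOL-Computational_Algebra.Polynomial" "HOL-Computational_Algebra.Formal_Power_Series"
begin

text \<open>Indices are lists of positive naturals. Truncated sums: for the reversed index
  (k_r, ..., k_1), msum gives the sum over 0 < n_1 < ... < n_r < N.\<close>

fun msum :: "nat list \<Rightarrow> nat \<Rightarrow> real" where
  "msum [] N = 1"
| "msum (k # ks) N = (\<Sum>n\<in>{1..<N}. msum ks n / real n ^ k)"

definition mzv :: "nat list \<Rightarrow> real" where
  "mzv k = lim (\<lambda>N. msum (rev k) N)"

definition is_index :: "nat list \<Rightarrow> bool" where
  "is_index k \<longleftrightarrow> (\<forall>x\<in>set k. 0 < x)"

definition admissible :: "nat list \<Rightarrow> bool" where
  "admissible k \<longleftrightarrow> k = [] \<or> 2 \<le> last k"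

text \<open>Words in e_0, e_1 as bool lists (True = e_1, False = e_0);
  e_k = e_1 e_0^(k_1-1) ... e_1 e_0^(k_r-1). The basis of Q + e_1 H is indexed by indices.\<close>

definition word_of :: "nat list \<Rightarrow> bool list" where
  "word_of k = concat (map (\<lambda>ki. True # replicate (ki - 1) False) k)"

definition index_of :: "bool list \<Rightarrow> nat list" where
  "index_of w = (THE k. is_index k \<and> word_of k = w)"

fun shuffle :: "bool list \<Rightarrow> bool list \<Rightarrow> bool list list" where
  "shuffle [] v = [v]"
| "shuffle u [] = [u]"
| "shuffle (a # u) (b # v) = map ((#) a) (shuffle u (b # v)) @ map ((#) b) (shuffle (a # u) v)"

text \<open>Products of basis elements e_k, e_l as formal linear combinations (coefficient, index).\<close>
definition sh_prod :: "nat list \<Rightarrow> nat list \<Rightarrow> (real \<times> nat list) list" where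
  "sh_prod k l = map (\<lambda>w. (1, index_of w)) (shuffle (word_of k) (word_of l))"

text \<open>Harmonic product on Q + e_1 H in the normalisation making Z(e_k) = (-1)^dep zeta(k)
  multiplicative: e_a u * e_b v = e_a(u * e_b v) + e_b(e_a u * v) - e_(a+b)(u * v).\<close>
fun harm_prod :: "nat list \<Rightarrow> nat list \<Rightarrow> (real \<times> nat list) list" where
  "harm_prod [] l = [(1, l)]"
| "harm_prod k [] = [(1, k)]"
| "harm_prod (a # k) (b # l) =
     map (\<lambda>(c, w). (c, a # w)) (harm_prod k (b # l))
   @ map (\<lambda>(c, w). (c, b # w)) (harm_prod (a # k) l)
   @ map (\<lambda>(c, w). (- c, (a + b) # w)) (harm_prod k l)"

datatype prodtype = Harmonic | Shuffle

fun prod_of :: "prodtype \<Rightarrow> nat list \<Rightarrow> nat list \<Rightarrow> (real \<times> nat list) list" where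
  "prod_of Harmonic = harm_prod"
| "prod_of Shuffle = sh_prod"

text \<open>Z is (the restriction to the basis e_k of) a Q-algebra homomorphism
  (Q + e_1 H, bullet) -> R[T] with the prescribed values.\<close>
definition reg_hom :: "prodtype \<Rightarrow> (nat list \<Rightarrow> real poly) \<Rightarrow> bool" where
  "reg_hom bt Z \<longleftrightarrow>
     Z [] = 1 \<and>
     (\<forall>k l. is_index k \<longrightarrow> is_index l \<longrightarrow>
        Z k * Z l = (\<Sum>(c, w)\<leftarrow>prod_of bt k l. smult c (Z w))) \<and>
     (\<forall>k. is_index k \<longrightarrow> admissible k \<longrightarrow> Z k = [:(-1) ^ length k * mzv k:]) \<and>
     Z [1] = [:0, -1:]"

definition zeta_reg :: "prodtype \<Rightarrow> nat list \<Rightarrow> real poly" where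
  "zeta_reg bt k = (THE p. \<exists>Z. reg_hom bt Z \<and> p = smult ((-1) ^ length k) (Z k))"

text \<open>R[T1,T2] is modelled as real poly poly (inner variable T1, outer variable T2);
  R[T1,T2][[s,t]] as (real poly poly fps) fps, outer variable s, inner variable t.\<close>

type_synonym ps = "real poly poly fps fps"

definition ss :: ps where "ss = fps_X"
definition tt :: ps where "tt = fps_const fps_X"

definition bcoef :: "nat list \<Rightarrow> nat list \<Rightarrow> real" where
  "bcoef k n = (\<Prod>i<length k. real ((k ! i + n ! i - 1) choose (n ! i)))"

definition shift_coef :: "prodtype \<Rightarrow> nat list \<Rightarrow> nat \<Rightarrow> real poly" where
  "shift_coef bt k m =
     (\<Sum>n\<in>{n. length n = length k \<and> sum_list n = m}. smult (bcoef k n) (zeta_reg bt (map2 (+) k n)))"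

definition shift_s :: "prodtype \<Rightarrow> nat list \<Rightarrow> ps" where
  "shift_s bt k = Abs_fps (\<lambda>a. fps_const [: smult ((-1) ^ a) (shift_coef bt k a) :])"

definition shift_mt :: "prodtype \<Rightarrow> nat list \<Rightarrow> ps" where
  "shift_mt bt k = fps_const (Abs_fps (\<lambda>b. map_poly (\<lambda>c. [:c:]) (shift_coef bt k b)))"

definition zS :: "prodtype \<Rightarrow> nat list \<Rightarrow> ps" where
  "zS bt k = (\<Sum>i\<le>length k. (-1) ^ sum_list (drop i k) * shift_s bt (take i k) * shift_mt bt (rev (drop i k)))"

fun coarsenings :: "nat list \<Rightarrow> nat list list" where
  "coarsenings [] = [[]]"
| "coarsenings [k] = [[k]]"
| "coarsenings (k1 # k2 # ks) =
     map (\<lambda>l. k1 # l) (coarsenings (k2 # ks)) @ map (\<lambda>l. (k1 + hd l) # tl l) (coarsenings (k2 # ks))"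

definition zSstar :: "prodtype \<Rightarrow> nat list \<Rightarrow> ps" where
  "zSstar bt k = (\<Sum>l\<leftarrow>coarsenings k. zS bt l)"

text \<open>Sum of a family G_j in R[[s,t]] in which G_j has total (s,t)-order at least j
  (as for G_j = F_j t^j or F_j s^j); only j \<le> a+b contribute to the coefficient of s^a t^b.\<close>
definition sum_st :: "(nat \<Rightarrow> ps) \<Rightarrow> ps" where
  "sum_st G = Abs_fps (\<lambda>a. Abs_fps (\<lambda>b. \<Sum>j\<le>a + b. fps_nth (fps_nth (G j) a) b))"

end

theory Submission
  imports Defs "HOL-Analysis.FPS_Convergence" "HOL-Analysis.Harmonic_Numbers"
    "HOL-Real_Asymp.Real_Asymp" "HOL-Library.Multiset"
begin

text \<open>
  For the harmonic product, replace each regularized value by the truncated sum over \<open>1, \<dots>, N\<close>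
  (for \<open>T\<^sub>1\<close>) resp. \<open>1, \<dots>, M\<close> (for \<open>T\<^sub>2\<close>). Expanding the shifts, the symmetric value of \<open>k\<close> becomes
  the sum of the \<open>\<Prod> x(n\<^sub>i)^k\<^sub>i\<close> over strict chains in the ordered set \<open>1 < \<dots> < N < -M < \<dots> < -1\<close>, where
  \<open>x(n) = 1/(n + s)\<close> for \<open>n > 0\<close> and \<open>x(n) = 1/(n + t)\<close> for \<open>n < 0\<close>, and the star value the sum over weak
  chains. There the cyclic sum formula is a telescoping identity, based on
  \<open>\<Sum>\<^sub>j x(a)^(j+1) x(b)^(m-j) = (x(a)^m - x(b)^m) / (1/x(b) - 1/x(a))\<close>, up to error terms supported on chains
  that are entirely positive or entirely negative. An exponent \<open>\<ge> 2\<close> makes these vanish as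
  \<open>M = c N\<close> tends to infinity, and letting \<open>c\<close> vary separates the variables \<open>T\<^sub>1\<close> and \<open>T\<^sub>2\<close>.

  Abel summation of the truncated sums gives the multiple polylogarithms, which regularize the shuffle
  product. Hence a linear map \<open>\<rho>\<close> carries the harmonic regularized values to the shuffle ones, and
  applying \<open>\<rho> \<otimes> \<rho>\<close> to the harmonic formula yields the shuffle formula.
\<close>

text \<open>Regularized values are asymptotic expansions of truncated sums in the harmonic number,
  so products of them carry powers of logarithms. Mere convergence of the errors to 0 would not
  survive these factors; every error is therefore required to decay like a negative power
  (\<open>small\<close>), and every other factor to grow slower than any power
  (\<open>slow\<close>). The values in the statement are definite descriptions over homomorphisms.
  Existence and uniqueness come from one locale, \<open>regulator\<close>, for any sequence of
  characters with such decay: truncated sums for the harmonic product, polylogarithms at nodes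
  tending to 1 for the shuffle product. The infinite sums on the right-hand side arise from two
  virtual positions 0, one with denominator \<open>s\<close> and one with denominator
  \<open>t\<close>: the inverse differences of a denominator to \<open>t\<close> and to
  \<open>s\<close> expand into the geometric series over \<open>j\<close>. With exactly these
  weights the errors of chains that meet both blocks cancel.\<close>

section \<open>Chain sums\<close>

text \<open>The monomial quasisymmetric function of \<open>k\<close> at the finite alphabet
  \<open>xs\<close>. Chains follow the order of the list, so \<open>xs\<close> may contain positive
  and negative positions.\<close>

fun chain_sum :: "'a::comm_ring_1 list \<Rightarrow> nat list \<Rightarrow> 'a" where
  "chain_sum xs [] = 1"
| "chain_sum [] (k # ks) = 0"
| "chain_sum (x # xs) (k # ks) = chain_sum xs (k # ks) + x ^ k * chain_sum xs ks"

text \<open>A chain is cut where it leaves \<open>xs\<close> (deconcatenation). This is the origin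
  of the sum over \<open>i\<close> in \<open>zS\<close>.\<close>

lemma chain_sum_append:
  "chain_sum (xs @ ys) k = (\<Sum>i\<le>length k. chain_sum xs (take i k) * chain_sum ys (drop i k))"
proof (induction xs arbitrary: k)
  case Nil
  show ?case
    by (cases k) (simp_all add: sum.atMost_Suc_shift del: sum.atMost_Suc)
next
  case IH: (Cons x xs)
  show ?case
    by (cases k) (simp_all add: sum.atMost_Suc_shift IH.IH algebra_simps sum.distrib sum_distrib_left
          del: sum.atMost_Suc)
qed

lemma chain_sum_Nil [simp]: "chain_sum [] ks = (if ks = [] then 1 else 0)"
  by (cases ks) auto

lemma chain_sum_snoc:
  "chain_sum (xs @ [x]) (ks @ [k]) = chain_sum xs (ks @ [k]) + chain_sum xs ks * x ^ k"
proof (induction xs arbitrary: ks)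
  case Nil
  show ?case by (cases ks) simp_all
next
  case IH: (Cons y xs)
  show ?case
  proof (cases ks)
    case Nil
    thus ?thesis using IH.IH[of "[]"] by simp
  next
    case (Cons c ks')
    thus ?thesis using IH.IH[of ks] IH.IH[of ks'] by (simp add: algebra_simps)
  qed
qed

text \<open>Negative positions run from \<open>-M\<close> up to \<open>-1\<close>, opposite to the
  truncated sums over \<open>1, ..., M\<close>; hence the reversed index in the second factor of
  \<open>zS\<close>.\<close>

lemma chain_sum_rev: "chain_sum (rev xs) (rev ks) = chain_sum xs ks"
proof (induction xs arbitrary: ks)
  case Nil
  show ?case by (simp add: chain_sum_Nil)
next
  case IH: (Cons x xs)
  show ?case
  proof (cases ks)
    case (Cons c ks')
    thus ?thesis using IH.IH[of ks] IH.IH[of ks'] by (simp add: chain_sum_snoc algebra_simps)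
  qed simp
qed

lemma chain_sum_hom:
  assumes "\<And>x y. h (x + y) = h x + h y" "\<And>x y. h (x * y) = h x * h y" "h 1 = 1" "h 0 = 0"
  shows "chain_sum (map h xs) k = h (chain_sum xs k)"
proof -
  have pow: "h (x ^ n) = h x ^ n" for x n
    by (induction n) (simp_all add: assms)
  show ?thesis
    by (induction xs k rule: chain_sum.induct) (simp_all add: assms pow)
qed

text \<open>The source of the weight sign in \<open>zS\<close>: negative positions carry negated
  values.\<close>

lemma chain_sum_uminus: "chain_sum (map uminus xs) k = (-1) ^ sum_list k * chain_sum xs k"
proof (induction xs k rule: chain_sum.induct)
  case (3 x xs k ks)
  have "(- x) ^ k * ((- 1) ^ sum_list ks * chain_sum xs ks)
      = (- 1) ^ (k + sum_list ks) * (x ^ k * chain_sum xs ks)"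
    by (subst power_minus) (simp only: power_add mult_ac)
  thus ?case using 3 by (simp add: distrib_left)
qed simp_all

definition lincomb :: "(nat list \<Rightarrow> real) \<Rightarrow> (real \<times> nat list) list \<Rightarrow> real" where
  "lincomb g R = (\<Sum>(c, w)\<leftarrow>R. c * g w)"

lemma lincomb_simps [simp]:
  "lincomb g [] = 0" "lincomb g ((c, w) # R) = c * g w + lincomb g R"
  "lincomb g (R @ R') = lincomb g R + lincomb g R'"
  by (simp_all add: lincomb_def)

lemma lincomb_map: "lincomb g (map (\<lambda>(c, w). (a * c, h w)) R) = a * lincomb (\<lambda>w. g (h w)) R"
  by (induction R) (auto simp: algebra_simps)

lemma lincomb_map_cons: "lincomb g (map (\<lambda>(c, w). (c, a # w)) R) = lincomb (\<lambda>w. g (a # w)) R"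
  "lincomb g (map (\<lambda>(c, w). (- c, a # w)) R) = - lincomb (\<lambda>w. g (a # w)) R"
  by (induction R) auto

lemma lincomb_diff: "lincomb (\<lambda>w. g w - g' w) R = lincomb g R - lincomb g' R"
  by (induction R) (auto simp: algebra_simps)

lemma lincomb_cmult: "lincomb (\<lambda>w. a * g w) R = a * lincomb g R"
  by (induction R) (auto simp: algebra_simps)

lemma lincomb_zero [simp]: "lincomb (\<lambda>w. 0) R = 0"
  by (induction R) auto

text \<open>\<open>harm_prod\<close> is normalised for the words e_k, whose values carry the sign of
  the depth; with this sign a chain sum becomes a character.\<close>

definition signed :: "(nat list \<Rightarrow> real) \<Rightarrow> nat list \<Rightarrow> real" where
  "signed g k = (-1) ^ length k * g k"

lemma harm_prod_Nil_right [simp]: "harm_prod k [] = [(1, k)]"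
  by (cases k) auto

lemma signed_chain_sum_Cons:
  "signed (chain_sum (x # xs)) (k # ks) = signed (chain_sum xs) (k # ks) - x ^ k * signed (chain_sum xs) ks"
  by (simp add: signed_def algebra_simps)

text \<open>Split off the first letter \<open>x\<close>: it is used by neither, one or both chains.
  The case of both is matched by the contracted term \<open>(a + b) # w\<close>, whose coefficient
  \<open>-1\<close> meets the sign of the leading entry in \<open>signed\<close> and gives
  \<open>+ x ^ (a + b)\<close>.\<close>

lemma chain_sum_harm_prod:
  "signed (chain_sum xs) k * signed (chain_sum xs) l = lincomb (signed (chain_sum xs)) (harm_prod k l)"
proof (induction xs arbitrary: k l)
  case Nil
  show ?case
    by (cases k; cases l) (simp_all add: lincomb_map_cons signed_def)
next
  case IH: (Cons x xs)
  show ?case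
  proof (cases k)
    case Nil
    thus ?thesis by (simp add: signed_def)
  next
    case k: (Cons a k')
    show ?thesis
    proof (cases l)
      case Nil
      thus ?thesis by (simp add: signed_def)
    next
      case l: (Cons b l')
      let ?g = "signed (chain_sum xs)"
      have "lincomb (signed (chain_sum (x # xs))) (harm_prod (a # k') (b # l'))
          = lincomb ?g (harm_prod (a # k') (b # l'))
            - x ^ a * lincomb ?g (harm_prod k' (b # l'))
            - x ^ b * lincomb ?g (harm_prod (a # k') l')
            + x ^ (a + b) * lincomb ?g (harm_prod k' l')"
        by (simp add: lincomb_map_cons signed_chain_sum_Cons lincomb_diff lincomb_cmult)
      also have "\<dots> = (?g (a # k') - x ^ a * ?g k') * (?g (b # l') - x ^ b * ?g l')"
        by (simp add: IH.IH[symmetric] algebra_simps power_add del: harm_prod.simps)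
      finally show ?thesis
        by (simp only: k l signed_chain_sum_Cons)
    qed
  qed
qed

text \<open>Weak chains in an interval of positions. Two endpoints replace the list because the
  cyclic argument moves them independently.\<close>

function star_sum :: "(nat \<Rightarrow> 'a::comm_ring_1) \<Rightarrow> nat \<Rightarrow> nat \<Rightarrow> nat list \<Rightarrow> 'a" where
  "star_sum x a b [] = 1"
| "star_sum x a b (k # ks) = (\<Sum>n=a..b. x n ^ k * star_sum x n b ks)"
  by pat_completeness auto
termination by (relation "measure (\<lambda>(_, _, _, k). length k)") auto

lemma coarsenings_nonempty: "k \<noteq> [] \<Longrightarrow> l \<in> set (coarsenings k) \<Longrightarrow> l \<noteq> []"
  by (induction k arbitrary: l rule: coarsenings.induct) auto

lemma sum_list_zero_if: "(\<And>x. x \<in> set xs \<Longrightarrow> f x = 0) \<Longrightarrow> (\<Sum>x\<leftarrow>xs. f x) = (0::'a::comm_monoid_add)"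
  by (induction xs) auto

text \<open>A merged first entry \<open>k1 + hd l\<close> means that \<open>x\<close> is used again
  by the next entry. So \<open>x\<close> stays available after serving \<open>k1\<close>, which is
  the recursion of weak chains.\<close>

lemma coarsenings_chain_sum_Cons:
  "(\<Sum>l\<leftarrow>coarsenings (k1 # ks). chain_sum (x # xs) l)
     = (\<Sum>l\<leftarrow>coarsenings (k1 # ks). chain_sum xs l) + x ^ k1 * (\<Sum>l\<leftarrow>coarsenings ks. chain_sum (x # xs) l)"
proof (cases ks)
  case Nil
  thus ?thesis by simp
next
  case (Cons k2 ks')
  have *: "chain_sum (x # xs) (k1 # l) + chain_sum (x # xs) ((k1 + hd l) # tl l)
      = chain_sum xs (k1 # l) + chain_sum xs ((k1 + hd l) # tl l) + x ^ k1 * chain_sum (x # xs) l"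
    if "l \<in> set (coarsenings ks)" for l
  proof -
    have "l \<noteq> []"
      using coarsenings_nonempty[of ks l] that Cons by blast
    then obtain m l' where "l = m # l'"
      by (cases l) simp_all
    thus ?thesis by (simp add: algebra_simps power_add)
  qed
  have "(\<Sum>l\<leftarrow>coarsenings (k1 # ks). chain_sum (x # xs) l)
      = (\<Sum>l\<leftarrow>coarsenings ks. chain_sum (x # xs) (k1 # l) + chain_sum (x # xs) ((k1 + hd l) # tl l))"
    unfolding Cons coarsenings.simps by (simp only: map_append map_map sum_list.append sum_list_addf o_def)
  also have "\<dots> = (\<Sum>l\<leftarrow>coarsenings ks. chain_sum xs (k1 # l) + chain_sum xs ((k1 + hd l) # tl l) + x ^ k1 * chain_sum (x # xs) l)"
    by (rule arg_cong[where f = sum_list, OF map_cong[OF refl]]) (rule *)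
  finally show ?thesis
    unfolding Cons coarsenings.simps
    by (simp only: map_append map_map sum_list.append sum_list_addf sum_list_const_mult o_def)
qed

text \<open>Each step either drops the left endpoint or shortens the index at the same endpoint,
  hence an induction on \<open>k\<close> inside one on the length of the interval.\<close>

lemma star_sum_coarsenings:
  "star_sum x a b k = (\<Sum>l\<leftarrow>coarsenings k. chain_sum (map x [a..<Suc b]) l)"
proof (induction "Suc b - a" arbitrary: a k)
  case 0
  show ?case
  proof (cases k)
    case (Cons c k')
    have "chain_sum (map x [a..<Suc b]) l = 0" if "l \<in> set (coarsenings k)" for l
    proof -
      have "l \<noteq> []" using coarsenings_nonempty[of k l] that Cons by blast
      thus ?thesis using 0 by simp
    qed
    moreover have "{a..b} = {}" using 0 by simp
    ultimately show ?thesis using Cons by (simp only: sum_list_zero_if star_sum.simps sum.empty)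
  qed simp
next
  case (Suc m)
  hence ab: "a \<le> b" by simp
  hence upt: "[a..<Suc b] = a # [Suc a..<Suc b]"
    by (simp add: upt_conv_Cons del: upt_Suc)
  show ?case
  proof (induction k)
    case (Cons c k)
    have "star_sum x a b (c # k) = x a ^ c * star_sum x a b k + star_sum x (Suc a) b (c # k)"
      unfolding star_sum.simps by (rule sum.atLeast_Suc_atMost[OF ab])
    also have "star_sum x (Suc a) b (c # k) = (\<Sum>l\<leftarrow>coarsenings (c # k). chain_sum (map x [Suc a..<Suc b]) l)"
      using Suc by (intro Suc.hyps(1)) auto
    finally show ?case
      unfolding Cons.IH upt list.map coarsenings_chain_sum_Cons by (rule trans[OF _ add.commute])
  qed simp
qed

section \<open>Sequences of polynomial decay\<close>

text \<open>A rate, not only the limit 0: the product with any power of a harmonic number must still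
  tend to 0.\<close>

definition small :: "(nat \<Rightarrow> real) \<Rightarrow> bool" where
  "small e \<longleftrightarrow> (\<exists>p>0. e \<in> O(\<lambda>n. real n powr (-p)))"

definition slow :: "(nat \<Rightarrow> real) \<Rightarrow> bool" where
  "slow g \<longleftrightarrow> (\<forall>p>0. g \<in> O(\<lambda>n. real n powr p))"

lemma bigo_powr_mono: "p \<le> q \<Longrightarrow> (\<lambda>n. real n powr p) \<in> O(\<lambda>n. real n powr q)"
  by (rule landau_o.big_mono, rule eventually_mono[OF eventually_ge_at_top[of 1]]) (simp add: powr_mono)

lemma small_zero [simp]: "small (\<lambda>n. 0)"
  by (auto simp: small_def intro!: exI[of _ 1])

lemma small_add:
  assumes "small e" "small e'"
  shows "small (\<lambda>n. e n + e' n)"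
proof -
  from assms obtain p q where pq: "p > 0" "q > 0"
    and e: "e \<in> O(\<lambda>n. real n powr (-p))" "e' \<in> O(\<lambda>n. real n powr (-q))"
    by (auto simp: small_def)
  have "e \<in> O(\<lambda>n. real n powr (- min p q))"
    by (rule landau_o.big_trans[OF e(1) bigo_powr_mono]) simp
  moreover have "e' \<in> O(\<lambda>n. real n powr (- min p q))"
    by (rule landau_o.big_trans[OF e(2) bigo_powr_mono]) simp
  ultimately show ?thesis
    using pq unfolding small_def by (intro exI[of _ "min p q"]) (auto intro: sum_in_bigo)
qed

lemma small_cmult: "small e \<Longrightarrow> small (\<lambda>n. c * e n)"
  by (cases "c = 0") (auto simp: small_def)

lemma small_uminus: "small e \<Longrightarrow> small (\<lambda>n. - e n)"
  using small_cmult[of e "-1"] by simp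

lemma small_diff: "small e \<Longrightarrow> small e' \<Longrightarrow> small (\<lambda>n. e n - e' n)"
  using small_add[of e "\<lambda>n. - e' n"] small_uminus[of e'] by simp

lemma small_sum: "(\<And>i. i \<in> A \<Longrightarrow> small (\<lambda>n. e n i)) \<Longrightarrow> small (\<lambda>n. \<Sum>i\<in>A. e n i)"
  by (induction A rule: infinite_finite_induct) (auto intro: small_add)

lemma small_sum_list: "(\<And>i. i \<in> set A \<Longrightarrow> small (\<lambda>n. e n i)) \<Longrightarrow> small (\<lambda>n. \<Sum>i\<leftarrow>A. e n i)"
  by (induction A) (auto intro: small_add)

lemma small_tendsto: "small e \<Longrightarrow> e \<longlonglongrightarrow> 0"
proof -
  assume "small e"
  then obtain p where p: "p > 0" "e \<in> O(\<lambda>n. real n powr (-p))"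
    by (auto simp: small_def)
  have "((\<lambda>n. real n powr (-p)) \<longlonglongrightarrow> 0)"
    using p(1) by real_asymp
  hence "(\<lambda>n. real n powr (-p)) \<in> o(\<lambda>_. 1)"
    by (intro smalloI_tendsto) auto
  from landau_o.big_small_trans[OF p(2) this] show ?thesis
    by (auto dest: smalloD_tendsto)
qed

lemma small_bounded:
  assumes "\<And>n. n > 0 \<Longrightarrow> \<bar>e n\<bar> \<le> C * g n" "small g"
  shows "small e"
proof -
  from assms(2) obtain p where p: "p > 0" "g \<in> O(\<lambda>n. real n powr (-p))"
    by (auto simp: small_def)
  have "e \<in> O(g)"
  proof (rule bigoI[of _ "\<bar>C\<bar>"], rule eventually_mono[OF eventually_gt_at_top[of 0]])
    fix n :: nat assume "n > 0"
    hence "\<bar>e n\<bar> \<le> C * g n" by (rule assms(1))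
    also have "\<dots> \<le> \<bar>C\<bar> * \<bar>g n\<bar>" using abs_ge_self[of "C * g n"] by (simp add: abs_mult)
    finally show "norm (e n) \<le> \<bar>C\<bar> * norm (g n)" by simp
  qed
  thus ?thesis using p landau_o.big_trans unfolding small_def by blast
qed

lemma slow_const [simp]: "slow (\<lambda>n. c)"
  unfolding slow_def
proof (intro allI impI)
  fix p :: real assume "p > 0"
  thus "(\<lambda>n. c) \<in> O(\<lambda>n. real n powr p)" by real_asymp
qed

lemma slow_add: "slow g \<Longrightarrow> slow g' \<Longrightarrow> slow (\<lambda>n. g n + g' n)"
  by (auto simp: slow_def intro: sum_in_bigo)

lemma slow_mult:
  assumes "slow g" "slow g'"
  shows "slow (\<lambda>n. g n * g' n)"
  unfolding slow_def
proof (intro allI impI)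
  fix p :: real assume "p > 0"
  hence "(\<lambda>n. g n * g' n) \<in> O(\<lambda>n. real n powr (p/2) * real n powr (p/2))"
    using assms by (intro landau_o.big_mult) (auto simp: slow_def)
  thus "(\<lambda>n. g n * g' n) \<in> O(\<lambda>n. real n powr p)"
    by (simp add: powr_add[symmetric])
qed

lemma slow_power: "slow g \<Longrightarrow> slow (\<lambda>n. g n ^ k)"
  by (induction k) (auto intro: slow_mult)

lemma small_mult_slow:
  assumes "small e" "slow g"
  shows "small (\<lambda>n. e n * g n)"
proof -
  from assms(1) obtain p where p: "p > 0" "e \<in> O(\<lambda>n. real n powr (-p))"
    by (auto simp: small_def)
  have "(\<lambda>n. e n * g n) \<in> O(\<lambda>n. real n powr (-p) * real n powr (p/2))"
    using p assms(2) by (intro landau_o.big_mult) (auto simp: slow_def)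
  hence "(\<lambda>n. e n * g n) \<in> O(\<lambda>n. real n powr (-(p/2)))"
    by (simp add: powr_add[symmetric])
  thus ?thesis using p(1) unfolding small_def by (intro exI[of _ "p/2"]) auto
qed

lemma small_mult_slow': "small e \<Longrightarrow> slow g \<Longrightarrow> small (\<lambda>n. g n * e n)"
  using small_mult_slow[of e g] by (simp add: mult.commute)

lemma small_slow: "small e \<Longrightarrow> slow e"
  unfolding small_def slow_def
proof (intro allI impI, elim exE conjE)
  fix p q :: real assume "p > 0" "q > 0" "e \<in> O(\<lambda>n. real n powr (-q))"
  thus "e \<in> O(\<lambda>n. real n powr p)"
    using landau_o.big_trans[OF _ bigo_powr_mono[of "-q" p]] by auto
qed

lemma slow_poly: "slow g \<Longrightarrow> slow (\<lambda>n. poly p (g n))"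
  by (induction p) (auto intro: slow_add slow_mult)

text \<open>A nonzero polynomial stays away from 0 near infinity. This makes polynomial expansions
  in a divergent sequence unique.\<close>

lemma poly_eq_0_if_small:
  assumes "filterlim \<tau> at_top sequentially" "small (\<lambda>n. poly p (\<tau> n))"
  shows "p = 0"
proof (rule ccontr)
  assume "p \<noteq> 0"
  have *: False if q: "lead_coeff q > 0" "(\<lambda>n. poly q (\<tau> n)) \<longlonglongrightarrow> 0" for q
  proof -
    obtain x0 where x0: "\<forall>x\<ge>x0. poly q x \<ge> lead_coeff q"
      using poly_pinfty_gt_lc[OF q(1)] by blast
    have "eventually (\<lambda>n. \<tau> n \<ge> x0) sequentially"
      using assms(1) by (simp add: filterlim_at_top)
    hence "eventually (\<lambda>n. poly q (\<tau> n) \<ge> lead_coeff q) sequentially"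
      by eventually_elim (use x0 in blast)
    hence "lead_coeff q \<le> 0"
      by (intro tendsto_lowerbound[OF q(2)]) auto
    thus False using q(1) by simp
  qed
  have lim: "(\<lambda>n. poly p (\<tau> n)) \<longlonglongrightarrow> 0"
    using assms(2) by (rule small_tendsto)
  show False
  proof (cases "lead_coeff p > 0")
    case True
    thus ?thesis using * lim by blast
  next
    case False
    hence "lead_coeff (- p) > 0" using \<open>p \<noteq> 0\<close> by (simp add: order_less_le)
    moreover have "(\<lambda>n. poly (- p) (\<tau> n)) \<longlonglongrightarrow> 0"
      using tendsto_minus[OF lim] by simp
    ultimately show ?thesis using * by blast
  qed
qed

section \<open>Indices, words and multiplication by e_1\<close>

definition trailing_ones :: "nat list \<Rightarrow> nat" where
  "trailing_ones k = length (takeWhile ((=) 1) (rev k))"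

lemma trailing_ones_simps [simp]:
  "trailing_ones [] = 0"
  "trailing_ones (k @ [m]) = (if m = 1 then Suc (trailing_ones k) else 0)"
  by (auto simp: trailing_ones_def)

lemma is_index_simps [simp]:
  "is_index []" "is_index (a # k) \<longleftrightarrow> a > 0 \<and> is_index k" "is_index (k @ l) \<longleftrightarrow> is_index k \<and> is_index l"
  by (auto simp: is_index_def)

lemma word_of_simps [simp]:
  "word_of [] = []" "word_of (k @ l) = word_of k @ word_of l" "word_of [m] = True # replicate (m - 1) False"
  by (simp_all add: word_of_def)

lemma word_of_snoc_Suc: "m > 0 \<Longrightarrow> word_of (k @ [Suc m]) = word_of (k @ [m]) @ [False]"
  by (cases m) (simp_all add: replicate_append_same[symmetric])

text \<open>The words spanning Q + e_1 H. They are exactly the words of indices, so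
  \<open>index_of\<close> has its intended value on them.\<close>

definition good_word :: "bool list \<Rightarrow> bool" where
  "good_word w \<longleftrightarrow> w = [] \<or> hd w"

lemma good_word_of: "good_word (word_of k)"
  by (cases k) (simp_all add: good_word_def word_of_def)

lemma word_of_eq_Nil [simp]: "word_of k = [] \<longleftrightarrow> k = []"
  by (cases k) (simp_all add: word_of_def)

lemma word_of_inj:
  assumes "is_index k" "is_index l" "word_of k = word_of l"
  shows "k = l"
  using assms
proof (induction "word_of k" arbitrary: k l rule: rev_induct)
  case Nil
  hence "word_of k = []" "word_of l = []" by simp_all
  thus ?case by simp
next
  case (snoc a w)
  \<comment> \<open>Deleting the last letter removes a final entry 1 if the letter is e_1, and
    lowers the final entry by one if it is e_0; so the word determines the index from the
    right.\<close>
  have snoc_form: "\<exists>j' m. j = j' @ [m] \<and> is_index j' \<and>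
      (if a then m = 1 \<and> word_of j' = w else m > 1 \<and> word_of (j' @ [m - 1]) = w)"
    if "is_index j" "word_of j = w @ [a]" for j
  proof -
    have "j \<noteq> []" using that(2) by auto
    then obtain j' m where j: "j = j' @ [m]" by (cases j rule: rev_cases) auto
    hence "m > 0" using that(1) by simp
    show ?thesis
    proof (cases "m = 1")
      case True
      thus ?thesis using that j by (intro exI[of _ j'] exI[of _ m]) auto
    next
      case False
      hence "m - 1 > 0" "m = Suc (m - 1)" using \<open>m > 0\<close> by auto
      hence "word_of j = word_of (j' @ [m - 1]) @ [False]"
        using word_of_snoc_Suc[of "m - 1" j'] j by simp
      thus ?thesis using that j False \<open>m > 0\<close> by (intro exI[of _ j'] exI[of _ m]) auto
    qed
  qed
  obtain k' m where k: "k = k' @ [m]" "is_index k'"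
      "if a then m = 1 \<and> word_of k' = w else m > 1 \<and> word_of (k' @ [m - 1]) = w"
    using snoc_form[OF snoc.prems(1) snoc.hyps(2)[symmetric]] by blast
  obtain l' n where l: "l = l' @ [n]" "is_index l'"
      "if a then n = 1 \<and> word_of l' = w else n > 1 \<and> word_of (l' @ [n - 1]) = w"
    using snoc_form[OF snoc.prems(2) snoc.prems(3)[symmetric, folded snoc.hyps(2)]] by blast
  show ?case
  proof (cases a)
    case True
    hence "k' = l'" using k l snoc.hyps(1)[of k' l'] by auto
    thus ?thesis using True k l by auto
  next
    case False
    hence "k' @ [m - 1] = l' @ [n - 1]"
      using k l snoc.hyps(1)[of "k' @ [m - 1]" "l' @ [n - 1]"] by auto
    thus ?thesis using False k l by auto
  qed
qed

lemma index_of_word_of [simp]: "is_index k \<Longrightarrow> index_of (word_of k) = k"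
  unfolding index_of_def by (rule the_equality) (auto intro: word_of_inj)

lemma good_word_obtain:
  assumes "good_word w"
  shows "\<exists>k. is_index k \<and> word_of k = w"
  using assms
proof (induction w rule: rev_induct)
  case Nil
  show ?case by (intro exI[of _ "[]"]) simp
next
  case (snoc a w)
  hence "good_word w" by (cases w) (auto simp: good_word_def)
  with snoc.IH obtain k where k: "is_index k" "word_of k = w" by blast
  show ?case
  proof (cases a)
    case True
    thus ?thesis using k by (intro exI[of _ "k @ [1]"]) simp
  next
    case False
    hence "w \<noteq> []" using snoc.prems by (auto simp: good_word_def)
    hence "k \<noteq> []" using k by auto
    then obtain k' m where k': "k = k' @ [m]" by (cases k rule: rev_cases) auto
    thus ?thesis using k False word_of_snoc_Suc[of m k'] by (intro exI[of _ "k' @ [Suc m]"]) simp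
  qed
qed

lemma good_word_index_of:
  assumes "good_word w"
  shows "is_index (index_of w)" "word_of (index_of w) = w"
  using good_word_obtain[OF assms] by auto

lemma index_of_snoc_True: "good_word w \<Longrightarrow> index_of (w @ [True]) = index_of w @ [1]"
  using good_word_index_of[of w] index_of_word_of[of "index_of w @ [1]"] by simp

lemma trailing_ones_snoc_False:
  assumes "good_word w" "w \<noteq> []"
  shows "is_index (index_of (w @ [False])) \<and> trailing_ones (index_of (w @ [False])) = 0"
proof -
  have g: "good_word (w @ [False])" using assms by (simp add: good_word_def)
  note i = good_word_index_of[OF g]
  obtain k m where k: "index_of (w @ [False]) = k @ [m]"
    using i(2) by (cases "index_of (w @ [False])" rule: rev_cases) auto
  have "m \<noteq> 1" using i(2) k by auto
  thus ?thesis using i k by simp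
qed

lemma shuffle_Nil_right [simp]: "shuffle u [] = [u]"
  by (cases u) auto

lemma good_word_shuffle: "good_word u \<Longrightarrow> good_word v \<Longrightarrow> w \<in> set (shuffle u v) \<Longrightarrow> good_word w"
  by (cases u; cases v) (auto simp: good_word_def)

lemma sh_prod_index: "(c, w) \<in> set (sh_prod k l) \<Longrightarrow> is_index w"
  using good_word_shuffle[OF good_word_of good_word_of]
  by (auto simp: sh_prod_def good_word_index_of)

lemma harm_prod_index:
  assumes "is_index k" "is_index l" "(c, w) \<in> set (harm_prod k l)"
  shows "is_index w"
proof -
  have "\<forall>p\<in>set (harm_prod k l). is_index (snd p)"
    using assms(1,2) by (induction k l rule: harm_prod.induct) (simp_all add: ball_Un case_prod_unfold)
  thus ?thesis using assms(3) by force
qed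

lemma prod_of_index: "is_index k \<Longrightarrow> is_index l \<Longrightarrow> (c, w) \<in> set (prod_of bt k l) \<Longrightarrow> is_index w"
  by (cases bt) (auto intro: harm_prod_index sh_prod_index)

text \<open>Both products recurse from the left, but divergence sits at the right end. For a
  one-letter factor a recursion from the right holds up to order, hence the multisets.\<close>

lemma harm_prod_snoc_one:
  "mset (harm_prod (k @ [m]) [1]) = {#(1, k @ [m, 1]), (-1, k @ [m + 1])#}
     + image_mset (\<lambda>(c, w). (c, w @ [m])) (mset (harm_prod k [1]))"
  by (induction k) (simp_all add: multiset.map_comp o_def case_prod_unfold)

lemma shuffle_snoc_one:
  "mset (shuffle (u @ [a]) [b]) = {#u @ [a, b]#} + image_mset (\<lambda>w. w @ [a]) (mset (shuffle u [b]))"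
  by (induction u) (simp_all add: multiset.map_comp o_def)

text \<open>Case of a last entry 1: appending 1 turns the leading terms of \<open>P\<close> into
  leading terms of \<open>P'\<close>, and the separate term supplies the one further copy.
  \<open>Q\<close> takes the contraction \<open>k @ [2]\<close> of the harmonic product and is empty
  for the shuffle product.\<close>

lemma image_snoc_split:
  assumes "mset P = replicate_mset (Suc (trailing_ones k)) (1, k @ [1]) + mset R"
    "\<forall>(c, w)\<in>set R. is_index w \<and> trailing_ones w \<le> trailing_ones k"
    "mset P' = add_mset (1, k @ [1, 1]) (mset Q + image_mset (\<lambda>(c, w). (c, w @ [1])) (mset P))"
    "\<forall>(c, w)\<in>set Q. is_index w \<and> trailing_ones w \<le> Suc (trailing_ones k)"
  shows "\<exists>R'. mset P' = replicate_mset (Suc (trailing_ones (k @ [1]))) (1 :: real, (k @ [1]) @ [1]) + mset R' \<and>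
    (\<forall>(c, w)\<in>set R'. is_index w \<and> trailing_ones w \<le> trailing_ones (k @ [1]))"
proof (intro exI conjI)
  show "mset P' = replicate_mset (Suc (trailing_ones (k @ [1]))) (1, (k @ [1]) @ [1])
      + mset (Q @ map (\<lambda>(c, w). (c, w @ [1])) R)"
    unfolding assms(3) by (simp add: assms(1))
qed (use assms(2,4) in auto)

text \<open>Case of a last entry other than 1: all other terms have no trailing 1, so the leading
  multiplicity is 1.\<close>

lemma single_split:
  assumes "mset P' = add_mset (1, k @ [m, 1]) (mset Q)" "m \<noteq> 1"
    "\<forall>(c, w)\<in>set Q. is_index w \<and> trailing_ones w = 0"
  shows "\<exists>R'. mset P' = replicate_mset (Suc (trailing_ones (k @ [m]))) (1 :: real, (k @ [m]) @ [1]) + mset R' \<and>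
    (\<forall>(c, w)\<in>set R'. is_index w \<and> trailing_ones w \<le> trailing_ones (k @ [m]))"
  by (rule exI[of _ Q]) (use assms in auto)

text \<open>Multiplication by \<open>e\<^sub>1\<close> is triangular with respect to the number of trailing ones, which is what
  makes both the existence and the uniqueness of the regularization work.\<close>

lemma prod_of_one:
  assumes "is_index k"
  shows "\<exists>R. mset (prod_of bt k [1]) = replicate_mset (Suc (trailing_ones k)) (1, k @ [1]) + mset R \<and>
    (\<forall>(c, w)\<in>set R. is_index w \<and> trailing_ones w \<le> trailing_ones k)"
  using assms
proof (induction k rule: rev_induct)
  case Nil
  have "index_of [True] = [1]" using index_of_word_of[of "[1]"] by simp
  thus ?case by (cases bt) (auto simp: sh_prod_def intro!: exI[of _ "[]"])
next
  case (snoc m k)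
  hence k: "is_index k" "m > 0" by auto
  obtain R where R: "mset (prod_of bt k [1]) = replicate_mset (Suc (trailing_ones k)) (1, k @ [1]) + mset R"
    "\<forall>(c, w)\<in>set R. is_index w \<and> trailing_ones w \<le> trailing_ones k"
    using snoc.IH k by blast
  show ?case
  proof (cases bt)
    case Harmonic
    have ind: "is_index w" if "(c, w) \<in> set (harm_prod k [1])" for c w
      using harm_prod_index[OF _ _ that] k by simp
    show ?thesis
    proof (cases "m = 1")
      case True
      show ?thesis unfolding True
        by (rule image_snoc_split[OF R, of _ "[(-1, k @ [2])]"])
           (use True Harmonic k in \<open>auto simp: harm_prod_snoc_one[of k 1, simplified]\<close>)
    next
      case False
      show ?thesis
        by (rule single_split[of _ _ _ "(-1, k @ [m + 1]) # map (\<lambda>(c, w). (c, w @ [m])) (harm_prod k [1])"])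
           (use False Harmonic k ind in \<open>auto simp: harm_prod_snoc_one[of k m, simplified]\<close>)
    qed
  next
    case Shuffle
    have good: "good_word w" if "w \<in> set (shuffle (word_of j) [True])" for w j
      by (rule good_word_shuffle[OF good_word_of _ that]) (simp add: good_word_def)
    show ?thesis
    proof (cases "m = 1")
      case True
      have 1: "index_of (word_of k @ [True, True]) = k @ [1, 1]"
        using index_of_word_of[of "k @ [1, 1]"] k by (simp add: word_of_def)
      have "mset (sh_prod (k @ [1]) [1])
          = add_mset (1, k @ [1, 1]) (image_mset (\<lambda>w. (1, index_of (w @ [True]))) (mset (shuffle (word_of k) [True])))"
        using shuffle_snoc_one[of "word_of k" True True] 1
        by (simp add: sh_prod_def multiset.map_comp o_def)
      also have "image_mset (\<lambda>w. (1 :: real, index_of (w @ [True]))) (mset (shuffle (word_of k) [True]))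
          = image_mset (\<lambda>(c, w). (c, w @ [1])) (mset (sh_prod k [1]))"
        by (auto simp: sh_prod_def multiset.map_comp o_def index_of_snoc_True good intro!: image_mset_cong)
      finally show ?thesis unfolding True
        using Shuffle by (intro image_snoc_split[OF R, of _ "[]"]) auto
    next
      case False
      \<comment> \<open>The word of \<open>k @ [m]\<close> is that of \<open>j\<close> followed by
        e_0, so inserting e_1 anywhere but at the end leaves a word ending in e_0.\<close>
      define j where "j = k @ [m - 1]"
      have w: "word_of (k @ [m]) = word_of j @ [False]"
        using word_of_snoc_Suc[of "m - 1" k] False k unfolding j_def by simp
      have 1: "index_of (word_of (k @ [m]) @ [True]) = k @ [m, 1]"
        using index_of_word_of[of "k @ [m, 1]"] k by (simp add: word_of_def)
      have ne: "w \<noteq> []" if "w \<in> set (shuffle (word_of j) [True])" for w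
        using that by (cases "word_of j") auto
      have "mset (sh_prod (k @ [m]) [1])
          = add_mset (1, k @ [m, 1]) (mset (map (\<lambda>w. (1, index_of (w @ [False]))) (shuffle (word_of j) [True])))"
        using shuffle_snoc_one[of "word_of j" False True] 1 w
        by (simp add: sh_prod_def multiset.map_comp o_def del: word_of_simps(2))
      thus ?thesis using Shuffle False good[of _ j] ne
        by (intro single_split[of _ _ _ "map (\<lambda>w. (1, index_of (w @ [False]))) (shuffle (word_of j) [True])"])
           (auto dest!: trailing_ones_snoc_False)
    qed
  qed
qed

section \<open>Regularization by sequences of characters\<close>

definition poly_lincomb :: "(nat list \<Rightarrow> real poly) \<Rightarrow> (real \<times> nat list) list \<Rightarrow> real poly" where
  "poly_lincomb Z R = (\<Sum>(c, w)\<leftarrow>R. smult c (Z w))"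

lemma poly_poly_lincomb: "poly (poly_lincomb Z R) x = lincomb (\<lambda>w. poly (Z w) x) R"
  by (induction R) (auto simp: poly_lincomb_def)

lemma lincomb_mset: "lincomb g R = sum_mset (image_mset (\<lambda>(c, w). c * g w) (mset R))"
  by (simp add: lincomb_def sum_mset_sum_list flip: mset_map)

lemma poly_lincomb_mset: "poly_lincomb g R = sum_mset (image_mset (\<lambda>(c, w). smult c (g w)) (mset R))"
  by (simp add: poly_lincomb_def sum_mset_sum_list flip: mset_map)

lemma lincomb_split:
  assumes "mset P = replicate_mset n (1, k) + mset R"
  shows "lincomb g P = real n * g k + lincomb g R"
  unfolding lincomb_mset assms by simp

lemma poly_lincomb_split:
  assumes "mset P = replicate_mset n (1, k) + mset R"
  shows "poly_lincomb g P = smult (real n) (g k) + poly_lincomb g R"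
  unfolding poly_lincomb_mset assms by (simp add: of_nat_poly)

lemma small_lincomb: "(\<And>c w. (c, w) \<in> set R \<Longrightarrow> small (\<lambda>n. g n w)) \<Longrightarrow> small (\<lambda>n. lincomb (g n) R)"
  unfolding lincomb_def by (intro small_sum_list) (auto intro: small_cmult)

text \<open>For an index, \<open>trailing_ones\<close> vanishes exactly in the admissible case; it
  measures the distance from convergence and drives the inductions below.\<close>

lemma index_cases:
  assumes "is_index k"
  shows "admissible k \<or> (\<exists>k'. k = k' @ [1] \<and> is_index k' \<and> trailing_ones k = Suc (trailing_ones k'))"
proof (cases k rule: rev_cases)
  case (snoc k' m)
  thus ?thesis using assms by (cases "m = 1") (auto simp: admissible_def)
qed (simp add: admissible_def)

text \<open>The product with \<open>[1]\<close> can be solved for its leading term, whose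
  coefficient is a positive integer. This reduces \<open>Z (k' @ [1])\<close> to values with fewer
  trailing ones, down to the prescribed admissible ones.\<close>

lemma reg_hom_unique:
  assumes "reg_hom bt Z" "reg_hom bt Z'" "is_index k"
  shows "Z k = Z' k"
  using assms(3)
proof (induction "trailing_ones k" arbitrary: k rule: less_induct)
  case less
  consider "admissible k" | k' where "k = k' @ [1]" "is_index k'" "trailing_ones k = Suc (trailing_ones k')"
    using index_cases[OF less.prems] by blast
  thus ?case
  proof cases
    case 1
    thus ?thesis using assms(1,2) less.prems by (simp add: reg_hom_def)
  next
    case k: 2
    obtain R where R: "mset (prod_of bt k' [1]) = replicate_mset (Suc (trailing_ones k')) (1, k' @ [1]) + mset R"
      "\<forall>(c, w)\<in>set R. is_index w \<and> trailing_ones w \<le> trailing_ones k'"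
      using prod_of_one[OF k(2)] by blast
    have *: "smult (real (Suc (trailing_ones k'))) (Y k) = Y k' * [:0, -1:] - poly_lincomb Y R"
      if "reg_hom bt Y" for Y
    proof -
      have "Y k' * Y [1] = poly_lincomb Y (prod_of bt k' [1])"
        using that[unfolded reg_hom_def, THEN conjunct2, THEN conjunct1, rule_format, of k' "[1]"] k(2)
        by (simp add: poly_lincomb_def)
      also have "\<dots> = smult (real (Suc (trailing_ones k'))) (Y k) + poly_lincomb Y R"
        unfolding k(1) by (rule poly_lincomb_split[OF R(1)])
      finally show ?thesis using that by (simp add: reg_hom_def)
    qed
    have "Z w = Z' w" if "(c, w) \<in> set R" for c w
      using R(2) that k(3) by (intro less.hyps) auto
    hence "poly_lincomb Z R = poly_lincomb Z' R"
      unfolding poly_lincomb_def by (intro arg_cong[where f = sum_list] map_cong) auto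
    moreover have "Z k' = Z' k'" using k by (intro less.hyps) auto
    ultimately have eq: "smult (real (Suc (trailing_ones k'))) (Z k) = smult (real (Suc (trailing_ones k'))) (Z' k)"
      using *[OF assms(1)] *[OF assms(2)] by (simp only:)
    define c where "c = real (Suc (trailing_ones k'))"
    have "c \<noteq> 0" by (simp add: c_def)
    thus ?thesis using arg_cong[OF eq[folded c_def], of "smult (1 / c)"] by simp
  qed
qed

text \<open>Data that determine a regularization: characters \<open>f n\<close> whose admissible
  values converge at a polynomial rate and whose value at \<open>[1]\<close> diverges slowly. The
  latter plays the role of \<open>T\<close>.\<close>

locale regulator =
  fixes bt :: prodtype and f :: "nat \<Rightarrow> nat list \<Rightarrow> real"
  assumes f_Nil: "f n [] = 1"
    and f_mult: "is_index k \<Longrightarrow> is_index l \<Longrightarrow>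
      signed (f n) k * signed (f n) l = lincomb (signed (f n)) (prod_of bt k l)"
    and f_admissible: "is_index k \<Longrightarrow> admissible k \<Longrightarrow> small (\<lambda>n. f n k - mzv k)"
    and f_one_at_top: "filterlim (\<lambda>n. f n [1]) at_top sequentially"
    and f_one_slow: "slow (\<lambda>n. f n [1])"
begin

text \<open>The sign is that of \<open>reg_hom\<close>, so \<open>q\<close> is a candidate for
  \<open>Z k\<close> itself and not for the zeta value.\<close>

definition expands :: "nat list \<Rightarrow> real poly \<Rightarrow> bool" where
  "expands k q \<longleftrightarrow> small (\<lambda>n. signed (f n) k - poly q (f n [1]))"

lemma poly_eqI_small:
  assumes "small (\<lambda>n. g n - poly p (f n [1]))" "small (\<lambda>n. g n - poly q (f n [1]))"
  shows "p = q"
proof -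
  have "small (\<lambda>n. poly (p - q) (f n [1]))"
    using small_diff[OF assms(2) assms(1)] by simp
  hence "p - q = 0" by (rule poly_eq_0_if_small[OF f_one_at_top])
  thus ?thesis by simp
qed

lemma expands_lincomb:
  assumes "\<And>c w. (c, w) \<in> set R \<Longrightarrow> expands w (Z w)"
  shows "small (\<lambda>n. lincomb (signed (f n)) R - poly (poly_lincomb Z R) (f n [1]))"
  unfolding poly_poly_lincomb lincomb_diff[symmetric]
  using assms by (intro small_lincomb) (auto simp: expands_def)

lemma expands_admissible:
  "is_index k \<Longrightarrow> admissible k \<Longrightarrow> expands k [:(-1) ^ length k * mzv k:]"
  using small_cmult[OF f_admissible, of k "(-1) ^ length k"]
  by (simp add: expands_def signed_def algebra_simps)

lemma expands_one: "expands [1] [:0, -1:]"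
  by (simp add: expands_def signed_def)

lemma expands_mult_one:
  assumes "expands k q"
  shows "small (\<lambda>n. signed (f n) k * signed (f n) [1] - poly (q * [:0, -1:]) (f n [1]))"
  using small_uminus[OF small_mult_slow[OF assms[unfolded expands_def] f_one_slow]]
  by (simp add: signed_def algebra_simps)

text \<open>The recursion of uniqueness, carried out on the numbers \<open>f n\<close>: the product
  with \<open>[1]\<close> is solved for \<open>k' @ [1]\<close>, and the errors stay small because
  \<open>f n [1]\<close> is slow.\<close>

lemma ex_expands: "is_index k \<Longrightarrow> \<exists>q. expands k q"
proof (induction "trailing_ones k" arbitrary: k rule: less_induct)
  case less
  consider "admissible k" | k' where "k = k' @ [1]" "is_index k'" "trailing_ones k = Suc (trailing_ones k')"
    using index_cases[OF less.prems] by blast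
  thus ?case
  proof cases
    case 1
    thus ?thesis using expands_admissible less.prems by blast
  next
    case k: 2
    obtain R where R: "mset (prod_of bt k' [1]) = replicate_mset (Suc (trailing_ones k')) (1, k' @ [1]) + mset R"
      "\<forall>(c, w)\<in>set R. is_index w \<and> trailing_ones w \<le> trailing_ones k'"
      using prod_of_one[OF k(2)] by blast
    define m where "m = real (Suc (trailing_ones k'))"
    have m: "m > 0" by (simp add: m_def)
    define Z where "Z w = (SOME q. expands w q)" for w
    have Z: "expands w (Z w)" if "is_index w" "trailing_ones w < trailing_ones k" for w
      unfolding Z_def using less.hyps[OF that(2,1)] by (rule someI_ex)
    have 1: "small (\<lambda>n. lincomb (signed (f n)) R - poly (poly_lincomb Z R) (f n [1]))"
      by (rule expands_lincomb, rule Z) (use R(2) k(3) in auto)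
    have "expands k' (Z k')" using k by (intro Z) auto
    note 2 = expands_mult_one[OF this]
    have 3: "signed (f n) k = (1 / m) * (signed (f n) k' * signed (f n) [1] - lincomb (signed (f n)) R)" for n
    proof -
      have "signed (f n) k' * signed (f n) [1] = m * signed (f n) k + lincomb (signed (f n)) R"
        unfolding m_def k(1)
        by (rule trans[OF f_mult lincomb_split[OF R(1)]]) (use k(2) in auto)
      thus ?thesis using m by (simp add: field_simps)
    qed
    have "expands k (smult (1 / m) (Z k' * [:0, -1:] - poly_lincomb Z R))"
      using small_cmult[OF small_diff[OF 2 1], of "1 / m"]
      unfolding expands_def 3 by (simp add: algebra_simps)
    thus ?thesis by blast
  qed
qed

definition reg :: "nat list \<Rightarrow> real poly" where
  "reg k = (SOME q. expands k q)"

lemma expands_reg: "is_index k \<Longrightarrow> expands k (reg k)"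
  unfolding reg_def by (rule someI_ex[OF ex_expands])

lemma expands_unique: "expands k p \<Longrightarrow> expands k q \<Longrightarrow> p = q"
  unfolding expands_def by (rule poly_eqI_small)

lemma signed_slow: "is_index k \<Longrightarrow> slow (\<lambda>n. signed (f n) k)"
  using slow_add[OF small_slow[OF expands_reg[of k, unfolded expands_def]] slow_poly[OF f_one_slow, of "reg k"]]
  by simp

text \<open>Each law holds because both sides expand the same sequence. For a product the error is
  split as \<open>(u - p) * v + p * (v - q)\<close> with \<open>v\<close> and \<open>p\<close>
  slow.\<close>

lemma reg_hom_reg: "reg_hom bt reg"
  unfolding reg_hom_def
proof (intro conjI allI impI)
  show "reg [] = 1"
    by (rule expands_unique[OF expands_reg]) (auto simp: expands_def f_Nil signed_def)
  show "reg [1] = [:0, -1:]"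
    by (rule expands_unique[OF expands_reg expands_one]) auto
  show "reg k = [:(-1) ^ length k * mzv k:]" if "is_index k" "admissible k" for k
    by (rule expands_unique[OF expands_reg expands_admissible]) (use that in auto)
  show "reg k * reg l = (\<Sum>(c, w)\<leftarrow>prod_of bt k l. smult c (reg w))"
    if kl: "is_index k" "is_index l" for k l
  proof -
    let ?\<tau> = "\<lambda>n. f n [1]"
    have "small (\<lambda>n. lincomb (signed (f n)) (prod_of bt k l) - poly (poly_lincomb reg (prod_of bt k l)) (?\<tau> n))"
      using expands_reg prod_of_index[OF kl] by (intro expands_lincomb) blast
    moreover have "small (\<lambda>n. lincomb (signed (f n)) (prod_of bt k l) - poly (reg k * reg l) (?\<tau> n))"
    proof -
      have "small (\<lambda>n. (signed (f n) k - poly (reg k) (?\<tau> n)) * signed (f n) l +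
          poly (reg k) (?\<tau> n) * (signed (f n) l - poly (reg l) (?\<tau> n)))"
        using expands_reg[unfolded expands_def] kl
        by (intro small_add small_mult_slow small_mult_slow' signed_slow slow_poly f_one_slow)
      thus ?thesis by (simp add: f_mult[OF kl, symmetric] algebra_simps)
    qed
    ultimately show ?thesis
      unfolding poly_lincomb_def[symmetric] by (rule poly_eqI_small[symmetric])
  qed
qed

text \<open>Existence and uniqueness of the homomorphism turn the definite description in
  \<open>zeta_reg\<close> into the constructed expansion.\<close>

lemma zeta_reg_eq:
  assumes "is_index k"
  shows "zeta_reg bt k = smult ((-1) ^ length k) (reg k)"
  unfolding zeta_reg_def
proof (rule the_equality)
  show "\<exists>Z. reg_hom bt Z \<and> smult ((-1) ^ length k) (reg k) = smult ((-1) ^ length k) (Z k)"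
    using reg_hom_reg by blast
next
  fix p assume "\<exists>Z. reg_hom bt Z \<and> p = smult ((-1) ^ length k) (Z k)"
  then obtain Z where Z: "reg_hom bt Z" "p = smult ((-1) ^ length k) (Z k)" by blast
  show "p = smult ((-1) ^ length k) (reg k)"
    unfolding Z(2) reg_hom_unique[OF Z(1) reg_hom_reg assms] by (rule refl)
qed

lemma zeta_reg_small:
  assumes "is_index k"
  shows "small (\<lambda>n. f n k - poly (zeta_reg bt k) (f n [1]))"
proof -
  have "f n k = (-1) ^ length k * signed (f n) k" for n
    by (simp add: signed_def power_mult_distrib[symmetric])
  thus ?thesis
    using small_cmult[OF expands_reg[OF assms, unfolded expands_def], of "(-1) ^ length k"]
    by (simp add: zeta_reg_eq[OF assms] algebra_simps)
qed

end

section \<open>The cyclic sum identity for finite chains\<close>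

text \<open>Weak chains with both ends prescribed. The telescoped weights see a chain only through
  its ends, so all terms are sorted by them.\<close>

fun pinned_sum :: "(nat \<Rightarrow> 'a::comm_ring_1) \<Rightarrow> nat \<Rightarrow> nat \<Rightarrow> nat list \<Rightarrow> 'a" where
  "pinned_sum x p q [] = 0"
| "pinned_sum x p q [k] = (if p = q then x p ^ k else 0)"
| "pinned_sum x p q (k # k' # ks) = x p ^ k * (\<Sum>n=p..q. pinned_sum x n q (k' # ks))"

lemma pinned_sum_Cons:
  "ks \<noteq> [] \<Longrightarrow> pinned_sum x p q (k # ks) = x p ^ k * (\<Sum>n=p..q. pinned_sum x n q ks)"
  by (cases ks) auto

lemma sum_triangle:
  fixes g :: "nat \<Rightarrow> nat \<Rightarrow> 'a::comm_monoid_add"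
  shows "(\<Sum>n=a..b. \<Sum>q=n..b. g n q) = (\<Sum>q=a..b. \<Sum>n=a..q. g n q)"
proof -
  have "(\<Sum>n=a..b. \<Sum>q=n..b. g n q) = (\<Sum>n=a..b. \<Sum>q | q \<in> {a..b} \<and> n \<le> q. g n q)"
    by (intro sum.cong refl) auto
  also have "\<dots> = (\<Sum>q=a..b. \<Sum>n | n \<in> {a..b} \<and> n \<le> q. g n q)"
    by (rule sum.swap_restrict) auto
  also have "\<dots> = (\<Sum>q=a..b. \<Sum>n=a..q. g n q)"
    by (intro sum.cong refl) auto
  finally show ?thesis .
qed

lemma star_sum_Cons_pinned:
  "p \<le> b \<Longrightarrow> x p ^ k * star_sum x p b ks = (\<Sum>q=p..b. pinned_sum x p q (k # ks))"
proof (induction ks arbitrary: p k)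
  case (Cons k' ks)
  have "star_sum x p b (k' # ks) = (\<Sum>n=p..b. \<Sum>q=n..b. pinned_sum x n q (k' # ks))"
    unfolding star_sum.simps by (intro sum.cong refl Cons.IH) auto
  also have "\<dots> = (\<Sum>q=p..b. \<Sum>n=p..q. pinned_sum x n q (k' # ks))"
    by (rule sum_triangle)
  finally show ?case by (simp only: pinned_sum.simps sum_distrib_left)
qed simp

lemma star_sum_pinned:
  "k \<noteq> [] \<Longrightarrow> star_sum x a b k = (\<Sum>p=a..b. \<Sum>q=p..b. pinned_sum x p q k)"
  by (cases k) (auto simp: star_sum_Cons_pinned intro!: sum.cong)

lemma star_sum_snoc:
  "star_sum x a b (ks @ [m]) = (\<Sum>n=a..b. star_sum x a n ks * x n ^ m)"
proof (induction ks arbitrary: a)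
  case (Cons k ks)
  have "star_sum x a b ((k # ks) @ [m]) = (\<Sum>n=a..b. \<Sum>q=n..b. x n ^ k * (star_sum x n q ks * x q ^ m))"
    by (simp only: append_Cons star_sum.simps Cons.IH sum_distrib_left)
  also have "\<dots> = (\<Sum>q=a..b. \<Sum>n=a..q. x n ^ k * (star_sum x n q ks * x q ^ m))"
    by (rule sum_triangle)
  finally show ?case by (simp only: star_sum.simps sum_distrib_right mult.assoc)
qed simp

lemma star_sum_snoc_pinned:
  "a \<le> b \<Longrightarrow> star_sum x a b ks * x b ^ k = (\<Sum>p=a..b. pinned_sum x p b (ks @ [k]))"
proof (induction ks arbitrary: a)
  case (Cons c ks)
  have "star_sum x a b (c # ks) * x b ^ k = (\<Sum>n=a..b. x n ^ c * (star_sum x n b ks * x b ^ k))"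
    by (simp only: star_sum.simps sum_distrib_right mult.assoc)
  also have "\<dots> = (\<Sum>n=a..b. x n ^ c * (\<Sum>p=n..b. pinned_sum x p b (ks @ [k])))"
    using Cons.IH by (intro sum.cong refl) simp
  finally show ?case by (simp add: pinned_sum_Cons)
qed simp

lemma star_sum_diag: "star_sum x a a k = x a ^ sum_list k"
  by (induction k) (simp_all add: power_add)

text \<open>Multiplication by \<open>v\<close> lowers the exponent of \<open>y\<close>,
  multiplication by \<open>u\<close> that of \<open>x\<close>, so the sum telescopes after
  multiplication by \<open>v - u\<close>. The inverses are given as data because the values are
  power series.\<close>

lemma power_diff_telescope:
  fixes x y c :: "'a::comm_ring_1"
  assumes "x * u = 1" "y * v = 1" "c * (v - u) = 1"
  shows "(\<Sum>j<m. x ^ (j + 1) * y ^ (m - j)) = c * (x ^ m - y ^ m)"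
proof -
  have tel: "(\<Sum>j<m. x ^ (j + 1) * y ^ (m - j)) * (v - u) = x ^ m - y ^ m"
  proof -
    have "x ^ (j + 1) * y ^ (m - j) * (v - u) = x ^ Suc j * y ^ (m - Suc j) - x ^ j * y ^ (m - j)" if "j < m" for j
    proof -
      have e: "y ^ (m - j) = y * y ^ (m - Suc j)"
        using that by (simp only: power_Suc[symmetric] Suc_diff_Suc)
      have "x ^ (j + 1) * y ^ (m - j) * (v - u)
          = x ^ Suc j * y ^ (m - Suc j) * (y * v) - x ^ j * y ^ (m - j) * (x * u)"
        by (simp only: e) (simp add: algebra_simps)
      thus ?thesis by (simp only: assms mult_1_right)
    qed
    hence "(\<Sum>j<m. x ^ (j + 1) * y ^ (m - j)) * (v - u)
        = (\<Sum>j<m. x ^ Suc j * y ^ (m - Suc j) - x ^ j * y ^ (m - j))"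
      unfolding sum_distrib_right by (intro sum.cong refl) auto
    also have "\<dots> = x ^ m - y ^ m"
      by (subst sum_lessThan_telescope) simp
    finally show ?thesis .
  qed
  have "(\<Sum>j<m. x ^ (j + 1) * y ^ (m - j)) = c * ((\<Sum>j<m. x ^ (j + 1) * y ^ (m - j)) * (v - u))"
    by (simp only: mult.left_commute[of c] assms(3) mult_1_right)
  thus ?thesis by (simp only: tel)
qed

definition rotation :: "nat \<Rightarrow> 'a list \<Rightarrow> 'a list" where
  "rotation i k = drop i k @ take i k"

lemma rotation_Cons: "1 \<le> i \<Longrightarrow> i \<le> length k \<Longrightarrow> k ! (i - 1) # drop i k @ take (i - 1) k = rotation (i - 1) k"
  using Cons_nth_drop_Suc[of "i - 1" k] by (simp add: rotation_def)

lemma rotation_snoc: "1 \<le> i \<Longrightarrow> i \<le> length k \<Longrightarrow> (drop i k @ take (i - 1) k) @ [k ! (i - 1)] = rotation i k"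
  using take_Suc_conv_app_nth[of "i - 1" k] by (simp add: rotation_def)

text \<open>Rotations by 0 and by the full length coincide, so the differences telescope to 0. Hence
  entries put back in front and entries put back at the end range over the same rotations.\<close>

lemma sum_rotation: "(\<Sum>i=1..length k. F (rotation (i - 1) k)) = (\<Sum>i=1..length k. F (rotation i k) :: 'a::comm_ring_1)"
proof -
  have "(\<Sum>i=1..length k. F (rotation (i - 1) k) - F (rotation i k)) = F (rotation 0 k) - F (rotation (length k) k)"
    using sum_Suc_diff'[of 0 "length k" "\<lambda>i. - F (rotation i k)"]
    by (simp add: sum.atLeast1_atMost_eq lessThan_atLeast0 algebra_simps)
  thus ?thesis by (simp add: rotation_def sum_subtractf)
qed

text \<open>The net weight of the chains from \<open>p\<close> to \<open>q\<close>. The first two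
  sums come from the telescoped left side, where a last position \<open>b\<close> or a first
  position \<open>a\<close> has lost its power; the other two are weights of the right side, with
  \<open>d\<close> and \<open>e\<close> still free.\<close>

definition cyclic_error ::
  "nat \<Rightarrow> (nat \<Rightarrow> nat \<Rightarrow> 'a::comm_ring_1) \<Rightarrow> (nat \<Rightarrow> 'a) \<Rightarrow> (nat \<Rightarrow> 'a) \<Rightarrow> nat \<Rightarrow> nat \<Rightarrow> 'a" where
  "cyclic_error B c d e p q = (\<Sum>b | b \<le> B \<and> p < b \<and> q \<le> b. c p b) - (\<Sum>a | a \<le> p \<and> a < q. c a q)
     - (\<Sum>a=0..p. d a) - (\<Sum>b=q..B. e b)"

text \<open>After telescoping, \<open>b\<close> carries no power of \<open>x\<close> and only bounds
  the chain from above, so it can be summed first for given ends \<open>p\<close> and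
  \<open>q\<close>.\<close>

lemma sum_first_part:
  "(\<Sum>a=0..B. \<Sum>b\<in>{a<..B}. c a b * (x a ^ m * star_sum x a b ks))
     = (\<Sum>p=0..B. \<Sum>q=p..B. pinned_sum x p q (m # ks) * (\<Sum>b | b \<le> B \<and> p < b \<and> q \<le> b. c p b))"
proof (rule sum.cong[OF refl])
  fix a assume "a \<in> {0..B}"
  have "(\<Sum>b\<in>{a<..B}. c a b * (x a ^ m * star_sum x a b ks))
      = (\<Sum>b\<in>{a<..B}. \<Sum>q | q \<in> {a..B} \<and> q \<le> b. c a b * pinned_sum x a q (m # ks))"
    by (intro sum.cong refl) (auto simp: star_sum_Cons_pinned sum_distrib_left intro!: sum.cong)
  also have "\<dots> = (\<Sum>q=a..B. \<Sum>b | b \<in> {a<..B} \<and> q \<le> b. c a b * pinned_sum x a q (m # ks))"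
    by (rule sum.swap_restrict) auto
  also have "\<dots> = (\<Sum>q=a..B. pinned_sum x a q (m # ks) * (\<Sum>b | b \<le> B \<and> a < b \<and> q \<le> b. c a b))"
    by (intro sum.cong refl) (auto simp: sum_distrib_left mult.commute intro!: sum.cong)
  finally show "(\<Sum>b\<in>{a<..B}. c a b * (x a ^ m * star_sum x a b ks)) = \<dots>" .
qed

text \<open>The mirror image: \<open>a\<close> survives only as a lower bound, and
  \<open>x b ^ m\<close> closes the chain.\<close>

lemma sum_second_part:
  "(\<Sum>a=0..B. \<Sum>b\<in>{a<..B}. c a b * (star_sum x a b ks * x b ^ m))
     = (\<Sum>p=0..B. \<Sum>q=p..B. pinned_sum x p q (ks @ [m]) * (\<Sum>a | a \<le> p \<and> a < q. c a q))"
proof -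
  have "(\<Sum>a=0..B. \<Sum>b\<in>{a<..B}. c a b * (star_sum x a b ks * x b ^ m))
      = (\<Sum>a=0..B. \<Sum>b | b \<in> {0..B} \<and> a < b. c a b * (star_sum x a b ks * x b ^ m))"
    by (intro sum.cong refl) auto
  also have "\<dots> = (\<Sum>b=0..B. \<Sum>a | a \<in> {0..B} \<and> a < b. c a b * (star_sum x a b ks * x b ^ m))"
    by (rule sum.swap_restrict) auto
  also have "\<dots> = (\<Sum>b=0..B. \<Sum>p=0..b. pinned_sum x p b (ks @ [m]) * (\<Sum>a | a \<le> p \<and> a < b. c a b))"
  proof (rule sum.cong[OF refl])
    fix b assume b: "b \<in> {0..B}"
    have "(\<Sum>a | a \<in> {0..B} \<and> a < b. c a b * (star_sum x a b ks * x b ^ m))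
        = (\<Sum>a\<in>{0..<b}. \<Sum>p | p \<in> {0..b} \<and> a \<le> p. c a b * pinned_sum x p b (ks @ [m]))"
      using b by (intro sum.cong) (auto simp: star_sum_snoc_pinned sum_distrib_left intro!: sum.cong)
    also have "\<dots> = (\<Sum>p=0..b. \<Sum>a | a \<in> {0..<b} \<and> a \<le> p. c a b * pinned_sum x p b (ks @ [m]))"
      by (rule sum.swap_restrict) auto
    also have "\<dots> = (\<Sum>p=0..b. pinned_sum x p b (ks @ [m]) * (\<Sum>a | a \<le> p \<and> a < b. c a b))"
      by (intro sum.cong refl) (auto simp: sum_distrib_left mult.commute intro!: sum.cong)
    finally show "(\<Sum>a | a \<in> {0..B} \<and> a < b. c a b * (star_sum x a b ks * x b ^ m)) = \<dots>" .
  qed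
  also have "\<dots> = (\<Sum>p=0..B. \<Sum>q=p..B. pinned_sum x p q (ks @ [m]) * (\<Sum>a | a \<le> p \<and> a < q. c a q))"
    by (rule sum_triangle[symmetric])
  finally show ?thesis .
qed

lemma sum_d_part:
  assumes "ks \<noteq> []"
  shows "(\<Sum>a=0..B. d a * star_sum x a B ks)
     = (\<Sum>p=0..B. \<Sum>q=p..B. pinned_sum x p q ks * (\<Sum>a=0..p. d a))"
proof -
  define D where "D p = sum d {0..p}" for p
  have "(\<Sum>a=0..B. d a * star_sum x a B ks)
      = (\<Sum>a=0..B. \<Sum>p=a..B. d a * (\<Sum>q=p..B. pinned_sum x p q ks))"
    using assms by (simp add: star_sum_pinned sum_distrib_left)
  also have "\<dots> = (\<Sum>p=0..B. \<Sum>a=0..p. d a * (\<Sum>q=p..B. pinned_sum x p q ks))"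
    by (rule sum_triangle)
  also have "\<dots> = (\<Sum>p=0..B. \<Sum>q=p..B. pinned_sum x p q ks * D p)"
  proof (rule sum.cong[OF refl])
    fix p
    have "(\<Sum>a=0..p. d a * (\<Sum>q=p..B. pinned_sum x p q ks)) = D p * (\<Sum>q=p..B. pinned_sum x p q ks)"
      unfolding D_def by (rule sum_distrib_right[symmetric])
    also have "\<dots> = (\<Sum>q=p..B. D p * pinned_sum x p q ks)" by (rule sum_distrib_left)
    finally show "(\<Sum>a=0..p. d a * (\<Sum>q=p..B. pinned_sum x p q ks)) = (\<Sum>q=p..B. pinned_sum x p q ks * D p)"
      by (simp only: mult.commute[of "D p"])
  qed
  finally show ?thesis unfolding D_def .
qed

lemma sum_e_part:
  assumes "ks \<noteq> []"
  shows "(\<Sum>b=0..B. star_sum x 0 b ks * e b)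
     = (\<Sum>p=0..B. \<Sum>q=p..B. pinned_sum x p q ks * (\<Sum>b=q..B. e b))"
proof -
  have "(\<Sum>b=0..B. star_sum x 0 b ks * e b)
      = (\<Sum>b=0..B. \<Sum>q=0..b. (\<Sum>p=0..q. pinned_sum x p q ks) * e b)"
    by (simp only: trans[OF star_sum_pinned[OF assms] sum_triangle] sum_distrib_right)
  also have "\<dots> = (\<Sum>q=0..B. \<Sum>b=q..B. (\<Sum>p=0..q. pinned_sum x p q ks) * e b)"
    by (rule sum_triangle[symmetric])
  also have "\<dots> = (\<Sum>q=0..B. \<Sum>p=0..q. pinned_sum x p q ks * (\<Sum>b=q..B. e b))"
    by (simp only: sum_distrib_left[symmetric]) (simp only: sum_distrib_right)
  finally show ?thesis by (simp only: sum_triangle)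
qed

text \<open>The first and last positions \<open>a\<close> and \<open>b\<close> carry the two parts
  of the split entry. If \<open>a = b\<close>, the whole chain is constant and every
  \<open>j\<close> gives the same power, which yields the multiple of
  \<open>star_sum x 0 B [sum_list k + 1]\<close>; if \<open>a < b\<close>, the sum over
  \<open>j\<close> telescopes. \<open>d\<close> and \<open>e\<close> are arbitrary, since what they
  add is subtracted in \<open>cyclic_error\<close>.\<close>

lemma star_sum_cyclic:
  fixes x :: "nat \<Rightarrow> 'a::comm_ring_1"
  assumes "\<And>i. i \<le> B \<Longrightarrow> x i * y i = 1"
    and "\<And>i j. i < j \<Longrightarrow> j \<le> B \<Longrightarrow> c i j * (y j - y i) = 1"
    and "k \<noteq> []"
  shows "(\<Sum>i=1..length k. \<Sum>j<k ! (i - 1).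
           star_sum x 0 B ([j + 1] @ drop i k @ take (i - 1) k @ [k ! (i - 1) - j]))
     = (\<Sum>i=1..length k. (\<Sum>a=0..B. d a * star_sum x a B (rotation i k))
          + (\<Sum>b=0..B. star_sum x 0 b (rotation i k) * e b))
       + of_nat (sum_list k) * star_sum x 0 B [sum_list k + 1]
       + (\<Sum>i=1..length k. \<Sum>p=0..B. \<Sum>q=p..B. pinned_sum x p q (rotation i k) * cyclic_error B c d e p q)"
proof -
  let ?s = "sum_list k"
  define U where "U p q = (\<Sum>b | b \<le> B \<and> p < b \<and> q \<le> b. c p b)" for p q
  define V where "V p q = (\<Sum>a | a \<le> p \<and> a < q. c a q)" for p q
  define P where "P F \<kappa> = (\<Sum>p=0..B. \<Sum>q=p..B. pinned_sum x p q \<kappa> * F p q)" for F :: "nat \<Rightarrow> nat \<Rightarrow> 'a" and \<kappa>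
  \<comment> \<open>One summand \<open>i\<close>: \<open>m\<close> is the entry that is split and
    \<open>\<kappa>\<close> the rest of the cycle.\<close>
  have step: "(\<Sum>j<m. star_sum x 0 B ([j + 1] @ \<kappa> @ [m - j]))
      = of_nat m * star_sum x 0 B [m + sum_list \<kappa> + 1] + P U (m # \<kappa>) - P V (\<kappa> @ [m])" for m \<kappa>
  proof -
    have "(\<Sum>j<m. star_sum x 0 B ([j + 1] @ \<kappa> @ [m - j]))
        = (\<Sum>j<m. \<Sum>a=0..B. \<Sum>b=a..B. star_sum x a b \<kappa> * (x a ^ (j + 1) * x b ^ (m - j)))"
      by (simp only: append_Cons append_Nil star_sum.simps star_sum_snoc sum_distrib_left mult.left_commute)
    also have "\<dots> = (\<Sum>a=0..B. \<Sum>b=a..B. \<Sum>j<m. star_sum x a b \<kappa> * (x a ^ (j + 1) * x b ^ (m - j)))"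
      by (subst sum.swap, rule sum.cong[OF refl], rule sum.swap)
    also have "\<dots> = (\<Sum>a=0..B. of_nat m * x a ^ (m + sum_list \<kappa> + 1)
        + (\<Sum>b\<in>{a<..B}. c a b * (x a ^ m * star_sum x a b \<kappa>)) - (\<Sum>b\<in>{a<..B}. c a b * (star_sum x a b \<kappa> * x b ^ m)))"
    proof (rule sum.cong[OF refl])
      fix a assume a: "a \<in> {0..B}"
      have split: "{a..B} = insert a {a<..B}" using a by auto
      have diag: "(\<Sum>j<m. star_sum x a a \<kappa> * (x a ^ (j + 1) * x a ^ (m - j))) = of_nat m * x a ^ (m + sum_list \<kappa> + 1)"
      proof -
        have "star_sum x a a \<kappa> * (x a ^ (j + 1) * x a ^ (m - j)) = x a ^ (m + sum_list \<kappa> + 1)" if "j < m" for j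
        proof -
          have "sum_list \<kappa> + ((j + 1) + (m - j)) = m + sum_list \<kappa> + 1" using that by simp
          thus ?thesis by (simp only: star_sum_diag power_add[symmetric])
        qed
        thus ?thesis by simp
      qed
      have off: "(\<Sum>j<m. star_sum x a b \<kappa> * (x a ^ (j + 1) * x b ^ (m - j)))
          = c a b * (x a ^ m * star_sum x a b \<kappa>) - c a b * (star_sum x a b \<kappa> * x b ^ m)" if "b \<in> {a<..B}" for b
      proof -
        have "(\<Sum>j<m. x a ^ (j + 1) * x b ^ (m - j)) = c a b * (x a ^ m - x b ^ m)"
          using that a by (intro power_diff_telescope[of _ "y a" _ "y b"] assms) auto
        thus ?thesis by (simp only: sum_distrib_left[symmetric]) (simp add: algebra_simps)
      qed
      show "(\<Sum>b=a..B. \<Sum>j<m. star_sum x a b \<kappa> * (x a ^ (j + 1) * x b ^ (m - j)))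
          = of_nat m * x a ^ (m + sum_list \<kappa> + 1)
        + (\<Sum>b\<in>{a<..B}. c a b * (x a ^ m * star_sum x a b \<kappa>)) - (\<Sum>b\<in>{a<..B}. c a b * (star_sum x a b \<kappa> * x b ^ m))"
        unfolding split by (simp add: diag[simplified] off[simplified] sum_subtractf)
    qed
    also have "\<dots> = of_nat m * star_sum x 0 B [m + sum_list \<kappa> + 1] + P U (m # \<kappa>) - P V (\<kappa> @ [m])"
      unfolding P_def U_def V_def sum_first_part[symmetric] sum_second_part[symmetric]
      by (simp add: sum_subtractf sum.distrib sum_distrib_left)
    finally show ?thesis .
  qed
  have rot: "rotation i k \<noteq> []" for i
  proof -
    have "length (rotation i k) = length k" by (simp add: rotation_def)
    thus ?thesis using assms(3) by auto
  qed
  have "(\<Sum>i=1..length k. \<Sum>j<k ! (i - 1).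
           star_sum x 0 B ([j + 1] @ drop i k @ take (i - 1) k @ [k ! (i - 1) - j]))
     = (\<Sum>i=1..length k. of_nat (k ! (i - 1)) * star_sum x 0 B [?s + 1] + P U (rotation (i - 1) k) - P V (rotation i k))"
  proof (rule sum.cong[OF refl])
    fix i assume "i \<in> {1..length k}"
    hence i: "1 \<le> i" "i \<le> length k" by auto
    have "sum_list (k ! (i - 1) # drop i k @ take (i - 1) k) = ?s"
      unfolding rotation_Cons[OF i] rotation_def
      using sum_list.append[of "take (i - 1) k" "drop (i - 1) k"] by (simp add: add.commute)
    hence s: "k ! (i - 1) + sum_list (drop i k @ take (i - 1) k) = ?s" by simp
    show "(\<Sum>j<k ! (i - 1). star_sum x 0 B ([j + 1] @ drop i k @ take (i - 1) k @ [k ! (i - 1) - j]))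
        = of_nat (k ! (i - 1)) * star_sum x 0 B [?s + 1] + P U (rotation (i - 1) k) - P V (rotation i k)"
      using step[where m = "k ! (i - 1)" and \<kappa> = "drop i k @ take (i - 1) k"]
      unfolding rotation_Cons[OF i] rotation_snoc[OF i] s by (simp only: append_assoc)
  qed
  also have "\<dots> = (\<Sum>i=1..length k. of_nat (k ! (i - 1))) * star_sum x 0 B [?s + 1]
      + (\<Sum>i=1..length k. P U (rotation i k) - P V (rotation i k))"
    by (simp only: sum.distrib sum_subtractf sum_rotation sum_distrib_right add_diff_eq)
  also have "(\<Sum>i=1..length k. of_nat (k ! (i - 1))) = (of_nat ?s :: 'a)"
    by (simp add: sum.atLeast1_atMost_eq sum_list_sum_nth atLeast0LessThan)
  also have "(\<Sum>i=1..length k. P U (rotation i k) - P V (rotation i k))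
      = (\<Sum>i=1..length k. P (\<lambda>p q. \<Sum>a=0..p. d a) (rotation i k) + P (\<lambda>p q. \<Sum>b=q..B. e b) (rotation i k))
        + (\<Sum>i=1..length k. P (cyclic_error B c d e) (rotation i k))"
    unfolding P_def cyclic_error_def U_def V_def sum.distrib[symmetric] sum_subtractf[symmetric]
    by (intro sum.cong refl) (simp add: algebra_simps)
  finally show ?thesis
    unfolding P_def sum_d_part[OF rot] sum_e_part[OF rot] by (simp only: add_ac)
qed

section \<open>Chains of shifted reciprocals\<close>

unbundle no vec_syntax
unbundle fps_syntax

text \<open>The expansion of \<open>1 / (m - \<epsilon> X)\<close>: for
  \<open>\<epsilon> = -1\<close> the value \<open>1/(m + s)\<close> of a positive position, for
  \<open>\<epsilon> = 1\<close> minus the value \<open>1/(-m + t)\<close> of a negative one.\<close>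

definition geom :: "real \<Rightarrow> nat \<Rightarrow> real fps" where
  "geom \<epsilon> m = Abs_fps (\<lambda>a. \<epsilon> ^ a / real m ^ (a + 1))"

lemma geom_inverse:
  assumes "m > 0"
  shows "geom \<epsilon> m * (fps_const (real m) - fps_const \<epsilon> * fps_X) = 1"
proof (rule fps_ext)
  fix n
  have "geom \<epsilon> m * (fps_const (real m) - fps_const \<epsilon> * fps_X)
      = fps_const (real m) * geom \<epsilon> m - fps_const \<epsilon> * (geom \<epsilon> m * fps_X)"
    by (simp add: algebra_simps)
  thus "(geom \<epsilon> m * (fps_const (real m) - fps_const \<epsilon> * fps_X)) $ n = 1 $ n"
    using assms by (cases n) (simp_all add: geom_def)
qed

lemma geom_nth: "geom \<epsilon> m $ a = \<epsilon> ^ a / real m ^ (a + 1)"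
  by (simp add: geom_def)

text \<open>The negative binomial series. Its coefficients are the factors of \<open>bcoef\<close>,
  which is why shifted values are chain sums of shifted reciprocals.\<close>

lemma geom_power_nth:
  "(geom \<epsilon> m ^ k) $ a = \<epsilon> ^ a * real ((k + a - 1) choose a) / real m ^ (k + a)"
proof (induction k arbitrary: a)
  case 0
  show ?case by (cases a) simp_all
next
  case (Suc k)
  have hockey: "(\<Sum>i\<le>a. (k + i - 1) choose i) = (k + a) choose a"
  proof (cases k)
    case 0
    \<comment> \<open>Subtraction is truncated: \<open>(i - 1) choose i\<close> is 1 at
      \<open>i = 0\<close> and 0 afterwards.\<close>
    have "(\<Sum>i\<le>a. (i - 1) choose i) = (\<Sum>i\<le>a. if i = 0 then 1 else 0)"
      by (intro sum.cong refl) auto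
    thus ?thesis using 0 by (simp add: sum.delta)
  next
    case (Suc r)
    thus ?thesis using sum_choose_lower[of r a] by simp
  qed
  have "(geom \<epsilon> m ^ Suc k) $ a = (\<Sum>i=0..a. (geom \<epsilon> m ^ k) $ i * geom \<epsilon> m $ (a - i))"
    by (simp only: power_Suc2 fps_mult_nth)
  also have "\<dots> = (\<Sum>i=0..a. \<epsilon> ^ a / real m ^ (Suc k + a) * real ((k + i - 1) choose i))"
  proof (rule sum.cong[OF refl])
    fix i assume "i \<in> {0..a}"
    hence e: "\<epsilon> ^ a = \<epsilon> ^ i * \<epsilon> ^ (a - i)" "real m ^ (Suc k + a) = real m ^ (k + i) * real m ^ (a - i + 1)"
      by (simp_all flip: power_add)
    show "(geom \<epsilon> m ^ k) $ i * geom \<epsilon> m $ (a - i)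
        = \<epsilon> ^ a / real m ^ (Suc k + a) * real ((k + i - 1) choose i)"
      unfolding Suc.IH geom_nth e by (simp add: mult_ac)
  qed
  also have "\<dots> = \<epsilon> ^ a / real m ^ (Suc k + a) * real (\<Sum>i\<le>a. (k + i - 1) choose i)"
    by (simp add: sum_distrib_left atLeast0AtMost)
  finally show ?case by (simp only: hockey) simp
qed

text \<open>The sum behind \<open>shift_coef\<close> for an arbitrary functional \<open>g\<close>,
  so that truncated and regularized values can be compared.\<close>

definition shift_sum :: "(nat list \<Rightarrow> real) \<Rightarrow> nat list \<Rightarrow> nat \<Rightarrow> real" where
  "shift_sum g k m =
     (\<Sum>n\<in>{n. length n = length k \<and> sum_list n = m}. bcoef k n * g (map2 (+) k n))"

lemma compositions_Suc:
  "{n::nat list. length n = Suc r \<and> sum_list n = m}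
     = (\<Union>j\<in>{..m}. (#) j ` {n. length n = r \<and> sum_list n = m - j})"
  by (auto simp: length_Suc_conv image_iff)

lemma finite_compositions: "finite {n::nat list. length n = r \<and> sum_list n = m}"
proof (induction r arbitrary: m)
  case 0
  have "{n::nat list. length n = 0 \<and> sum_list n = m} \<subseteq> {[]}" by auto
  thus ?case by (rule finite_subset) simp
qed (simp add: compositions_Suc)

lemma bcoef_Cons: "bcoef (k # ks) (j # n) = real ((k + j - 1) choose j) * bcoef ks n"
  by (simp add: bcoef_def prod.lessThan_Suc_shift del: prod.lessThan_Suc)

lemma shift_sum_Nil: "shift_sum g [] m = (if m = 0 then g [] else 0)"
proof -
  have "{n::nat list. length n = length ([] :: nat list) \<and> sum_list n = m} = (if m = 0 then {[]} else {})"
    by auto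
  thus ?thesis by (simp add: shift_sum_def bcoef_def)
qed

lemma shift_sum_Cons:
  "shift_sum g (k # ks) m
     = (\<Sum>j\<le>m. real ((k + j - 1) choose j) * shift_sum (\<lambda>l. g ((k + j) # l)) ks (m - j))"
proof -
  have "shift_sum g (k # ks) m = (\<Sum>j\<le>m. \<Sum>n\<in>(#) j ` {n. length n = length ks \<and> sum_list n = m - j}.
      bcoef (k # ks) n * g (map2 (+) (k # ks) n))"
    unfolding shift_sum_def list.size(4) add_Suc_right add_0_right Nat.add_0_right One_nat_def compositions_Suc
    by (rule sum.UNION_disjoint) (auto simp: finite_compositions)
  also have "\<dots> = (\<Sum>j\<le>m. real ((k + j - 1) choose j) * shift_sum (\<lambda>l. g ((k + j) # l)) ks (m - j))"
    by (intro sum.cong refl, subst sum.reindex)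
       (simp_all add: inj_on_def shift_sum_def bcoef_Cons sum_distrib_left mult.assoc)
  finally show ?thesis .
qed

lemma shift_sum_add: "shift_sum (\<lambda>l. g l + h l) k m = shift_sum g k m + shift_sum h k m"
  by (simp add: shift_sum_def algebra_simps sum.distrib)

lemma shift_sum_cmult: "shift_sum (\<lambda>l. c * g l) k m = c * shift_sum g k m"
  by (simp add: shift_sum_def sum_distrib_left mult.left_commute)

text \<open>Every power along a chain is expanded separately; the increments of the exponents form
  the tuple summed over in the shift.\<close>

lemma chain_sum_geom_nth:
  "chain_sum (map (geom \<epsilon>) ms) k $ a = \<epsilon> ^ a * shift_sum (chain_sum (map (\<lambda>m. 1 / real m) ms)) k a"
proof (induction ms arbitrary: k a)
  case Nil
  have "shift_sum (\<lambda>l. 0) ks n = 0" for ks n by (simp add: shift_sum_def)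
  thus ?case by (cases k) (simp_all add: shift_sum_Nil shift_sum_Cons)
next
  case IH: (Cons m ms)
  show ?case
  proof (cases k)
    case Nil
    thus ?thesis by (simp add: shift_sum_Nil)
  next
    case (Cons k1 ks)
    let ?g = "chain_sum (map (\<lambda>m. 1 / real m) ms)"
    let ?g' = "chain_sum (map (\<lambda>m. 1 / real m) (m # ms))"
    have "chain_sum (map (geom \<epsilon>) (m # ms)) (k1 # ks) $ a
        = \<epsilon> ^ a * shift_sum ?g (k1 # ks) a
          + (\<Sum>j\<le>a. (geom \<epsilon> m ^ k1) $ j * (\<epsilon> ^ (a - j) * shift_sum ?g ks (a - j)))"
      by (simp add: IH.IH fps_mult_nth atLeast0AtMost)
    also have "(\<Sum>j\<le>a. (geom \<epsilon> m ^ k1) $ j * (\<epsilon> ^ (a - j) * shift_sum ?g ks (a - j)))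
        = \<epsilon> ^ a * (\<Sum>j\<le>a. real ((k1 + j - 1) choose j) * ((1 / real m) ^ (k1 + j) * shift_sum ?g ks (a - j)))"
      unfolding sum_distrib_left
    proof (rule sum.cong[OF refl])
      fix j assume "j \<in> {..a}"
      hence "\<epsilon> ^ a = \<epsilon> ^ j * \<epsilon> ^ (a - j)" by (simp flip: power_add)
      thus "(geom \<epsilon> m ^ k1) $ j * (\<epsilon> ^ (a - j) * shift_sum ?g ks (a - j))
          = \<epsilon> ^ a * (real ((k1 + j - 1) choose j) * ((1 / real m) ^ (k1 + j) * shift_sum ?g ks (a - j)))"
        by (simp add: geom_power_nth power_divide)
    qed
    also have "\<epsilon> ^ a * shift_sum ?g (k1 # ks) a + \<dots> = \<epsilon> ^ a * shift_sum ?g' (k1 # ks) a"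
      by (simp add: shift_sum_Cons shift_sum_add shift_sum_cmult algebra_simps sum.distrib)
    finally show ?thesis by (simp only: Cons)
  qed
qed

text \<open>The outer variable is \<open>s\<close>, the inner one \<open>t\<close>: series in
  \<open>s\<close> enter through \<open>lift_s\<close>, series in \<open>t\<close> through
  \<open>fps_const\<close>.\<close>

definition lift_s :: "real fps \<Rightarrow> real fps fps" where
  "lift_s F = Abs_fps (\<lambda>a. fps_const (F $ a))"

lemma lift_s_nth [simp]: "lift_s F $ a = fps_const (F $ a)"
  by (simp add: lift_s_def)

lemma lift_s_add: "lift_s (F + G) = lift_s F + lift_s G"
  and lift_s_1: "lift_s 1 = 1" and lift_s_0: "lift_s 0 = 0"
  and lift_s_const: "lift_s (fps_const c) = fps_const (fps_const c)"
  and lift_s_X: "lift_s fps_X = fps_X"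
  by (rule fps_ext; simp)+

lemma fps_const_sum: "fps_const (sum f A) = (\<Sum>x\<in>A. fps_const (f x))"
  by (induction A rule: infinite_finite_induct) (simp_all add: fps_const_add[symmetric] del: fps_const_add)

lemma lift_s_mult: "lift_s (F * G) = lift_s F * lift_s G"
  by (rule fps_ext) (simp add: fps_mult_nth fps_const_sum)

definition rec :: "nat \<Rightarrow> real fps fps" where
  "rec n = fps_const (fps_const (1 / real n))"

text \<open>The inverse of \<open>m + s - t\<close>, expanded in \<open>s\<close> over powers of
  \<open>1/(m - t)\<close>.\<close>

definition mixed_rec :: "nat \<Rightarrow> real fps fps" where
  "mixed_rec m = Abs_fps (\<lambda>a. (-1) ^ a * geom 1 m ^ (a + 1))"

lemma of_nat_fps_const2: "of_nat n = (fps_const (fps_const (real n)) :: real fps fps)"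
  by (simp add: fps_of_nat)

lemma mixed_rec_inverse:
  assumes "m > 0"
  shows "mixed_rec m * (of_nat m + fps_X - fps_const fps_X) = 1"
proof -
  let ?u = "fps_const (real m) - fps_X :: real fps"
  have u: "geom 1 m * ?u = 1"
    using geom_inverse[OF assms, of 1] by simp
  have eq: "mixed_rec m * (of_nat m + fps_X - fps_const fps_X) = fps_const ?u * mixed_rec m + mixed_rec m * fps_X"
    by (simp add: of_nat_fps_const2 algebra_simps fps_const_sub[symmetric] del: fps_const_sub)
  show ?thesis
  proof (rule fps_ext)
    fix n
    have c: "?u * ((-1) ^ a * geom 1 m ^ (a + 1)) = (-1) ^ a * geom 1 m ^ a" for a
    proof -
      have "?u * ((-1) ^ a * geom 1 m ^ (a + 1)) = (-1) ^ a * geom 1 m ^ a * (geom 1 m * ?u)"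
        by (simp add: mult_ac)
      thus ?thesis by (simp only: u mult_1_right)
    qed
    show "(mixed_rec m * (of_nat m + fps_X - fps_const fps_X)) $ n = 1 $ n"
      unfolding eq using c[of n] by (cases n) (simp_all add: mixed_rec_def)
  qed
qed

lemma rec_inverse: "n > 0 \<Longrightarrow> rec n * of_nat n = 1"
  by (simp add: rec_def of_nat_fps_const2)

text \<open>The positions \<open>1 < 2 < \<dots> < N < -M < \<dots> < -1\<close> are encoded as \<open>0, \<dots>, N + M - 1\<close>.\<close>

definition pos_val :: "nat \<Rightarrow> nat \<Rightarrow> nat \<Rightarrow> real fps fps" where
  "pos_val N M i = (if i < N then lift_s (geom (-1) (i + 1)) else - fps_const (geom 1 (N + M - i)))"

definition pos_den :: "nat \<Rightarrow> nat \<Rightarrow> nat \<Rightarrow> real fps fps" where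
  "pos_den N M i = (if i < N then of_nat (i + 1) + fps_X else fps_const fps_X - of_nat (N + M - i))"

text \<open>The inverse of a difference of denominators. Inside a block the variable cancels and a
  rational number is left; across the blocks it is \<open>-1/(m + s - t)\<close> with
  \<open>m\<close> the sum of the absolute values.\<close>

definition pos_diff :: "nat \<Rightarrow> nat \<Rightarrow> nat \<Rightarrow> nat \<Rightarrow> real fps fps" where
  "pos_diff N M i j = (if j < N \<or> N \<le> i then rec (j - i) else - mixed_rec (N + M - j + (i + 1)))"

text \<open>The choice of \<open>d\<close>, and below of \<open>e\<close>: \<open>1/(y - t)\<close>
  and \<open>1/(y - s)\<close> for the denominator \<open>y\<close> of a position. These are inverse
  differences to virtual positions 0 of the negative and of the positive block, and also the sums of
  the geometric series over \<open>j\<close> in the formula.\<close>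

definition pos_first :: "nat \<Rightarrow> nat \<Rightarrow> nat \<Rightarrow> real fps fps" where
  "pos_first N M i = (if i < N then mixed_rec (i + 1) else - rec (N + M - i))"

definition pos_last :: "nat \<Rightarrow> nat \<Rightarrow> nat \<Rightarrow> real fps fps" where
  "pos_last N M i = (if i < N then rec (i + 1) else - mixed_rec (N + M - i))"

definition pos_error :: "nat \<Rightarrow> nat \<Rightarrow> nat \<Rightarrow> nat \<Rightarrow> real fps fps" where
  "pos_error N M = cyclic_error (N + M - 1) (pos_diff N M) (pos_first N M) (pos_last N M)"

lemma pos_val_den:
  assumes "i < N + M"
  shows "pos_val N M i * pos_den N M i = 1"
proof (cases "i < N")
  case True
  have "lift_s (geom (-1) (i + 1) * (fps_const (real (i + 1)) - fps_const (-1) * fps_X)) = 1"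
    by (subst geom_inverse) (simp_all add: lift_s_1)
  hence "lift_s (geom (-1) (i + 1)) * (fps_const (fps_const (real (i + 1))) + fps_X) = 1"
    by (simp add: lift_s_mult lift_s_add lift_s_const lift_s_X del: of_nat_Suc of_nat_add flip: fps_const_neg)
  thus ?thesis using True by (simp only: pos_val_def pos_den_def of_nat_fps_const2 if_True)
next
  case False
  hence "fps_const (geom 1 (N + M - i) * (fps_const (real (N + M - i)) - fps_const 1 * fps_X)) = 1"
    using assms by (subst geom_inverse) simp_all
  thus ?thesis using False
    by (simp add: pos_val_def pos_den_def of_nat_fps_const2 algebra_simps fps_const_mult[symmetric]
        fps_const_sub[symmetric] del: fps_const_mult fps_const_sub of_nat_diff)
qed

lemma pos_diff_den:
  assumes "i < j" "j < N + M"
  shows "pos_diff N M i j * (pos_den N M j - pos_den N M i) = 1"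
proof -
  consider "j < N" | "N \<le> i" | "i < N" "N \<le> j" by linarith
  thus ?thesis
  proof cases
    case 1
    have "pos_den N M j - pos_den N M i = of_nat (j - i)"
      using 1 assms by (simp add: pos_den_def of_nat_diff)
    thus ?thesis using 1 assms rec_inverse[of "j - i"] by (simp add: pos_diff_def)
  next
    case 2
    have "pos_den N M j - pos_den N M i = of_nat (j - i)"
      using 2 assms by (simp add: pos_den_def of_nat_diff)
    thus ?thesis using 2 assms rec_inverse[of "j - i"] by (simp add: pos_diff_def)
  next
    case 3
    have "pos_den N M j - pos_den N M i = - (of_nat (N + M - j + (i + 1)) + fps_X - fps_const fps_X)"
      using 3 by (simp add: pos_den_def)
    moreover have "pos_diff N M i j = - mixed_rec (N + M - j + (i + 1))"
      using 3 by (simp add: pos_diff_def)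
    ultimately show ?thesis
      by (simp only: minus_mult_minus) (rule mixed_rec_inverse, simp)
  qed
qed

lemma pos_first_den:
  assumes "i < N + M"
  shows "pos_first N M i * (pos_den N M i - fps_const fps_X) = 1"
  using assms mixed_rec_inverse[of "i + 1"] rec_inverse[of "N + M - i"]
  by (auto simp: pos_first_def pos_den_def simp del: of_nat_diff of_nat_add of_nat_Suc)

lemma pos_last_den:
  assumes "i < N + M"
  shows "pos_last N M i * (pos_den N M i - fps_X) = 1"
proof (cases "i < N")
  case True
  thus ?thesis using rec_inverse[of "i + 1"]
    by (simp add: pos_last_def pos_den_def del: of_nat_add of_nat_Suc)
next
  case False
  have "pos_den N M i - fps_X = - (of_nat (N + M - i) + fps_X - fps_const fps_X)"
    using False by (simp add: pos_den_def)
  moreover have "pos_last N M i = - mixed_rec (N + M - i)"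
    using False by (simp add: pos_last_def)
  ultimately show ?thesis using assms
    by (simp only: minus_mult_minus) (rule mixed_rec_inverse, simp)
qed

definition psum :: "(nat \<Rightarrow> 'a::comm_ring_1) \<Rightarrow> nat \<Rightarrow> 'a" where
  "psum h n = (\<Sum>m=1..n. h m)"

lemma psum_simps [simp]: "psum h 0 = 0" "psum h (Suc n) = psum h n + h (Suc n)"
  by (simp_all add: psum_def)

lemma psum_diff_up:
  assumes "p < u" "u \<le> v"
  shows "(\<Sum>b\<in>{u..<v}. h (b - p)) = psum h (v - 1 - p) - psum h (u - 1 - p)"
  using assms(2)
proof (induction v rule: dec_induct)
  case (step v)
  have "v - p = Suc (v - 1 - p)" using step assms(1) by simp
  thus ?case using step by simp
qed simp

lemma psum_diff_down:
  assumes "u \<le> v" "v \<le> L"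
  shows "(\<Sum>b\<in>{u..<v}. h (L - b + w)) = psum h (L - u + w) - psum h (L - v + w)"
  using assms
proof (induction v rule: dec_induct)
  case (step v)
  have "L - v + w = Suc (L - Suc v + w)" using step by simp
  thus ?case using step by simp
qed simp

lemma psum_shift: "u \<le> v \<Longrightarrow> (\<Sum>a\<in>{u..<v}. h (w + (a + 1))) = psum h (v + w) - psum h (u + w)"
  by (induction v rule: dec_induct) (simp_all add: add.commute)

text \<open>All four weights are partial sums of \<open>rec\<close> or \<open>mixed_rec\<close>, and
  the end \<open>q\<close> cancels. There remain \<open>p + 1\<close> reciprocals up to
  \<open>N\<close> and \<open>p + 1\<close> mixed ones beyond \<open>M\<close>.\<close>

lemma pos_error_pos:
  assumes "p \<le> q" "q < N"
  shows "pos_error N M p q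
    = psum rec (N - (p + 1)) - psum rec N - (psum mixed_rec (M + (p + 1)) - psum mixed_rec M)"
proof -
  let ?L = "N + M"
  let ?U = "\<Sum>b | b \<le> N + M - 1 \<and> p < b \<and> q \<le> b. pos_diff N M p b"
  let ?V = "\<Sum>a | a \<le> p \<and> a < q. pos_diff N M a q"
  let ?D = "\<Sum>a=0..p. pos_first N M a"
  let ?E = "\<Sum>b=q..N + M - 1. pos_last N M b"
  \<comment> \<open>\<open>u\<close> and \<open>w\<close> absorb the strict inequalities, which
    matter only for \<open>p = q\<close>.\<close>
  define u w where "u = max q (p + 1)" and "w = min (p + 1) q"
  have u: "p < u" "u \<le> N" "u - 1 - p = q - (p + 1)" using assms by (auto simp: u_def)
  have w: "w \<le> q" "q - w = q - (p + 1)" using assms by (auto simp: w_def)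
  have "{b. b \<le> N + M - 1 \<and> p < b \<and> q \<le> b} = {u..<N} \<union> {N..<?L}"
    using assms by (auto simp: u_def)
  hence "?U = (\<Sum>b\<in>{u..<N}. rec (b - p)) - (\<Sum>b\<in>{N..<?L}. mixed_rec (?L - b + (p + 1)))"
    using assms by (simp add: sum.union_disjoint pos_diff_def sum_negf[symmetric])
  hence U: "?U = psum rec (N - (p + 1)) - psum rec (q - (p + 1)) - (psum mixed_rec (M + (p + 1)) - psum mixed_rec (p + 1))"
    using psum_diff_up[OF u(1,2), of rec] psum_diff_down[of N ?L ?L mixed_rec "p + 1"] by (simp add: u(3)[simplified])
  have "{a. a \<le> p \<and> a < q} = {0..<w}" by (auto simp: w_def)
  hence "?V = (\<Sum>a\<in>{0..<w}. rec (q - a + 0))"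
    using assms by (simp add: pos_diff_def)
  hence V: "?V = psum rec q - psum rec (q - (p + 1))"
    by (subst (asm) psum_diff_down) (use w in auto)
  have "?D = (\<Sum>a\<in>{0..<p + 1}. mixed_rec (0 + (a + 1)))"
    using assms by (intro sum.cong) (auto simp: pos_first_def)
  hence D: "?D = psum mixed_rec (p + 1)"
    by (subst (asm) psum_shift) auto
  have "{q..N + M - 1} = {q..<N} \<union> {N..<?L}" using assms by auto
  hence "?E = (\<Sum>b\<in>{q..<N}. rec (0 + (b + 1))) - (\<Sum>b\<in>{N..<?L}. mixed_rec (?L - b + 0))"
    by (simp add: sum.union_disjoint pos_last_def sum_negf[symmetric])
  hence E: "?E = psum rec N - psum rec q - psum mixed_rec M"
    by (subst (asm) psum_shift, use assms in simp, subst (asm) psum_diff_down) auto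
  show ?thesis unfolding pos_error_def cyclic_error_def U V D E by (simp add: algebra_simps)
qed

text \<open>Every weight is here a difference of partial sums of \<open>mixed_rec\<close>, at
  \<open>p + 1\<close>, at \<open>N + M - q\<close> and at their sum, and each of these occurs twice
  with opposite signs. The weights \<open>pos_first\<close> and \<open>pos_last\<close> are chosen
  for this cancellation.\<close>

lemma pos_error_mixed:
  assumes "p < N" "N \<le> q" "q < N + M"
  shows "pos_error N M p q = 0"
proof -
  let ?L = "N + M"
  let ?U = "\<Sum>b | b \<le> N + M - 1 \<and> p < b \<and> q \<le> b. pos_diff N M p b"
  let ?V = "\<Sum>a | a \<le> p \<and> a < q. pos_diff N M a q"
  let ?D = "\<Sum>a=0..p. pos_first N M a"
  let ?E = "\<Sum>b=q..N + M - 1. pos_last N M b"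
  have "{b. b \<le> N + M - 1 \<and> p < b \<and> q \<le> b} = {q..<?L}"
    using assms by auto
  hence "?U = - (\<Sum>b\<in>{q..<?L}. mixed_rec (?L - b + (p + 1)))"
    using assms by (simp add: pos_diff_def sum_negf[symmetric])
  hence U: "?U = - (psum mixed_rec (?L - q + (p + 1)) - psum mixed_rec (p + 1))"
    by (subst (asm) psum_diff_down) (use assms in auto)
  have "{a. a \<le> p \<and> a < q} = {0..<p + 1}" using assms by auto
  hence "?V = - (\<Sum>a\<in>{0..<p + 1}. mixed_rec ((?L - q) + (a + 1)))"
    using assms by (simp add: pos_diff_def sum_negf[symmetric])
  hence V: "?V = - (psum mixed_rec (p + 1 + (?L - q)) - psum mixed_rec (?L - q))"
    by (subst (asm) psum_shift) auto
  have "?D = (\<Sum>a\<in>{0..<p + 1}. mixed_rec (0 + (a + 1)))"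
    using assms by (intro sum.cong) (auto simp: pos_first_def)
  hence D: "?D = psum mixed_rec (p + 1)"
    by (subst (asm) psum_shift) auto
  have "{q..N + M - 1} = {q..<?L}" using assms by auto
  hence "?E = - (\<Sum>b\<in>{q..<?L}. mixed_rec (?L - b + 0))"
    using assms by (simp add: pos_last_def sum_negf[symmetric])
  hence E: "?E = - psum mixed_rec (?L - q)"
    by (subst (asm) psum_diff_down) (use assms in auto)
  show ?thesis unfolding pos_error_def cyclic_error_def U V D E by (simp only: add.commute[of "p + 1"]) simp
qed

text \<open>The mirror image: the start \<open>p\<close> cancels, and \<open>N + M - q\<close> is
  the absolute value of the last position.\<close>

lemma pos_error_neg:
  assumes "N \<le> p" "p \<le> q" "q < N + M"
  shows "pos_error N M p q
    = psum rec M - psum rec (M - (N + M - q)) + (psum mixed_rec (N + (N + M - q)) - psum mixed_rec N)"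
proof -
  let ?L = "N + M"
  let ?U = "\<Sum>b | b \<le> N + M - 1 \<and> p < b \<and> q \<le> b. pos_diff N M p b"
  let ?V = "\<Sum>a | a \<le> p \<and> a < q. pos_diff N M a q"
  let ?D = "\<Sum>a=0..p. pos_first N M a"
  let ?E = "\<Sum>b=q..N + M - 1. pos_last N M b"
  define u w where "u = max q (p + 1)" and "w = min (p + 1) q"
  have u: "p < u" "u \<le> ?L" "u - 1 - p = q - (p + 1)" using assms by (auto simp: u_def)
  have w: "N \<le> w" "w \<le> q" "q - w = q - (p + 1)" using assms by (auto simp: w_def)
  have "{b. b \<le> N + M - 1 \<and> p < b \<and> q \<le> b} = {u..<?L}"
    using assms by (auto simp: u_def)
  hence "?U = (\<Sum>b\<in>{u..<?L}. rec (b - p))"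
    using assms by (simp add: pos_diff_def)
  hence U: "?U = psum rec (?L - (p + 1)) - psum rec (q - (p + 1))"
    using psum_diff_up[OF u(1,2), of rec] by (simp add: u(3)[simplified])
  have "{a. a \<le> p \<and> a < q} = {0..<N} \<union> {N..<w}" using assms by (auto simp: w_def)
  hence "?V = - (\<Sum>a\<in>{0..<N}. mixed_rec ((?L - q) + (a + 1))) + (\<Sum>a\<in>{N..<w}. rec (q - a + 0))"
    using assms by (simp add: sum.union_disjoint pos_diff_def sum_negf[symmetric])
  hence V: "?V = - (psum mixed_rec (N + (?L - q)) - psum mixed_rec (?L - q)) + (psum rec (q - N) - psum rec (q - (p + 1)))"
    by (subst (asm) psum_shift, simp, subst (asm) psum_diff_down) (use w in auto)
  have "{0..p} = {0..<N} \<union> {N..<p + 1}" using assms by auto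
  hence "?D = (\<Sum>a\<in>{0..<N}. mixed_rec (0 + (a + 1))) - (\<Sum>a\<in>{N..<p + 1}. rec (?L - a + 0))"
    using assms by (simp add: sum.union_disjoint pos_first_def sum_negf[symmetric] del: sum.op_ivl_Suc)
  hence D: "?D = psum mixed_rec N - (psum rec M - psum rec (?L - (p + 1)))"
    by (subst (asm) psum_shift, simp, subst (asm) psum_diff_down) (use assms in auto)
  have "{q..N + M - 1} = {q..<?L}" using assms by auto
  hence "?E = - (\<Sum>b\<in>{q..<?L}. mixed_rec (?L - b + 0))"
    using assms by (simp add: pos_last_def sum_negf[symmetric])
  hence E: "?E = - psum mixed_rec (?L - q)"
    by (subst (asm) psum_diff_down) (use assms in auto)
  have e: "q - N = M - (?L - q)" using assms by auto
  have "(x - y) - (- (z - v) + (r - y)) - (z' - (m - x)) - (- v) = m - r + (z - z')"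
    for x y z v r m z' :: "real fps fps"
    by (simp add: algebra_simps)
  thus ?thesis unfolding pos_error_def cyclic_error_def U V D E e by blast
qed

section \<open>Bounds for the error terms\<close>

text \<open>Only finitely many coefficients enter, so every series has a finite seminorm; applied
  twice, the construction covers \<open>s\<close> and \<open>t\<close>.\<close>

definition trunc_norm :: "('a::comm_ring_1 \<Rightarrow> real) \<Rightarrow> nat \<Rightarrow> 'a fps \<Rightarrow> real" where
  "trunc_norm \<nu> A F = (\<Sum>a\<le>A. \<nu> (F $ a))"

definition ring_seminorm :: "('a::comm_ring_1 \<Rightarrow> real) \<Rightarrow> bool" where
  "ring_seminorm \<nu> \<longleftrightarrow> (\<forall>x. \<nu> x \<ge> 0) \<and> \<nu> 0 = 0 \<and> \<nu> 1 = 1 \<and> (\<forall>x. \<nu> (- x) = \<nu> x) \<and>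
     (\<forall>x y. \<nu> (x + y) \<le> \<nu> x + \<nu> y) \<and> (\<forall>x y. \<nu> (x * y) \<le> \<nu> x * \<nu> y)"

lemma ring_seminormD:
  assumes "ring_seminorm \<nu>"
  shows "\<nu> x \<ge> 0" "\<nu> 0 = 0" "\<nu> 1 = 1" "\<nu> (- x) = \<nu> x" "\<nu> (x + y) \<le> \<nu> x + \<nu> y" "\<nu> (x * y) \<le> \<nu> x * \<nu> y"
  using assms by (simp_all add: ring_seminorm_def)

lemma ring_seminorm_sum:
  assumes "ring_seminorm \<nu>"
  shows "\<nu> (sum f A) \<le> (\<Sum>i\<in>A. \<nu> (f i))"
proof (induction A rule: infinite_finite_induct)
  case (insert x F)
  thus ?case using ring_seminormD(5)[OF assms, of "f x" "sum f F"] by simp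
qed (simp_all add: ring_seminormD[OF assms])

lemma ring_seminorm_power:
  assumes "ring_seminorm \<nu>"
  shows "\<nu> (x ^ n) \<le> \<nu> x ^ n"
proof (induction n)
  case (Suc n)
  have "\<nu> (x ^ Suc n) \<le> \<nu> x * \<nu> (x ^ n)" by (simp add: ring_seminormD(6)[OF assms])
  also have "\<dots> \<le> \<nu> x * \<nu> x ^ n" by (intro mult_left_mono Suc.IH ring_seminormD(1)[OF assms])
  finally show ?case by simp
qed (simp add: ring_seminormD[OF assms])

lemma ring_seminorm_abs: "ring_seminorm (abs :: real \<Rightarrow> real)"
  by (simp add: ring_seminorm_def abs_mult abs_triangle_ineq)

text \<open>Submultiplicativity: coefficients of a product up to \<open>A\<close> involve only pairs
  with \<open>i + j \<le> A\<close>, which lie in the square of side \<open>A\<close>.\<close>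

lemma ring_seminorm_trunc_norm:
  assumes "ring_seminorm \<nu>"
  shows "ring_seminorm (trunc_norm \<nu> A)"
  unfolding ring_seminorm_def
proof (intro conjI allI)
  note D = ring_seminormD[OF assms]
  show "trunc_norm \<nu> A x \<ge> 0" for x
    unfolding trunc_norm_def by (intro sum_nonneg D)
  show "trunc_norm \<nu> A 0 = 0"
    unfolding trunc_norm_def by (simp add: D)
  have "\<nu> (1 $ a) = (if a = 0 then 1 else 0)" for a
    by (simp add: D)
  thus "trunc_norm \<nu> A 1 = 1"
    unfolding trunc_norm_def by (simp add: sum.delta)
  show "trunc_norm \<nu> A (- x) = trunc_norm \<nu> A x" for x
    unfolding trunc_norm_def by (simp add: D)
  show "trunc_norm \<nu> A (x + y) \<le> trunc_norm \<nu> A x + trunc_norm \<nu> A y" for x y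
    unfolding trunc_norm_def sum.distrib[symmetric] by (intro sum_mono) (simp add: D)
  show "trunc_norm \<nu> A (x * y) \<le> trunc_norm \<nu> A x * trunc_norm \<nu> A y" for x y
  proof -
    have "\<nu> ((x * y) $ a) \<le> (\<Sum>i\<le>a. \<nu> (x $ i) * \<nu> (y $ (a - i)))" for a
      unfolding fps_mult_nth atLeast0AtMost
      by (rule order.trans[OF ring_seminorm_sum[OF assms]]) (intro sum_mono D)
    hence "trunc_norm \<nu> A (x * y) \<le> (\<Sum>a\<le>A. \<Sum>i\<le>a. \<nu> (x $ i) * \<nu> (y $ (a - i)))"
      unfolding trunc_norm_def by (intro sum_mono)
    also have "\<dots> = (\<Sum>(i, j)\<in>{(i, j). i + j \<le> A}. \<nu> (x $ i) * \<nu> (y $ j))"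
      by (rule sum.triangle_reindex_eq[symmetric])
    also have "\<dots> \<le> (\<Sum>(i, j)\<in>{..A} \<times> {..A}. \<nu> (x $ i) * \<nu> (y $ j))"
      by (rule sum_mono2) (auto intro!: mult_nonneg_nonneg D)
    also have "\<dots> = trunc_norm \<nu> A x * trunc_norm \<nu> A y"
      unfolding trunc_norm_def by (simp add: sum_product sum.cartesian_product)
    finally show ?thesis .
  qed
qed

abbreviation norm1 :: "nat \<Rightarrow> real fps \<Rightarrow> real" where
  "norm1 A \<equiv> trunc_norm abs A"

abbreviation norm2 :: "nat \<Rightarrow> real fps fps \<Rightarrow> real" where
  "norm2 A \<equiv> trunc_norm (norm1 A) A"

lemmas norm1_seminorm = ring_seminorm_trunc_norm[OF ring_seminorm_abs]
lemmas norm2_seminorm = ring_seminorm_trunc_norm[OF norm1_seminorm]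

lemma trunc_norm_const:
  assumes "ring_seminorm \<nu>"
  shows "trunc_norm \<nu> A (fps_const c) = \<nu> c"
proof -
  have "\<nu> (fps_const c $ a) = (if a = 0 then \<nu> c else 0)" for a
    by (simp add: ring_seminormD[OF assms])
  thus ?thesis unfolding trunc_norm_def by (simp add: sum.delta)
qed

lemma norm2_const: "norm2 A (fps_const F) = norm1 A F"
  by (rule trunc_norm_const[OF norm1_seminorm])

lemma norm1_const: "norm1 A (fps_const c) = \<bar>c\<bar>"
  by (rule trunc_norm_const[OF ring_seminorm_abs])

lemma norm2_lift_s: "norm2 A (lift_s F) = norm1 A F"
  unfolding trunc_norm_def[of "norm1 A"] by (simp add: norm1_const) (simp add: trunc_norm_def)

lemma nth_le_norm2:
  assumes "a \<le> A" "b \<le> A"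
  shows "\<bar>F $ a $ b\<bar> \<le> norm2 A F"
proof -
  have "\<bar>F $ a $ b\<bar> \<le> norm1 A (F $ a)"
    unfolding trunc_norm_def using assms by (intro member_le_sum[of b _ "\<lambda>b. \<bar>F $ a $ b\<bar>"]) auto
  also have "\<dots> \<le> norm2 A F"
    unfolding trunc_norm_def[of "norm1 A"] using assms
    by (intro member_le_sum[of a _ "\<lambda>a. norm1 A (F $ a)"]) (auto simp: ring_seminormD(1)[OF norm1_seminorm])
  finally show ?thesis .
qed

lemma norm1_geom:
  assumes "m > 0" "\<bar>\<epsilon>\<bar> = 1"
  shows "norm1 A (geom \<epsilon> m) \<le> real (A + 1) / real m"
proof -
  have "\<bar>geom \<epsilon> m $ a\<bar> \<le> 1 / real m" for a
  proof -
    have "real m ^ 1 \<le> real m ^ (a + 1)"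
      using assms by (intro power_increasing) auto
    thus ?thesis using assms by (simp add: geom_nth abs_mult power_abs divide_simps)
  qed
  hence "norm1 A (geom \<epsilon> m) \<le> (\<Sum>a\<le>A. 1 / real m)"
    unfolding trunc_norm_def by (intro sum_mono)
  thus ?thesis by simp
qed

text \<open>\<open>A + 1\<close> coefficients in \<open>s\<close>, each at most
  \<open>(A + 1) ^ (A + 1) / m\<close> by \<open>norm1_geom\<close>, give the exponent
  \<open>A + 2\<close> for \<open>mixed_rec\<close>. The constant \<open>A + 1\<close> of
  \<open>norm1_geom\<close> is covered as well.\<close>

definition norm_bound :: "nat \<Rightarrow> real" where
  "norm_bound A = real (A + 1) ^ (A + 2)"

lemma norm_bound_ge: "real (A + 1) \<le> norm_bound A" "1 \<le> norm_bound A"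
proof -
  have "real (A + 1) ^ 1 \<le> real (A + 1) ^ (A + 2)" by (intro power_increasing) auto
  thus "real (A + 1) \<le> norm_bound A" by (simp add: norm_bound_def)
  thus "1 \<le> norm_bound A" by simp
qed

lemma norm2_mixed_rec:
  assumes "m > 0"
  shows "norm2 A (mixed_rec m) \<le> norm_bound A / real m"
proof -
  let ?G = "real (A + 1)"
  note D = ring_seminormD[OF norm1_seminorm]
  have "norm1 A (mixed_rec m $ a) \<le> ?G ^ (A + 1) / real m" if "a \<le> A" for a
  proof -
    have "norm1 A (mixed_rec m $ a) = norm1 A (geom 1 m ^ (a + 1))"
      by (cases "even a") (simp_all add: mixed_rec_def D(4))
    also have "\<dots> \<le> norm1 A (geom 1 m) ^ (a + 1)"
      by (rule ring_seminorm_power[OF norm1_seminorm])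
    also have "\<dots> \<le> (?G / real m) ^ (a + 1)"
      using assms by (intro power_mono norm1_geom D(1)) auto
    also have "\<dots> = ?G ^ (a + 1) / real m ^ (a + 1)"
      by (rule power_divide)
    also have "\<dots> \<le> ?G ^ (A + 1) / real m ^ 1"
      using assms that by (intro frac_le power_increasing) auto
    finally show ?thesis by simp
  qed
  hence "norm2 A (mixed_rec m) \<le> (\<Sum>a\<le>A. ?G ^ (A + 1) / real m)"
    unfolding trunc_norm_def[of "norm1 A"] by (intro sum_mono) auto
  also have "\<dots> = norm_bound A / real m"
    by (simp add: norm_bound_def)
  finally show ?thesis .
qed

definition pos_weight :: "nat \<Rightarrow> nat \<Rightarrow> nat \<Rightarrow> real" where
  "pos_weight N M i = (if i < N then 1 / real (i + 1) else 1 / real (N + M - i))"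

lemma norm2_pos_val:
  assumes "i < N + M"
  shows "norm2 A (pos_val N M i) \<le> norm_bound A * pos_weight N M i"
proof -
  have "norm1 A (geom \<epsilon> m) \<le> norm_bound A / real m" if "m > 0" "\<bar>\<epsilon>\<bar> = 1" for \<epsilon> m
  proof -
    have "norm1 A (geom \<epsilon> m) \<le> real (A + 1) / real m" using that by (rule norm1_geom)
    also have "\<dots> \<le> norm_bound A / real m" by (intro divide_right_mono norm_bound_ge) simp
    finally show ?thesis .
  qed
  from this[of "i + 1" "-1"] this[of "N + M - i" 1] show ?thesis using assms
    by (simp add: pos_val_def pos_weight_def norm2_lift_s norm2_const ring_seminormD(4)[OF norm2_seminorm]
        ring_seminormD(4)[OF norm1_seminorm])
qed

lemma norm_pinned_sum:
  assumes \<nu>: "ring_seminorm \<nu>" and "\<And>i. p \<le> i \<Longrightarrow> i \<le> q \<Longrightarrow> \<nu> (x i) \<le> C * w i"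
  shows "\<nu> (pinned_sum x p q k) \<le> C ^ sum_list k * pinned_sum w p q k"
  using assms(2)
proof (induction k arbitrary: p)
  case Nil
  thus ?case by (simp add: ring_seminormD[OF \<nu>])
next
  case (Cons k ks)
  have pow: "\<nu> (x p ^ k) \<le> C ^ k * w p ^ k" if "p \<le> q"
  proof -
    have "\<nu> (x p ^ k) \<le> \<nu> (x p) ^ k" by (rule ring_seminorm_power[OF \<nu>])
    also have "\<dots> \<le> (C * w p) ^ k" using Cons.prems that by (intro power_mono ring_seminormD(1)[OF \<nu>]) auto
    finally show ?thesis by (simp add: power_mult_distrib)
  qed
  show ?case
  proof (cases "ks = []")
    case True
    thus ?thesis using pow by (auto simp: ring_seminormD[OF \<nu>])
  next
    case False
    show ?thesis
    proof (cases "p \<le> q")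
      case pq: True
      have "\<nu> (pinned_sum x p q (k # ks)) \<le> \<nu> (x p ^ k) * \<nu> (\<Sum>n=p..q. pinned_sum x n q ks)"
        using False by (simp add: pinned_sum_Cons ring_seminormD(6)[OF \<nu>])
      also have "\<dots> \<le> (C ^ k * w p ^ k) * (\<Sum>n=p..q. C ^ sum_list ks * pinned_sum w n q ks)"
      proof (intro mult_mono pow pq)
        show "\<nu> (\<Sum>n=p..q. pinned_sum x n q ks) \<le> (\<Sum>n=p..q. C ^ sum_list ks * pinned_sum w n q ks)"
          by (rule order.trans[OF ring_seminorm_sum[OF \<nu>]]) (intro sum_mono Cons.IH Cons.prems, auto)
        \<comment> \<open>Nonnegativity follows from the seminorm that this product bounds.\<close>
        show "0 \<le> C ^ k * w p ^ k"
          using pow[OF pq] ring_seminormD(1)[OF \<nu>] by (meson order.trans)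
      qed (rule ring_seminormD(1)[OF \<nu>])
      finally show ?thesis using False
        by (simp add: pinned_sum_Cons sum_distrib_left[symmetric] power_add mult_ac)
    next
      case False
      thus ?thesis using \<open>ks \<noteq> []\<close> by (simp add: pinned_sum_Cons ring_seminormD[OF \<nu>])
    qed
  qed
qed

lemma pinned_sum_nonneg:
  fixes w :: "nat \<Rightarrow> real"
  assumes "\<And>i. p \<le> i \<Longrightarrow> i \<le> q \<Longrightarrow> 0 \<le> w i"
  shows "0 \<le> pinned_sum w p q k"
  using assms
proof (induction k arbitrary: p)
  case (Cons k ks)
  show ?case
  proof (cases "ks = []")
    case False
    have "0 \<le> (\<Sum>n=p..q. pinned_sum w n q ks)"
      by (intro sum_nonneg Cons.IH Cons.prems) auto
    thus ?thesis using False Cons.prems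
      by (cases "p \<le> q") (auto simp: pinned_sum_Cons intro!: mult_nonneg_nonneg)
  qed (use Cons.prems in auto)
qed simp

text \<open>One exponent \<open>\<ge> 2\<close> anywhere in the chain provides the spare factor \<open>w j\<close> that kills the error term.\<close>

lemma pinned_sum_absorb:
  fixes w :: "nat \<Rightarrow> real"
  assumes "\<And>i. p \<le> i \<Longrightarrow> i \<le> q \<Longrightarrow> 0 \<le> w i \<and> w i \<le> 1" "\<And>i. p \<le> i \<Longrightarrow> i \<le> q \<Longrightarrow> e * w i \<le> E"
    and "is_index k" "0 \<le> e" "\<exists>x\<in>set k. x \<ge> 2"
  shows "pinned_sum w p q k * e \<le> E * pinned_sum w p q (replicate (length k) 1)"
  using assms
proof (induction k arbitrary: p)
  case (Cons k ks)
  note w01 = Cons.prems(1)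
  have k: "k > 0" using Cons.prems(3) by simp
  have pow1: "w p ^ k \<le> w p" if "p \<le> q"
    using Cons.prems(1)[of p] that k power_decreasing[of 1 k "w p"] by simp
  have pow2: "w p ^ k * e \<le> w p * E" if "p \<le> q" "k \<ge> 2"
  proof -
    have "w p ^ k * e \<le> w p ^ 2 * e"
      using Cons.prems(1)[of p] Cons.prems(4) that power_decreasing[of 2 k "w p"] by (intro mult_right_mono) auto
    also have "\<dots> = w p * (e * w p)" by (simp add: power2_eq_square)
    also have "\<dots> \<le> w p * E" using Cons.prems(1,2) that by (intro mult_left_mono) auto
    finally show ?thesis .
  qed
  \<comment> \<open>The remaining exponents may be lowered to 1 because the weights are at most
    1.\<close>
  have mono: "pinned_sum w n q ls \<le> pinned_sum w n q (replicate (length ls) 1)"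
    if "n \<ge> p" "is_index ls" for n ls
    using that
  proof (induction ls arbitrary: n)
    case (Cons l ls)
    have l: "w n ^ l \<le> w n" if "n \<le> q"
      using w01[of n] that Cons.prems power_decreasing[of 1 l "w n"] by simp
    have wn: "0 \<le> w n" if "n \<le> q" using w01[of n] that Cons.prems by simp
    show ?case
    proof (cases "ls = []")
      case False
      have "0 \<le> (\<Sum>m=n..q. pinned_sum w m q ls)"
        using w01 Cons.prems by (intro sum_nonneg pinned_sum_nonneg) auto
      moreover have "(\<Sum>m=n..q. pinned_sum w m q ls) \<le> (\<Sum>m=n..q. pinned_sum w m q (replicate (length ls) 1))"
        using Cons.prems by (intro sum_mono Cons.IH) auto
      ultimately show ?thesis using False l wn
        by (cases "n \<le> q") (auto simp: pinned_sum_Cons intro!: mult_mono)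
    qed (use l in auto)
  qed simp
  show ?case
  proof (cases "ks = []")
    case True
    thus ?thesis using pow2 Cons.prems(5) by (auto simp: mult.commute)
  next
    case ks: False
    show ?thesis
    proof (cases "p \<le> q")
      case pq: True
      let ?S = "\<Sum>n=p..q. pinned_sum w n q ks"
      let ?S1 = "\<Sum>n=p..q. pinned_sum w n q (replicate (length ks) 1)"
      have S: "0 \<le> ?S" using Cons.prems(1) by (intro sum_nonneg pinned_sum_nonneg) auto
      have wp: "0 \<le> w p" "w p \<le> 1" using Cons.prems(1) pq by auto
      have "(w p ^ k * ?S) * e \<le> E * (w p * ?S1)"
      proof (cases "k \<ge> 2")
        case True
        have E: "0 \<le> w p * E"
          using pow2[OF pq True] wp Cons.prems(4) by (meson mult_nonneg_nonneg order.trans zero_le_power)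
        have "(w p ^ k * ?S) * e = (w p ^ k * e) * ?S" by (simp only: mult_ac)
        also have "\<dots> \<le> (w p * E) * ?S1"
          using Cons.prems(3) by (intro mult_mono pow2[OF pq True] sum_mono mono S E) auto
        finally show ?thesis by (simp only: mult_ac)
      next
        case False
        hence ex: "\<exists>x\<in>set ks. x \<ge> 2" using Cons.prems(5) by auto
        have Se: "?S * e \<le> E * ?S1"
          unfolding sum_distrib_left sum_distrib_right
          using Cons.prems(1,2,3,4) ex by (intro sum_mono Cons.IH) auto
        have "w p ^ k * (?S * e) \<le> w p * (E * ?S1)"
          by (rule mult_mono[OF pow1[OF pq] Se wp(1) mult_nonneg_nonneg[OF S Cons.prems(4)]])
        thus ?thesis by (simp only: mult_ac)
      qed
      thus ?thesis using ks by (simp add: pinned_sum_Cons)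
    qed (use ks in \<open>simp add: pinned_sum_Cons\<close>)
  qed
qed simp

text \<open>Dropping the order condition lets each of the \<open>r\<close> later positions run over
  all weights.\<close>

lemma pinned_sum_ones:
  fixes w :: "nat \<Rightarrow> real"
  assumes "\<And>i. a \<le> i \<Longrightarrow> i \<le> b \<Longrightarrow> 0 \<le> w i" "a \<le> p" "p \<le> b"
  shows "(\<Sum>q=p..b. pinned_sum w p q (replicate (Suc r) 1)) \<le> w p * (\<Sum>i=a..b. w i) ^ r"
  using assms(2,3)
proof (induction r arbitrary: p)
  case (Suc r)
  let ?W = "\<Sum>i=a..b. w i"
  have "(\<Sum>q=p..b. pinned_sum w p q (replicate (Suc (Suc r)) 1))
      = w p * (\<Sum>q=p..b. \<Sum>n=p..q. pinned_sum w n q (replicate (Suc r) 1))"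
    by (simp add: sum_distrib_left)
  also have "\<dots> = w p * (\<Sum>n=p..b. \<Sum>q=n..b. pinned_sum w n q (replicate (Suc r) 1))"
    by (simp only: sum_triangle)
  also have "\<dots> \<le> w p * (\<Sum>n=p..b. w n * ?W ^ r)"
    using assms(1) Suc.prems by (intro mult_left_mono sum_mono Suc.IH) auto
  also have "\<dots> = w p * ((\<Sum>n=p..b. w n) * ?W ^ r)"
    by (simp only: sum_distrib_right)
  also have "\<dots> \<le> w p * (?W * ?W ^ r)"
    using assms(1) Suc.prems by (intro mult_left_mono mult_right_mono sum_mono2 zero_le_power sum_nonneg) auto
  finally show ?case by simp
qed simp

text \<open>For \<open>2 * n \<le> N\<close> each of the \<open>n\<close> reciprocals is at most
  \<open>2 / N\<close>; otherwise the whole harmonic number serves as a bound.\<close>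

lemma sum_inverse_le: "n \<le> N \<Longrightarrow> harm N - harm (N - n) \<le> (if 2 * n \<le> N then 2 * real n / real N else harm N)"
proof (cases "2 * n \<le> N \<and> N > 0")
  case True
  hence N: "N > 0" by simp
  have "harm N - harm (N - m) \<le> 2 * real m / real N" if "m \<le> n" for m
    using that
  proof (induction m)
    case (Suc m)
    have e: "N - m = Suc (N - Suc m)" using Suc.prems True by linarith
    have "harm N - harm (N - Suc m) = harm N - harm (N - m) + inverse (real (N - m))"
      unfolding e harm_Suc by simp
    also have "inverse (real (N - m)) \<le> 2 / real N"
    proof -
      have "real N / 2 \<le> real (N - m)" using Suc.prems True by simp
      hence "inverse (real (N - m)) \<le> inverse (real N / 2)" using N by (intro le_imp_inverse_le) auto
      thus ?thesis by (simp add: field_simps)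
    qed
    finally show ?case using Suc.IH Suc.prems N by (simp add: field_simps)
  qed simp
  from this[of n] show ?thesis using True by simp
next
  case False
  thus ?thesis using harm_nonneg[of "N - n", where ?'a = real] by (auto simp: harm_def)
qed

text \<open>For small \<open>n\<close> the factor \<open>1 / n\<close> cancels the number of terms;
  for large \<open>n\<close> it is itself at most \<open>2 / N\<close>.\<close>

lemma harm_diff_quotient:
  assumes "0 < n" "n \<le> N"
  shows "(harm N - harm (N - n)) * (1 / real n) \<le> 2 * harm N / real N"
proof -
  have h1: "1 \<le> (harm N :: real)"
    using harm_mono[of 1 N, where ?'a = real] assms by (simp add: harm_def)
  show ?thesis
  proof (cases "2 * n \<le> N")
    case True
    hence "(harm N - harm (N - n)) * (1 / real n) \<le> (2 * real n / real N) * (1 / real n)"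
      using sum_inverse_le[of n N] assms by (intro mult_right_mono) auto
    also have "\<dots> = 2 * 1 / real N" using assms by simp
    also have "\<dots> \<le> 2 * harm N / real N" using h1 by (intro divide_right_mono mult_left_mono) auto
    finally show ?thesis .
  next
    case False
    have "(harm N - harm (N - n)) * (1 / real n) \<le> harm N * (2 / real N)"
      using sum_inverse_le[of n N] assms False h1 by (intro mult_mono) (auto simp: field_simps)
    thus ?thesis by (simp add: mult.commute)
  qed
qed

lemma psum_rec: "psum rec n = fps_const (fps_const (harm n))"
proof (induction n)
  case 0
  show ?case by (simp add: harm_def)
qed (simp add: rec_def harm_Suc inverse_eq_divide del: of_nat_Suc)

lemma norm2_psum_rec_diff: "m \<le> n \<Longrightarrow> norm2 A (psum rec n - psum rec m) = harm n - harm m"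
  using harm_mono[of m n, where ?'a = real] by (simp add: psum_rec norm2_const norm1_const)

lemma norm2_psum_mixed_rec_diff:
  assumes "M > 0"
  shows "norm2 A (psum mixed_rec (M + n) - psum mixed_rec M) \<le> real n * (norm_bound A / real M)"
proof (induction n)
  case 0
  show ?case by (simp add: ring_seminormD[OF norm2_seminorm])
next
  case (Suc n)
  have "psum mixed_rec (M + Suc n) - psum mixed_rec M
      = (psum mixed_rec (M + n) - psum mixed_rec M) + mixed_rec (Suc (M + n))" by simp
  hence "norm2 A (psum mixed_rec (M + Suc n) - psum mixed_rec M)
      \<le> norm2 A (psum mixed_rec (M + n) - psum mixed_rec M) + norm2 A (mixed_rec (Suc (M + n)))"
    using ring_seminormD(5)[OF norm2_seminorm] by (simp only:)
  also have "norm2 A (mixed_rec (Suc (M + n))) \<le> norm_bound A / real (Suc (M + n))"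
    by (rule norm2_mixed_rec) simp
  also have "\<dots> \<le> norm_bound A / real M"
    using assms norm_bound_ge[of A] by (intro divide_left_mono) auto
  finally have "norm2 A (psum mixed_rec (M + Suc n) - psum mixed_rec M)
      \<le> real n * (norm_bound A / real M) + norm_bound A / real M"
    using Suc.IH by simp
  also have "\<dots> = real (Suc n) * (norm_bound A / real M)"
    by (simp only: of_nat_Suc distrib_right mult_1_left add.commute)
  finally show ?case .
qed

definition error_scale :: "nat \<Rightarrow> nat \<Rightarrow> nat \<Rightarrow> real" where
  "error_scale A N M = (2 * harm N / real N + norm_bound A / real M) + (2 * harm M / real M + norm_bound A / real N)"

text \<open>Both one-sided errors have this form, up to sign and an exchange of \<open>N\<close> and
  \<open>M\<close>, with \<open>n\<close> the least absolute value on the chain. The weight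
  \<open>w\<close> of any position on it is at most \<open>1 / n\<close>.\<close>

lemma error_part_bound:
  assumes "0 < n" "n \<le> N" "0 < M" "w \<le> 1 / real n" "0 \<le> w"
  shows "norm2 A (psum rec N - psum rec (N - n) + (psum mixed_rec (M + n) - psum mixed_rec M)) * w
     \<le> 2 * harm N / real N + norm_bound A / real M"
proof -
  have "norm2 A (psum rec N - psum rec (N - n) + (psum mixed_rec (M + n) - psum mixed_rec M)) * w
     \<le> ((harm N - harm (N - n)) + real n * (norm_bound A / real M)) * (1 / real n)"
  proof (intro mult_mono assms)
    show "norm2 A (psum rec N - psum rec (N - n) + (psum mixed_rec (M + n) - psum mixed_rec M))
       \<le> (harm N - harm (N - n)) + real n * (norm_bound A / real M)"
      by (rule order.trans[OF ring_seminormD(5)[OF norm2_seminorm]])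
         (intro add_mono norm2_psum_mixed_rec_diff assms, simp add: norm2_psum_rec_diff)
    show "0 \<le> harm N - harm (N - n) + real n * (norm_bound A / real M)"
      using harm_mono[of "N - n" N, where ?'a = real] norm_bound_ge[of A] by simp
  qed
  also have "\<dots> = (harm N - harm (N - n)) * (1 / real n) + norm_bound A / real M"
    using assms by (simp add: field_simps)
  also have "\<dots> \<le> 2 * harm N / real N + norm_bound A / real M"
    using harm_diff_quotient[OF assms(1,2)] by simp
  finally show ?thesis .
qed

text \<open>The position \<open>j\<close> is left free because the exponent of at least 2 may sit
  anywhere on the chain.\<close>

lemma pos_error_bound:
  assumes "p \<le> j" "j \<le> q" "q < N + M" "0 < N" "0 < M"
  shows "norm2 A (pos_error N M p q) * pos_weight N M j
     \<le> error_scale A N M"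
proof -
  let ?E = "pos_error N M p q"
  have nn: "0 \<le> 2 * harm N / real N + norm_bound A / real M" "0 \<le> 2 * harm M / real M + norm_bound A / real N"
    using harm_nonneg[of N, where ?'a = real] harm_nonneg[of M, where ?'a = real] norm_bound_ge[of A] by simp_all
  consider "q < N" | "p < N" "N \<le> q" | "N \<le> p" using assms by linarith
  thus ?thesis
  proof cases
    case 1
    have "?E = - (psum rec N - psum rec (N - (p + 1)) + (psum mixed_rec (M + (p + 1)) - psum mixed_rec M))"
      using pos_error_pos[of p q N M] assms 1 by simp
    hence "norm2 A ?E = norm2 A (psum rec N - psum rec (N - (p + 1)) + (psum mixed_rec (M + (p + 1)) - psum mixed_rec M))"
      by (simp only: ring_seminormD(4)[OF norm2_seminorm])
    moreover have "pos_weight N M j \<le> 1 / real (p + 1)" "0 \<le> pos_weight N M j"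
      using assms 1 by (auto simp: pos_weight_def intro!: divide_left_mono)
    ultimately show ?thesis
      using error_part_bound[of "p + 1" N M "pos_weight N M j" A] assms 1 nn by (simp add: error_scale_def)
  next
    case 2
    thus ?thesis using pos_error_mixed[of p N q M] assms nn
      by (simp add: error_scale_def ring_seminormD[OF norm2_seminorm])
  next
    case 3
    have "norm2 A ?E = norm2 A (psum rec M - psum rec (M - (N + M - q)) + (psum mixed_rec (N + (N + M - q)) - psum mixed_rec N))"
      using pos_error_neg[of N p q M] assms 3 by simp
    moreover have "pos_weight N M j \<le> 1 / real (N + M - q)" "0 \<le> pos_weight N M j"
      using assms 3 by (auto simp: pos_weight_def intro!: divide_left_mono)
    moreover have "N + M - q \<le> M" using assms 3 by simp
    ultimately show ?thesis
      using error_part_bound[of "N + M - q" M N "pos_weight N M j" A] assms 3 nn by (simp add: error_scale_def)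
  qed
qed

lemma sum_pos_weight: "0 < N + M \<Longrightarrow> (\<Sum>i=0..N + M - 1. pos_weight N M i) = harm N + harm M"
proof -
  assume "0 < N + M"
  hence "{0..N + M - 1} = {..<N} \<union> {N..<N + M}" by auto
  hence "(\<Sum>i=0..N + M - 1. pos_weight N M i) = (\<Sum>i<N. pos_weight N M i) + (\<Sum>i\<in>{N..<N + M}. pos_weight N M i)"
    by (simp only:) (rule sum.union_disjoint, auto)
  also have "(\<Sum>i<N. pos_weight N M i) = (\<Sum>i<N. inverse (real (Suc i)))"
    by (intro sum.cong refl) (simp add: pos_weight_def inverse_eq_divide)
  also have "(\<Sum>i\<in>{N..<N + M}. pos_weight N M i) = (\<Sum>i\<in>{N..<N + M}. inverse (real (N + M - i)))"
    by (intro sum.cong refl) (simp add: pos_weight_def inverse_eq_divide)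
  also have "(\<Sum>i\<in>{N..<N + M}. inverse (real (N + M - i))) = (\<Sum>i<M. inverse (real (Suc i)))"
    by (rule sum.reindex_bij_witness[of _ "\<lambda>i. N + M - Suc i" "\<lambda>i. N + M - Suc i"]) auto
  finally show ?thesis by (simp add: harm_altdef)
qed

text \<open>The weight absorbed by the error leaves chains with all exponents 1, which cost only
  \<open>length k\<close> factors \<open>harm N + harm M\<close>. For \<open>M = c * N\<close> this
  logarithmic growth cannot offset the decay of \<open>error_scale\<close>.\<close>

lemma total_error_bound:
  assumes "is_index k" "\<exists>x\<in>set k. x \<ge> 2" "0 < N" "0 < M"
  shows "norm2 A (\<Sum>p=0..N + M - 1. \<Sum>q=p..N + M - 1. pinned_sum (pos_val N M) p q k *
      pos_error N M p q)
    \<le> norm_bound A ^ sum_list k * (error_scale A N M * (harm N + harm M) ^ length k)"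
proof -
  let ?B = "N + M - 1" and ?w = "pos_weight N M" and ?C = "norm_bound A ^ sum_list k"
    note D = ring_seminormD[OF norm2_seminorm, of A]
  obtain r where r: "length k = Suc r" using assms(2) by (cases k) auto
  have C: "0 \<le> ?C" using norm_bound_ge[of A] by simp
  have w: "0 \<le> ?w i" "?w i \<le> 1" if "i \<le> ?B" for i
    using that assms by (auto simp: pos_weight_def)
  have sc: "0 \<le> error_scale A N M"
    using harm_nonneg[of N, where ?'a = real] harm_nonneg[of M, where ?'a = real] norm_bound_ge[of A]
    by (simp add: error_scale_def)
  have "norm2 A (\<Sum>p=0..?B. \<Sum>q=p..?B. pinned_sum (pos_val N M) p q k * pos_error N M p q)
      \<le> (\<Sum>p=0..?B. \<Sum>q=p..?B. norm2 A (pinned_sum (pos_val N M) p q k * pos_error N M p q))"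
    by (rule order.trans[OF ring_seminorm_sum[OF norm2_seminorm]])
       (intro sum_mono ring_seminorm_sum[OF norm2_seminorm])
  also have "\<dots> \<le> (\<Sum>p=0..?B. \<Sum>q=p..?B. ?C * (error_scale A N M * pinned_sum ?w p q (replicate (length k) 1)))"
  proof (intro sum_mono)
    fix p q assume pq: "p \<in> {0..?B}" "q \<in> {p..?B}"
    have "norm2 A (pinned_sum (pos_val N M) p q k * pos_error N M p q) \<le> norm2 A (pinned_sum (pos_val N M) p q k) * norm2 A (pos_error N M p q)"
      by (rule D)
    also have "\<dots> \<le> (?C * pinned_sum ?w p q k) * norm2 A (pos_error N M p q)"
      using pq assms by (intro mult_right_mono norm_pinned_sum norm2_seminorm norm2_pos_val D) auto
    also have "\<dots> = ?C * (pinned_sum ?w p q k * norm2 A (pos_error N M p q))" by simp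
    also have "\<dots> \<le> ?C * (error_scale A N M * pinned_sum ?w p q (replicate (length k) 1))"
      using pq assms w by (intro mult_left_mono C pinned_sum_absorb pos_error_bound D) auto
    finally show "norm2 A (pinned_sum (pos_val N M) p q k * pos_error N M p q) \<le> \<dots>" .
  qed
  also have "\<dots> = ?C * (error_scale A N M * (\<Sum>p=0..?B. \<Sum>q=p..?B. pinned_sum ?w p q (replicate (length k) 1)))"
    by (simp only: sum_distrib_left)
  also have "\<dots> \<le> ?C * (error_scale A N M * (\<Sum>p=0..?B. ?w p * (\<Sum>i=0..?B. ?w i) ^ r))"
    unfolding r using w by (intro mult_left_mono C sc sum_mono pinned_sum_ones) auto
  also have "\<dots> = ?C * (error_scale A N M * (harm N + harm M) ^ length k)"
    using assms by (simp add: r sum_distrib_right[symmetric] sum_pos_weight[simplified])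
  finally show ?thesis .
qed

section \<open>Truncated zeta values\<close>

definition trunc_zeta :: "nat \<Rightarrow> nat list \<Rightarrow> real" where
  "trunc_zeta N k = chain_sum (map (\<lambda>n. 1 / real n) [1..<Suc N]) k"

lemma trunc_zeta_0: "trunc_zeta 0 k = (if k = [] then 1 else 0)"
  by (simp add: trunc_zeta_def)

lemma trunc_zeta_Nil [simp]: "trunc_zeta N [] = 1"
  by (simp add: trunc_zeta_def)

lemma trunc_zeta_Suc:
  "trunc_zeta (Suc N) (ks @ [k]) = trunc_zeta N (ks @ [k]) + trunc_zeta N ks / real (Suc N) ^ k"
proof -
  have "[1..<Suc (Suc N)] = [1..<Suc N] @ [Suc N]" by simp
  thus ?thesis
    unfolding trunc_zeta_def by (simp only: map_append list.map chain_sum_snoc) (simp add: power_divide)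
qed

text \<open>\<open>msum\<close> takes the reversed index and excludes its bound, hence
  \<open>rev\<close> and \<open>Suc\<close>.\<close>

lemma msum_eq_trunc_zeta: "msum ks (Suc N) = trunc_zeta N (rev ks)"
proof (induction N arbitrary: ks)
  case 0
  show ?case by (cases ks) (simp_all add: trunc_zeta_0)
next
  case (Suc N)
  show ?case
  proof (cases ks)
    case (Cons k ks')
    have "{1..<Suc (Suc N)} = insert (Suc N) {1..<Suc N}" by auto
    hence "msum (k # ks') (Suc (Suc N)) = msum (k # ks') (Suc N) + msum ks' (Suc N) / real (Suc N) ^ k"
      by simp
    thus ?thesis using Suc.IH[of "k # ks'"] Suc.IH[of ks'] Cons trunc_zeta_Suc[of N "rev ks'" k] by simp
  qed simp
qed

lemma trunc_zeta_snoc_sum: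
  "trunc_zeta N (ks @ [k]) = (\<Sum>n<N. trunc_zeta n ks / real (Suc n) ^ k)"
  by (induction N) (simp_all add: trunc_zeta_0 trunc_zeta_Suc)

lemma trunc_zeta_one: "trunc_zeta N [1] = harm N"
  using trunc_zeta_snoc_sum[of N "[]" 1] by (simp add: harm_altdef inverse_eq_divide)

lemma trunc_zeta_nonneg: "0 \<le> trunc_zeta N k"
  by (induction k arbitrary: N rule: rev_induct) (auto simp: trunc_zeta_snoc_sum intro!: sum_nonneg)

lemma trunc_zeta_le:
  assumes "is_index k"
  shows "trunc_zeta N k \<le> harm N ^ length k"
  using assms
proof (induction k arbitrary: N rule: rev_induct)
  case (snoc m k)
  have "trunc_zeta N (k @ [m]) \<le> (\<Sum>n<N. harm N ^ length k * inverse (real (Suc n)))"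
    unfolding trunc_zeta_snoc_sum
  proof (intro sum_mono)
    fix n assume "n \<in> {..<N}"
    have "trunc_zeta n k \<le> harm n ^ length k" using snoc by simp
    also have "\<dots> \<le> harm N ^ length k"
      using \<open>n \<in> {..<N}\<close> by (intro power_mono harm_mono harm_nonneg) auto
    finally have 1: "trunc_zeta n k \<le> harm N ^ length k" .
    have "real (Suc n) ^ 1 \<le> real (Suc n) ^ m"
      using snoc.prems by (intro power_increasing) auto
    thus "trunc_zeta n k / real (Suc n) ^ m \<le> harm N ^ length k * inverse (real (Suc n))"
      unfolding divide_inverse using 1 trunc_zeta_nonneg[of n k]
      by (intro mult_mono le_imp_inverse_le) (auto simp: harm_nonneg)
  qed
  also have "\<dots> = harm N ^ length (k @ [m])"
    by (simp only: sum_distrib_left[symmetric]) (simp add: harm_altdef)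
  finally show ?case .
qed simp

lemma slow_bounded:
  assumes "\<And>n. \<bar>e n\<bar> \<le> g n" "slow g"
  shows "slow e"
  unfolding slow_def
proof (intro allI impI)
  fix p :: real assume "p > 0"
  have "e \<in> O(g)"
  proof (intro bigoI[of _ 1] always_eventually allI)
    fix n
    show "norm (e n) \<le> 1 * norm (g n)" using assms(1)[of n] by simp
  qed
  thus "e \<in> O(\<lambda>n. real n powr p)"
    using assms(2) \<open>p > 0\<close> landau_o.big_trans unfolding slow_def by blast
qed

lemma slow_harm: "slow (harm :: nat \<Rightarrow> real)"
proof -
  have "slow (\<lambda>n. harm n - ln (real n) :: real)"
    unfolding slow_def
  proof (intro allI impI)
    fix p :: real assume "p > 0"
    have "(\<lambda>n. harm n - ln (real n) :: real) \<in> O(\<lambda>_. 1)"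
      using euler_mascheroni_LIMSEQ by (intro bigoI_tendsto[where c = euler_mascheroni]) auto
    moreover have "(\<lambda>_. 1) \<in> O(\<lambda>n. real n powr p)"
      using slow_const[of 1] \<open>p > 0\<close> unfolding slow_def by blast
    ultimately show "(\<lambda>n. harm n - ln (real n) :: real) \<in> O(\<lambda>n. real n powr p)"
      by (rule landau_o.big_trans)
  qed
  moreover have "slow (\<lambda>n. ln (real n))"
    unfolding slow_def
  proof (intro allI impI)
    fix p :: real assume "p > 0"
    thus "(\<lambda>n. ln (real n)) \<in> O(\<lambda>n. real n powr p)" by real_asymp
  qed
  ultimately have "slow (\<lambda>n. (harm n - ln (real n)) + ln (real n) :: real)" by (rule slow_add)
  thus ?thesis by simp
qed

lemma slow_trunc_zeta: "is_index k \<Longrightarrow> slow (\<lambda>N. trunc_zeta N k)"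
  by (rule slow_bounded[OF _ slow_power[OF slow_harm, of "length k"]])
     (simp add: trunc_zeta_nonneg trunc_zeta_le)

text \<open>A telescoping majorant of \<open>(m + 1) powr (-3/2)\<close>: for consecutive square
  roots \<open>a\<close>, \<open>b\<close> one has
  \<open>1/a - 1/b = 1/((a + b) * a * b)\<close>.\<close>

lemma inverse_sqrt_telescope:
  assumes "m > 0"
  shows "sqrt (real (Suc m)) / real (Suc m) ^ 2 \<le> 2 * (1 / sqrt (real m) - 1 / sqrt (real (Suc m)))"
proof -
  define a b where "a = sqrt (real m)" and "b = sqrt (real (Suc m))"
  have ab: "0 < a" "a \<le> b" "b ^ 2 = a ^ 2 + 1" "real (Suc m) = b ^ 2"
    using assms by (auto simp: a_def b_def)
  have b: "0 < b" using ab by simp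
  have "(b - a) * (a + b) = 1" using ab by (simp add: power2_eq_square algebra_simps)
  hence ba: "b - a = 1 / (a + b)" using ab b by (simp add: field_simps)
  have "1 / a - 1 / b = (b - a) / (a * b)" using ab b by (simp add: field_simps)
  also have "\<dots> = 1 / ((a + b) * (a * b))" by (simp add: ba)
  also have "\<dots> \<ge> 1 / ((2 * b) * (b * b))"
    using ab b by (intro divide_left_mono mult_mono mult_pos_pos) auto
  finally have le: "1 / ((2 * b) * (b * b)) \<le> 1 / a - 1 / b" .
  have eq: "b / (b ^ 2) ^ 2 = 2 * (1 / ((2 * b) * (b * b)))"
    using b by (simp add: field_simps power2_eq_square)
  have sq: "real (Suc m) ^ 2 = (b ^ 2) ^ 2" by (simp only: ab(4))
  show ?thesis unfolding sq a_def[symmetric] b_def[symmetric] eq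
    by (rule mult_left_mono[OF le]) simp
qed

text \<open>The inner sum is slow, so a last exponent of at least 2 leaves summable increments. The
  same estimate proves that the limit in \<open>mzv\<close> exists.\<close>

lemma trunc_zeta_admissible:
  assumes "is_index k" "admissible k"
  shows "small (\<lambda>N. trunc_zeta N k - mzv k)"
proof (cases k rule: rev_cases)
  case Nil
  have "mzv [] = 1" by (simp add: mzv_def)
  thus ?thesis using Nil by simp
next
  case (snoc ks m)
  have m: "m \<ge> 2" and ks: "is_index ks" using assms snoc by (auto simp: admissible_def)
  let ?f = "\<lambda>N. trunc_zeta N k"
  \<comment> \<open>The exponent 1/2 is chosen to fit \<open>inverse_sqrt_telescope\<close>.\<close>
  have "(\<lambda>n. trunc_zeta n ks) \<in> O(\<lambda>n. real n powr (1/2))"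
    using slow_trunc_zeta[OF ks] unfolding slow_def by simp
  then obtain c where c: "c > 0" "eventually (\<lambda>n. norm (trunc_zeta n ks) \<le> c * norm (real n powr (1/2))) sequentially"
    by (rule landau_o.bigE)
  obtain N0 where N0': "\<forall>n\<ge>N0. norm (trunc_zeta n ks) \<le> c * norm (real n powr (1/2))"
    using c(2) unfolding eventually_sequentially by blast
  have N0: "trunc_zeta n ks \<le> c * sqrt (real n)" if "n \<ge> N0" for n
    using N0'[rule_format, OF that] by (simp add: powr_half_sqrt)
  define N1 where "N1 = max N0 1"
  have incr: "?f (Suc N) - ?f N \<le> 2 * c * (1 / sqrt (real N) - 1 / sqrt (real (Suc N)))" if "N \<ge> N1" for N
  proof -
    have "?f (Suc N) - ?f N = trunc_zeta N ks / real (Suc N) ^ m"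
      unfolding snoc trunc_zeta_Suc by simp
    also have "\<dots> \<le> (c * sqrt (real (Suc N))) / real (Suc N) ^ 2"
    proof (intro frac_le)
      have "trunc_zeta N ks \<le> c * sqrt (real N)" using that by (intro N0) (simp add: N1_def)
      also have "\<dots> \<le> c * sqrt (real (Suc N))" using c by (intro mult_left_mono) auto
      finally show "trunc_zeta N ks \<le> c * sqrt (real (Suc N))" .
      show "real (Suc N) ^ 2 \<le> real (Suc N) ^ m" using m by (intro power_increasing) auto
    qed (use c in auto)
    also have "\<dots> = c * (sqrt (real (Suc N)) / real (Suc N) ^ 2)" by simp
    also have "\<dots> \<le> c * (2 * (1 / sqrt (real N) - 1 / sqrt (real (Suc N))))"
      using c that by (intro mult_left_mono inverse_sqrt_telescope) (auto simp: N1_def)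
    finally show ?thesis by (simp only: mult_ac)
  qed
  have tail: "?f M - ?f N \<le> 2 * c * (1 / sqrt (real N) - 1 / sqrt (real M))" if "N \<ge> N1" "M \<ge> N" for N M
    using that(2)
  proof (induction M rule: dec_induct)
    case (step M)
    have "?f (Suc M) - ?f N = (?f (Suc M) - ?f M) + (?f M - ?f N)" by simp
    also have "\<dots> \<le> 2 * c * (1 / sqrt (real M) - 1 / sqrt (real (Suc M))) + 2 * c * (1 / sqrt (real N) - 1 / sqrt (real M))"
      using incr[of M] step that(1) by (intro add_mono) auto
    finally show ?case by (simp add: algebra_simps)
  qed simp
  have tail': "?f M \<le> ?f N + 2 * c / sqrt (real N)" if "N \<ge> N1" "M \<ge> N" for N M
  proof -
    have "2 * c * (1 / sqrt (real N) - 1 / sqrt (real M)) \<le> 2 * c * (1 / sqrt (real N))"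
      using c by (intro mult_left_mono) auto
    thus ?thesis using tail[OF that] by simp
  qed
  have inc: "incseq ?f"
    unfolding snoc by (rule incseq_SucI) (simp add: trunc_zeta_Suc trunc_zeta_nonneg)
  have bounded: "\<forall>n. ?f n \<le> ?f N1 + 2 * c / sqrt (real N1)"
  proof
    fix n
    have "?f n \<le> ?f (max n N1)" by (rule incseqD[OF inc]) simp
    also have "\<dots> \<le> ?f N1 + 2 * c / sqrt (real N1)" by (rule tail') auto
    finally show "?f n \<le> ?f N1 + 2 * c / sqrt (real N1)" .
  qed
  obtain l where l: "?f \<longlonglongrightarrow> l" "\<forall>n. ?f n \<le> l"
    by (rule incseq_convergent[OF inc bounded])
  have "(\<lambda>N. msum (rev k) (Suc N)) \<longlonglongrightarrow> l"
    using l(1) by (simp add: msum_eq_trunc_zeta)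
  hence "(\<lambda>N. msum (rev k) N) \<longlonglongrightarrow> l" by (rule LIMSEQ_imp_Suc)
  hence mzv: "mzv k = l" unfolding mzv_def by (rule limI)
  have "(\<lambda>N. trunc_zeta N k - mzv k) \<in> O(\<lambda>N. real N powr (-(1/2)))"
  proof (rule bigoI[of _ "2 * c"], rule eventually_mono[OF eventually_ge_at_top[of N1]])
    fix N assume N: "N \<ge> N1"
    hence "N > 0" by (simp add: N1_def)
    have "l \<le> ?f N + 2 * c / sqrt (real N)"
      by (rule LIMSEQ_le_const2[OF l(1)]) (use tail'[OF N] in blast)
    moreover have "?f N \<le> l" using l(2) by blast
    ultimately have "\<bar>?f N - l\<bar> \<le> 2 * c * inverse (sqrt (real N))"
      by (simp add: divide_inverse)
    moreover have "real N powr (-(1/2)) = inverse (sqrt (real N))"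
      by (simp only: powr_minus powr_half_sqrt of_nat_0_le_iff)
    moreover have "\<bar>inverse (sqrt (real N))\<bar> = inverse (sqrt (real N))" by simp
    ultimately show "norm (trunc_zeta N k - mzv k) \<le> 2 * c * norm (real N powr (-(1/2)))"
      by (simp only: mzv real_norm_def)
  qed
  thus ?thesis unfolding small_def by (intro exI[of _ "1/2"]) auto
qed

lemma harm_top: "filterlim (\<lambda>n. trunc_zeta n [1]) at_top sequentially"
  unfolding trunc_zeta_one by (rule harm_at_top)

interpretation harmonic: regulator Harmonic trunc_zeta
proof
  show "signed (trunc_zeta n) k * signed (trunc_zeta n) l = lincomb (signed (trunc_zeta n)) (prod_of Harmonic k l)" for n k l
  proof -
    have "trunc_zeta n = chain_sum (map (\<lambda>n. 1 / real n) [1..<Suc n])"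
      by (rule ext) (simp add: trunc_zeta_def)
    thus ?thesis by (simp only: prod_of.simps chain_sum_harm_prod)
  qed
  show "slow (\<lambda>n. trunc_zeta n [1])" unfolding trunc_zeta_one by (rule slow_harm)
qed (use trunc_zeta_admissible harm_top in auto)

section \<open>Polylogarithms near 1\<close>

lemma shuffle_one_snoc:
  "mset (shuffle [a] (v @ [b])) = {#v @ [b, a]#} + image_mset (\<lambda>w. w @ [b]) (mset (shuffle [a] v))"
  by (induction v) (simp_all add: multiset.map_comp o_def)

lemma shuffle_snoc:
  "mset (shuffle (u @ [a]) (v @ [b]))
     = image_mset (\<lambda>w. w @ [a]) (mset (shuffle u (v @ [b]))) + image_mset (\<lambda>w. w @ [b]) (mset (shuffle (u @ [a]) v))"
proof (induction u v rule: shuffle.induct)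
  case (1 v)
  show ?case by (simp add: shuffle_one_snoc)
next
  case (2 c u)
  show ?case using shuffle_snoc_one[of "c # u" a b] by simp
next
  case (3 c u d v)
  thus ?case by (simp add: multiset.map_comp o_def)
qed

text \<open>\<open>shuffle\<close> strips first letters, whereas differentiating a polylogarithm
  strips the last letter of its word; reversal reconciles the two.\<close>

lemma shuffle_rev: "mset (shuffle (rev u) (rev v)) = image_mset rev (mset (shuffle u v))"
  by (induction u v rule: shuffle.induct) (simp_all add: shuffle_snoc multiset.map_comp o_def)

text \<open>The iterated integral whose outermost form belongs to the first letter:
  \<open>dz/z\<close> for e_0 and \<open>dz/(1 - z)\<close> for e_1. Words of indices enter
  reversed. Division by \<open>n = 0\<close> makes the constant term 0.\<close>

fun word_series :: "bool list \<Rightarrow> real fps" where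
  "word_series [] = 1"
| "word_series (a # w) = Abs_fps (\<lambda>n. (if a then \<Sum>m<n. word_series w $ m else word_series w $ n) / real n)"

definition theta :: "real fps \<Rightarrow> real fps" where
  "theta F = fps_X * fps_deriv F"

lemma theta_nth: "theta F $ n = real n * F $ n"
  by (cases n) (simp_all add: theta_def)

lemma theta_mult: "theta (F * G) = theta F * G + F * theta G"
  by (simp add: theta_def algebra_simps)

lemma theta_add: "theta (F + G) = theta F + theta G"
  by (simp add: theta_def algebra_simps)

lemma theta_sum_list: "theta (sum_list (map f xs)) = (\<Sum>x\<leftarrow>xs. theta (f x))"
  by (induction xs) (simp_all add: theta_def algebra_simps)

lemma theta_eqI:
  assumes "theta F = theta G" "F $ 0 = G $ 0"
  shows "F = G"
proof (rule fps_ext)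
  fix n
  have "real n * F $ n = real n * G $ n"
    using arg_cong[OF assms(1), of "\<lambda>H. H $ n"] by (simp add: theta_nth)
  thus "F $ n = G $ n" using assms(2) by (cases n) auto
qed

text \<open>\<open>z\<close> times the differential form of the letter, to match
  \<open>theta\<close>, which is \<open>z d/dz\<close>.\<close>

definition letter_series :: "bool \<Rightarrow> real fps" where
  "letter_series a = (if a then Abs_fps (\<lambda>n. if n = 0 then 0 else 1) else 1)"

lemma word_series_0: "w \<noteq> [] \<Longrightarrow> word_series w $ 0 = 0"
  by (cases w) auto

text \<open>The word e_0 alone is excluded: its integral is a logarithm, while
  \<open>word_series [False]\<close> is 0 by the division convention.\<close>

lemma theta_word_series:
  assumes "w \<noteq> [] \<or> a"
  shows "theta (word_series (a # w)) = letter_series a * word_series w"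
proof (rule fps_ext)
  fix n
  show "theta (word_series (a # w)) $ n = (letter_series a * word_series w) $ n"
  proof (cases a)
    case True
    have "(letter_series True * word_series w) $ n = (\<Sum>i=0..n. if i = 0 then 0 else word_series w $ (n - i))"
      by (auto simp: letter_series_def fps_mult_nth intro!: sum.cong)
    also have "\<dots> = (\<Sum>i=1..n. word_series w $ (n - i))"
      by (rule sum.mono_neutral_cong_right) auto
    also have "\<dots> = (\<Sum>m<n. word_series w $ m)"
      by (rule sum.reindex_bij_witness[of _ "\<lambda>m. n - m" "\<lambda>i. n - i"]) auto
    finally show ?thesis using True by (cases n) (simp_all add: theta_nth)
  next
    case False
    thus ?thesis using assms word_series_0[of w] by (cases n) (simp_all add: theta_nth letter_series_def)
  qed
qed

lemma fps_nth_sum_list: "sum_list (map f xs) $ n = (\<Sum>x\<leftarrow>xs. f x $ n)"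
  by (induction xs) auto

lemma shuffle_nonempty: "u \<noteq> [] \<or> v \<noteq> [] \<Longrightarrow> w \<in> set (shuffle u v) \<Longrightarrow> w \<noteq> []"
  by (cases u; cases v) auto

text \<open>The product rule of \<open>theta\<close> reproduces the recursion of
  \<open>shuffle\<close>, and \<open>theta\<close> together with the constant term determines a
  series. The condition on last letters keeps logarithms out.\<close>

lemma word_series_shuffle:
  "(u = [] \<or> last u) \<Longrightarrow> (v = [] \<or> last v) \<Longrightarrow>
   word_series u * word_series v = (\<Sum>w\<leftarrow>shuffle u v. word_series w)"
proof (induction u v rule: shuffle.induct)
  case (3 a u b v)
  have a: "u \<noteq> [] \<or> a" and b: "v \<noteq> [] \<or> b" and u: "u = [] \<or> last u" and v: "v = [] \<or> last v"
    using 3(3,4) by (auto split: if_splits)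
  have IH: "word_series u * word_series (b # v) = (\<Sum>w\<leftarrow>shuffle u (b # v). word_series w)"
    "word_series (a # u) * word_series v = (\<Sum>w\<leftarrow>shuffle (a # u) v. word_series w)"
    using 3 u v by blast+
  have th: "(\<Sum>w\<leftarrow>W. theta (word_series (c # w))) = letter_series c * (\<Sum>w\<leftarrow>W. word_series w)"
    if "\<And>w. w \<in> set W \<Longrightarrow> w \<noteq> []" for W c
    using that by (induction W) (simp_all add: theta_word_series algebra_simps del: word_series.simps)
  show ?case
  proof (rule theta_eqI)
    have "theta (word_series (a # u) * word_series (b # v))
        = letter_series a * (word_series u * word_series (b # v)) + letter_series b * (word_series (a # u) * word_series v)"
      using theta_word_series[OF a] theta_word_series[OF b] by (simp only: theta_mult mult_ac)
    also have "\<dots> = (\<Sum>w\<leftarrow>shuffle u (b # v). theta (word_series (a # w))) + (\<Sum>w\<leftarrow>shuffle (a # u) v. theta (word_series (b # w)))"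
    proof -
      have "(\<Sum>w\<leftarrow>shuffle u (b # v). theta (word_series (a # w))) = letter_series a * (\<Sum>w\<leftarrow>shuffle u (b # v). word_series w)"
        by (rule th, rule shuffle_nonempty[of u "b # v"]) simp_all
      moreover have "(\<Sum>w\<leftarrow>shuffle (a # u) v. theta (word_series (b # w))) = letter_series b * (\<Sum>w\<leftarrow>shuffle (a # u) v. word_series w)"
        by (rule th, rule shuffle_nonempty[of "a # u" v]) simp_all
      ultimately show ?thesis by (simp only: IH)
    qed
    also have "\<dots> = theta (\<Sum>w\<leftarrow>shuffle (a # u) (b # v). word_series w)"
      by (simp only: shuffle.simps map_append sum_list.append map_map o_def theta_add theta_sum_list)
    finally show "theta (word_series (a # u) * word_series (b # v)) = theta (\<Sum>w\<leftarrow>shuffle (a # u) (b # v). word_series w)" .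
    have "(\<Sum>w\<leftarrow>shuffle (a # u) (b # v). word_series w) $ 0 = 0"
      unfolding fps_nth_sum_list
      by (rule sum_list_zero_if) (use shuffle_nonempty[of "a # u" "b # v"] word_series_0 in blast)
    thus "(word_series (a # u) * word_series (b # v)) $ 0 = (\<Sum>w\<leftarrow>shuffle (a # u) (b # v). word_series w) $ 0"
      by simp
  qed
qed (simp_all del: word_series.simps(2))

definition trunc_series :: "nat list \<Rightarrow> real fps" where
  "trunc_series k = Abs_fps (\<lambda>N. trunc_zeta N k)"

text \<open>The multiple polylogarithm of \<open>k\<close>: the factor \<open>1 - z\<close> turns
  the generating series of the partial sums into that of their increments.\<close>

definition li_series :: "nat list \<Rightarrow> real fps" where
  "li_series k = (1 - fps_X) * trunc_series k"

lemma li_series_nth: "li_series k $ n = trunc_zeta n k - (if n = 0 then 0 else trunc_zeta (n - 1) k)"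
  by (cases n) (simp_all add: li_series_def trunc_series_def algebra_simps)

lemma li_series_Nil: "li_series [] = 1"
  by (rule fps_ext) (simp add: li_series_nth)

lemma li_series_snoc_nth:
  "li_series (ks @ [m]) $ n = (if n = 0 then 0 else trunc_zeta (n - 1) ks / real n ^ m)"
  by (cases n) (simp_all add: li_series_nth trunc_zeta_0 trunc_zeta_Suc)

lemma sum_li_series: "(\<Sum>m<Suc n. li_series k $ m) = trunc_zeta n k"
  by (induction n) (simp_all add: li_series_nth)

lemma word_series_word_of:
  assumes "is_index k"
  shows "word_series (rev (word_of k)) = li_series k"
  using assms
proof (induction k rule: rev_induct)
  case Nil
  show ?case by (simp add: li_series_Nil)
next
  case (snoc m ks)
  have "word_series (rev (word_of (ks @ [Suc j]))) = li_series (ks @ [Suc j])" for j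
  proof (induction j)
    case 0
    have "word_series (True # rev (word_of ks)) = li_series (ks @ [1])"
    proof (rule fps_ext)
      fix n
      show "word_series (True # rev (word_of ks)) $ n = li_series (ks @ [1]) $ n"
        using snoc sum_li_series[where n = "n - 1" and k = ks] by (cases n) (simp_all add: li_series_snoc_nth)
    qed
    thus ?case by simp
  next
    case (Suc j)
    have "word_series (False # rev (word_of (ks @ [Suc j]))) = li_series (ks @ [Suc (Suc j)])"
      by (rule fps_ext) (simp add: Suc.IH li_series_snoc_nth del: word_of_simps)
    moreover have "rev (word_of (ks @ [Suc (Suc j)])) = False # rev (word_of (ks @ [Suc j]))"
      by (simp only: word_of_snoc_Suc[OF zero_less_Suc] rev_append rev.simps append.simps)
    ultimately show ?case by (simp only:)
  qed
  from this[of "m - 1"] show ?case using snoc.prems by simp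
qed

lemma li_series_shuffle:
  assumes "is_index k" "is_index l"
  shows "li_series k * li_series l = (\<Sum>w\<leftarrow>shuffle (word_of k) (word_of l). li_series (index_of w))"
proof -
  have last: "rev (word_of j) = [] \<or> last (rev (word_of j))" for j
    using good_word_of[of j] by (auto simp: good_word_def last_rev)
  have "li_series k * li_series l = (\<Sum>w\<leftarrow>shuffle (rev (word_of k)) (rev (word_of l)). word_series w)"
    using word_series_shuffle[OF last[of k] last[of l]] assms by (simp add: word_series_word_of)
  also have "\<dots> = (\<Sum>w\<in>#mset (shuffle (rev (word_of k)) (rev (word_of l))). word_series w)"
    by (simp only: mset_map[symmetric] sum_mset_sum_list)
  also have "\<dots> = (\<Sum>w\<in>#mset (shuffle (word_of k) (word_of l)). word_series (rev w))"
    by (simp add: shuffle_rev multiset.map_comp o_def)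
  also have "\<dots> = (\<Sum>w\<leftarrow>shuffle (word_of k) (word_of l). word_series (rev w))"
    by (simp only: mset_map[symmetric] sum_mset_sum_list)
  also have "\<dots> = (\<Sum>w\<leftarrow>shuffle (word_of k) (word_of l). li_series (index_of w))"
  proof (rule arg_cong[where f = sum_list], rule map_cong[OF refl])
    fix w assume "w \<in> set (shuffle (word_of k) (word_of l))"
    hence "good_word w" by (rule good_word_shuffle[OF good_word_of good_word_of])
    thus "word_series (rev w) = li_series (index_of w)"
      using word_series_word_of[of "index_of w"] by (simp add: good_word_index_of)
  qed
  finally show ?thesis .
qed

text \<open>The square makes the Abel means preserve polynomial decay: the first \<open>m\<close>
  terms have total weight at most \<open>m / (m + 1) ^ 2\<close>. With \<open>1 - 1/(m + 1)\<close>
  their weight would not tend to 0.\<close>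

definition node :: "nat \<Rightarrow> real" where
  "node m = 1 - 1 / (real m + 1) ^ 2"

lemma node: "0 \<le> node m" "node m < 1" "\<bar>node m\<bar> < 1" "1 - node m = 1 / (real m + 1) ^ 2"
proof -
  have "1 / (real m + 1) ^ 2 \<le> 1" by simp
  thus "0 \<le> node m" unfolding node_def by simp
  show "node m < 1" unfolding node_def by simp
  thus "\<bar>node m\<bar> < 1" using \<open>0 \<le> node m\<close> by simp
qed (simp add: node_def)

lemma summable_slow:
  assumes "slow e" "\<bar>z\<bar> < 1"
  shows "summable (\<lambda>N. e N * z ^ N)"
proof -
  have "e \<in> O(\<lambda>n. real n powr 1)" by (rule assms(1)[unfolded slow_def, rule_format]) simp
  then obtain c where c: "c > 0" "eventually (\<lambda>n. norm (e n) \<le> c * norm (real n powr 1)) sequentially"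
    by (rule landau_o.bigE)
  have "summable (\<lambda>n. c * (real (Suc n) * \<bar>z\<bar> ^ n))"
    using geometric_deriv_sums[of "\<bar>z\<bar>"] assms(2) by (intro summable_mult) (auto simp: sums_iff)
  thus ?thesis
  proof (rule summable_comparison_test_ev[rotated])
    show "eventually (\<lambda>n. norm (e n * z ^ n) \<le> c * (real (Suc n) * \<bar>z\<bar> ^ n)) sequentially"
      using c(2)
    proof eventually_elim
      case (elim n)
      hence "\<bar>e n\<bar> \<le> c * real (Suc n)" using c(1) by (simp add: algebra_simps)
      hence "\<bar>e n\<bar> * \<bar>z\<bar> ^ n \<le> (c * real (Suc n)) * \<bar>z\<bar> ^ n" by (intro mult_right_mono) auto
      thus ?case by (simp add: abs_mult power_abs mult.assoc)
    qed
  qed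
qed

section \<open>Abel means\<close>

definition average :: "nat \<Rightarrow> (nat \<Rightarrow> real) \<Rightarrow> real" where
  "average m e = (1 - node m) * (\<Sum>N. e N * node m ^ N)"

lemma average_add:
  assumes "slow e" "slow e'"
  shows "average m (\<lambda>N. e N + e' N) = average m e + average m e'"
  unfolding average_def distrib_right
    suminf_add[OF summable_slow[OF assms(1) node(3)] summable_slow[OF assms(2) node(3)], symmetric]
  by (rule distrib_left)

lemma average_cmult:
  assumes "slow e"
  shows "average m (\<lambda>N. c * e N) = c * average m e"
  using suminf_mult[OF summable_slow[OF assms node(3)[of m]], of c]
  by (simp add: average_def mult.assoc)

lemma average_const: "average m (\<lambda>N. c) = c"
  using suminf_geometric[of "node m"] node[of m] suminf_mult[OF summable_geometric[of "node m"], of c]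
  by (simp add: average_def)

text \<open>The series is cut at \<open>m\<close>: the head is bounded by its small total weight,
  the tail by the decay of \<open>e\<close> at \<open>m\<close>, as all weights sum to 1.\<close>

lemma small_average:
  assumes "small e"
  shows "small (\<lambda>m. average m e)"
proof -
  from assms obtain p where p: "p > 0" "e \<in> O(\<lambda>n. real n powr (-p))"
    by (auto simp: small_def)
  obtain c where c: "c > 0" "eventually (\<lambda>n. norm (e n) \<le> c * norm (real n powr (-p))) sequentially"
    using p(2) by (rule landau_o.bigE)
  obtain N0 where N0': "\<forall>n\<ge>N0. norm (e n) \<le> c * norm (real n powr (-p))"
    using c(2) unfolding eventually_sequentially by blast
  have N0: "\<bar>e n\<bar> \<le> c * real n powr (-p)" if "n \<ge> N0" for n
    using N0'[rule_format, OF that] by simp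
  have "Bseq e" by (rule convergent_imp_Bseq[OF convergentI[OF small_tendsto[OF assms]]])
  then obtain K where K': "K > 0" "\<forall>n. norm (e n) \<le> K" by (rule BseqE)
  have K: "K > 0" "\<bar>e n\<bar> \<le> K" for n using K' by simp_all
  have bound: "\<bar>average m e\<bar> \<le> K * real m powr (-1) + c * real m powr (-p)" if "m \<ge> max N0 1" for m
  proof -
    let ?z = "node m"
    note z = node[of m]
    have sm: "summable (\<lambda>N. e N * ?z ^ N)" by (rule summable_slow[OF small_slow[OF assms] z(3)])
    have "(\<Sum>N. e N * ?z ^ N) = (\<Sum>N. e (N + m) * ?z ^ (N + m)) + (\<Sum>N<m. e N * ?z ^ N)"
      by (rule suminf_split_initial_segment[OF sm])
    hence "\<bar>\<Sum>N. e N * ?z ^ N\<bar> \<le> \<bar>\<Sum>N. e (N + m) * ?z ^ (N + m)\<bar> + \<bar>\<Sum>N<m. e N * ?z ^ N\<bar>"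
      by (simp only: abs_triangle_ineq)
    also have "\<bar>\<Sum>N<m. e N * ?z ^ N\<bar> \<le> (\<Sum>N<m. \<bar>e N * ?z ^ N\<bar>)" by (rule sum_abs)
    also have "\<dots> \<le> (\<Sum>N<m. K * 1)"
      unfolding abs_mult using K z by (intro sum_mono mult_mono) (auto intro: power_le_one)
    also have "\<bar>\<Sum>N. e (N + m) * ?z ^ (N + m)\<bar> \<le> (\<Sum>N. (c * real m powr (-p)) * ?z ^ N)"
    proof -
      have le: "\<bar>e (N + m) * ?z ^ (N + m)\<bar> \<le> (c * real m powr (-p)) * ?z ^ N" for N
      proof -
        have "\<bar>e (N + m)\<bar> \<le> c * real (N + m) powr (-p)" using that by (intro N0) auto
        also have "\<dots> \<le> c * real m powr (-p)"
          using c p that by (intro mult_left_mono powr_mono2') auto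
        finally have "\<bar>e (N + m)\<bar> \<le> c * real m powr (-p)" .
        moreover have "\<bar>?z ^ (N + m)\<bar> \<le> ?z ^ N"
          using z power_decreasing[of N "N + m" ?z] by simp
        ultimately show ?thesis unfolding abs_mult using c by (intro mult_mono) auto
      qed
      have sm': "summable (\<lambda>N. (c * real m powr (-p)) * ?z ^ N)"
        using z by (intro summable_mult summable_geometric) auto
      have sma: "summable (\<lambda>N. \<bar>e (N + m) * ?z ^ (N + m)\<bar>)"
        by (rule summable_comparison_test'[OF sm', of 0]) (use le in simp)
      have "\<bar>\<Sum>N. e (N + m) * ?z ^ (N + m)\<bar> \<le> (\<Sum>N. \<bar>e (N + m) * ?z ^ (N + m)\<bar>)"
        by (rule summable_rabs[OF sma])
      also have "\<dots> \<le> (\<Sum>N. (c * real m powr (-p)) * ?z ^ N)"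
        by (rule suminf_le[OF le sma sm'])
      finally show ?thesis .
    qed
    also have "(\<Sum>N. (c * real m powr (-p)) * ?z ^ N) = (c * real m powr (-p)) * (1 / (1 - ?z))"
      using z by (subst suminf_mult) (auto simp: suminf_geometric summable_geometric)
    finally have "\<bar>\<Sum>N. e N * ?z ^ N\<bar> \<le> (c * real m powr (-p)) * (1 / (1 - ?z)) + real m * K" by simp
    hence "(1 - ?z) * \<bar>\<Sum>N. e N * ?z ^ N\<bar> \<le> (1 - ?z) * ((c * real m powr (-p)) * (1 / (1 - ?z)) + real m * K)"
      using z by (intro mult_left_mono) auto
    also have "\<dots> = c * real m powr (-p) + (real m * (1 / (real m + 1) ^ 2)) * K"
    proof -
      have "(1 / q) * (x * (1 / (1 / q)) + y * K) = x + (y * (1 / q)) * K" if "q \<noteq> 0" for q x y :: real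
        using that by (simp add: field_simps)
      moreover have "(real m + 1) ^ 2 \<noteq> 0" by simp
      ultimately show ?thesis by (simp only: z(4))
    qed
    also have "real m * (1 / (real m + 1) ^ 2) \<le> real m powr (-1)"
    proof -
      have "real m * real m \<le> (real m + 1) ^ 2" by (simp add: power2_eq_square algebra_simps)
      thus ?thesis using that by (simp add: powr_minus field_simps)
    qed
    finally show ?thesis using z K by (simp add: average_def abs_mult mult.commute)
  qed
  have g: "small (\<lambda>m. K * real m powr (-1) + c * real m powr (-p))"
  proof (intro small_add small_cmult)
    show "small (\<lambda>m. real m powr (-1))" unfolding small_def by (intro exI[of _ 1]) simp
    show "small (\<lambda>m. real m powr (-p))" unfolding small_def using p(1) by (intro exI[of _ p]) simp
  qed
  then obtain q where q: "q > 0" "(\<lambda>m. K * real m powr (-1) + c * real m powr (-p)) \<in> O(\<lambda>n. real n powr (-q))"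
    by (auto simp: small_def)
  have "(\<lambda>m. average m e) \<in> O(\<lambda>m. K * real m powr (-1) + c * real m powr (-p))"
  proof (rule bigoI[of _ 1], rule eventually_mono[OF eventually_ge_at_top[of "max N0 1"]])
    fix m assume "m \<ge> max N0 1"
    from bound[OF this] show "norm (average m e) \<le> 1 * norm (K * real m powr (-1) + c * real m powr (-p))"
      by simp
  qed
  from landau_o.big_trans[OF this q(2)] show ?thesis
    using q(1) by (auto simp: small_def)
qed

lemma conv_radius_slow:
  assumes "slow (\<lambda>n. F $ n)"
  shows "fps_conv_radius F \<ge> 1"
  unfolding fps_conv_radius_def
proof (rule conv_radius_geI_ex)
  fix r :: real assume "0 < r" "ereal r < 1"
  thus "\<exists>z. norm z = r \<and> summable (\<lambda>n. F $ n * z ^ n)"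
    by (intro exI[of _ r]) (auto intro!: summable_slow[OF assms])
qed

lemma conv_radius_one_minus_X: "fps_conv_radius (1 - fps_X :: real fps) = \<infinity>"
  using fps_conv_radius_diff[of "1 :: real fps" fps_X] by simp

lemma conv_radius_li_series:
  assumes "is_index k"
  shows "fps_conv_radius (trunc_series k) \<ge> 1" "fps_conv_radius (li_series k) \<ge> 1"
proof -
  show 1: "fps_conv_radius (trunc_series k) \<ge> 1"
    using slow_trunc_zeta[OF assms] by (intro conv_radius_slow) (simp add: trunc_series_def)
  have "1 \<le> min (fps_conv_radius (1 - fps_X :: real fps)) (fps_conv_radius (trunc_series k))"
    using 1 by (simp add: conv_radius_one_minus_X)
  thus "fps_conv_radius (li_series k) \<ge> 1"
    unfolding li_series_def using fps_conv_radius_mult by (rule order.trans)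
qed

definition abel_zeta :: "nat \<Rightarrow> nat list \<Rightarrow> real" where
  "abel_zeta m k = eval_fps (li_series k) (node m)"

lemma node_in_radius: "fps_conv_radius F \<ge> 1 \<Longrightarrow> ereal (norm (node m)) < fps_conv_radius F"
proof (rule less_le_trans)
  show "ereal (norm (node m)) < 1" using node(3)[of m] by simp
qed

lemma abel_zeta_average:
  assumes "is_index k"
  shows "abel_zeta m k = average m (\<lambda>N. trunc_zeta N k)"
proof -
  have "abel_zeta m k = eval_fps (1 - fps_X) (node m) * eval_fps (trunc_series k) (node m)"
    unfolding abel_zeta_def li_series_def
  proof (rule eval_fps_mult)
    show "ereal (norm (node m)) < fps_conv_radius (1 - fps_X :: real fps)"
      by (simp add: conv_radius_one_minus_X)
    show "ereal (norm (node m)) < fps_conv_radius (trunc_series k)"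
      by (intro node_in_radius conv_radius_li_series assms)
  qed
  also have "eval_fps (1 - fps_X) (node m) = 1 - node m"
    using eval_fps_diff[of "node m" 1 fps_X] by simp
  finally show ?thesis by (simp add: average_def eval_fps_def trunc_series_def)
qed

lemma average_diff_const:
  assumes "slow e"
  shows "average m (\<lambda>N. e N - c) = average m e - c"
  using average_add[OF assms slow_const[of "- c"], of m] average_const[of m "- c"] by simp

text \<open>The polylogarithm of \<open>[1]\<close> is \<open>- ln (1 - z)\<close>, and
  \<open>1 - z\<close> is the inverse square of \<open>m + 1\<close> at the node.\<close>

lemma abel_zeta_one: "abel_zeta m [1] = 2 * ln (real m + 1)"
proof -
  have z: "0 < 1 - node m" "1 - node m < 2" using node[of m] by auto
  have sm: "summable (\<lambda>n. (if n = 0 then 0 else 1 / real n) * node m ^ n)"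
  proof (rule summable_slow[OF slow_bounded[OF _ slow_const[of 1]] node(3)])
    show "\<bar>if n = 0 then 0 else 1 / real n\<bar> \<le> (1::real)" for n :: nat by simp
  qed
  have "li_series [1] $ n = (if n = 0 then 0 else 1 / real n)" for n
    using li_series_snoc_nth[of "[]" 1 n] by simp
  hence "abel_zeta m [1] = (\<Sum>n. (if n = 0 then 0 else 1 / real n) * node m ^ n)"
    by (simp add: abel_zeta_def eval_fps_def)
  also have "\<dots> = (\<Sum>n. 1 / real (Suc n) * node m ^ Suc n)"
    using suminf_split_head[OF sm] by simp
  \<comment> \<open>Rewritten as the logarithm series about 1, taken at
    \<open>1 - node m\<close>.\<close>
  also have "\<dots> = - (\<Sum>n. (-1) ^ n * (1 / real (n + 1)) * ((1 - node m) - 1) ^ Suc n)"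
  proof -
    have "(-1) ^ n * (1 / real (n + 1)) * ((1 - node m) - 1) ^ Suc n = - (1 / real (Suc n) * node m ^ Suc n)" for n
    proof -
      have e: "((1 - node m) - 1) ^ Suc n = (-1) ^ Suc n * node m ^ Suc n"
        by (simp only: power_mult_distrib[symmetric]) simp
      have "(-1) ^ n * (1 / real (n + 1)) * ((1 - node m) - 1) ^ Suc n
          = ((-1) ^ n * (-1) ^ Suc n) * (1 / real (n + 1) * node m ^ Suc n)"
        by (simp only: e mult_ac)
      also have "(-1) ^ n * (-1 :: real) ^ Suc n = -1"
        by (simp flip: power_add)
      finally show ?thesis by simp
    qed
    moreover have "summable (\<lambda>n. 1 / real (Suc n) * node m ^ Suc n)"
      using iffD2[OF summable_Suc_iff sm] by simp
    ultimately show ?thesis by (simp only: suminf_minus minus_minus)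
  qed
  also have "\<dots> = - ln (1 - node m)"
    using ln_series[OF z] by simp
  also have "\<dots> = 2 * ln (real m + 1)"
    using ln_realpow[of "real m + 1" 2] by (simp add: node(4) ln_div)
  finally show ?thesis .
qed

lemma length_word_of: "is_index k \<Longrightarrow> length (filter id (word_of k)) = length k"
  by (induction k) (auto simp: word_of_def)

lemma length_filter_shuffle: "w \<in> set (shuffle u v) \<Longrightarrow> length (filter P w) = length (filter P u) + length (filter P v)"
  by (induction u v arbitrary: w rule: shuffle.induct) auto

text \<open>Shuffling preserves the number of letters e_1, so the sign in \<open>signed\<close>
  factors out of a product.\<close>

lemma length_index_of_shuffle:
  assumes "is_index k" "is_index l" "w \<in> set (shuffle (word_of k) (word_of l))"
  shows "length (index_of w) = length k + length l"
proof -
  have g: "good_word w" by (rule good_word_shuffle[OF good_word_of good_word_of assms(3)])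
  have "length (index_of w) = length (filter id w)"
    using length_word_of[of "index_of w"] good_word_index_of[OF g] by simp
  thus ?thesis using length_filter_shuffle[OF assms(3), of id] length_word_of assms(1,2) by simp
qed

interpretation abel: regulator Shuffle abel_zeta
proof
  show "abel_zeta n [] = 1" for n by (simp add: abel_zeta_def li_series_Nil)
  show "small (\<lambda>n. abel_zeta n k - mzv k)" if "is_index k" "admissible k" for k
    using small_average[OF trunc_zeta_admissible[OF that]] that
    by (simp add: abel_zeta_average average_diff_const slow_trunc_zeta)
  show "filterlim (\<lambda>n. abel_zeta n [1]) at_top sequentially"
    unfolding abel_zeta_one by real_asymp
  show "slow (\<lambda>n. abel_zeta n [1])"
    unfolding abel_zeta_one slow_def
  proof (intro allI impI)
    fix p :: real assume "p > 0"
    thus "(\<lambda>n. 2 * ln (real n + 1)) \<in> O(\<lambda>n. real n powr p)" by real_asymp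
  qed
  fix n k l assume kl: "is_index k" "is_index l"
  let ?W = "shuffle (word_of k) (word_of l)"
  have ind: "is_index (index_of w)" if "w \<in> set ?W" for w
    using good_word_shuffle[OF good_word_of good_word_of that] by (rule good_word_index_of)
  \<comment> \<open>The radius of convergence is carried along since additivity of the evaluation is
    available inside the disc.\<close>
  have rad: "fps_conv_radius (\<Sum>w\<leftarrow>W. li_series (index_of w)) \<ge> 1 \<and>
      eval_fps (\<Sum>w\<leftarrow>W. li_series (index_of w)) (node n) = (\<Sum>w\<leftarrow>W. abel_zeta n (index_of w))"
    if "set W \<subseteq> set ?W" for W
    using that
  proof (induction W)
    case (Cons w W)
    have r: "fps_conv_radius (li_series (index_of w)) \<ge> 1"
      using Cons.prems by (intro conv_radius_li_series ind) auto
    have IH: "fps_conv_radius (\<Sum>w\<leftarrow>W. li_series (index_of w)) \<ge> 1"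
      "eval_fps (\<Sum>w\<leftarrow>W. li_series (index_of w)) (node n) = (\<Sum>w\<leftarrow>W. abel_zeta n (index_of w))"
      using Cons by auto
    have "fps_conv_radius (\<Sum>w\<leftarrow>w # W. li_series (index_of w)) \<ge> 1"
      using r IH(1) by (simp) (rule order.trans[OF _ fps_conv_radius_add], simp)
    moreover have "eval_fps (\<Sum>w\<leftarrow>w # W. li_series (index_of w)) (node n) = (\<Sum>w\<leftarrow>w # W. abel_zeta n (index_of w))"
      using IH(2) eval_fps_add[OF node_in_radius[OF r] node_in_radius[OF IH(1)]] by (simp add: abel_zeta_def)
    ultimately show ?case by blast
  qed simp
  have "abel_zeta n k * abel_zeta n l = eval_fps (li_series k * li_series l) (node n)"
    unfolding abel_zeta_def
    by (rule eval_fps_mult[symmetric]) (intro node_in_radius conv_radius_li_series kl)+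
  also have "\<dots> = (\<Sum>w\<leftarrow>?W. abel_zeta n (index_of w))"
    unfolding li_series_shuffle[OF kl] using rad[of ?W] by blast
  finally have prod: "abel_zeta n k * abel_zeta n l = (\<Sum>w\<leftarrow>?W. abel_zeta n (index_of w))" .
  have "lincomb (signed (abel_zeta n)) (sh_prod k l) = (\<Sum>w\<leftarrow>?W. (-1) ^ (length k + length l) * abel_zeta n (index_of w))"
    unfolding lincomb_def sh_prod_def map_map o_def
    by (rule arg_cong[where f = sum_list], rule map_cong[OF refl])
       (simp add: signed_def length_index_of_shuffle[OF kl])
  also have "\<dots> = (-1) ^ (length k + length l) * (abel_zeta n k * abel_zeta n l)"
    unfolding prod by (rule sum_list_const_mult)
  finally show "signed (abel_zeta n) k * signed (abel_zeta n) l = lincomb (signed (abel_zeta n)) (prod_of Shuffle k l)"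
    by (simp add: signed_def power_add mult_ac)
qed

section \<open>Transfer from the harmonic to the shuffle product\<close>

lemma average_lincomb:
  assumes "\<And>c w. (c, w) \<in> set R \<Longrightarrow> is_index w"
  shows "slow (\<lambda>N. lincomb (signed (trunc_zeta N)) R) \<and>
    average m (\<lambda>N. lincomb (signed (trunc_zeta N)) R) = lincomb (signed (abel_zeta m)) R"
  using assms
proof (induction R)
  case Nil
  show ?case using average_const[of m 0] by simp
next
  case (Cons a R)
  obtain c w where a: "a = (c, w)" by (cases a)
  have w: "is_index w" using Cons.prems[of c w] a by simp
  have IH: "slow (\<lambda>N. lincomb (signed (trunc_zeta N)) R)"
    "average m (\<lambda>N. lincomb (signed (trunc_zeta N)) R) = lincomb (signed (abel_zeta m)) R"
    using Cons.IH Cons.prems by auto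
  have sl: "slow (\<lambda>N. c * signed (trunc_zeta N) w)"
    by (intro slow_mult slow_const harmonic.signed_slow w)
  have "average m (\<lambda>N. c * signed (trunc_zeta N) w) = c * signed (abel_zeta m) w"
    unfolding average_cmult[OF harmonic.signed_slow[OF w]] unfolding signed_def
    by (simp only: average_cmult[OF slow_trunc_zeta[OF w]] abel_zeta_average[OF w])
  thus ?case
    unfolding a lincomb_simps average_add[OF sl IH(1)] IH(2) using slow_add[OF sl IH(1)] by simp
qed

text \<open>\<open>harm N\<close> is minus the character at \<open>[1]\<close>, so multiplying by it
  stays in the span of truncated sums. Abel means of powers of \<open>harm N\<close> are thus
  combinations of polylogarithm values and have polynomial expansions.\<close>

lemma harm_power_lincomb:
  "\<exists>R. (\<forall>c w. (c, w) \<in> set R \<longrightarrow> is_index w) \<and> (\<forall>N. harm N ^ j = lincomb (signed (trunc_zeta N)) R)"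
proof (induction j)
  case 0
  show ?case by (rule exI[of _ "[(1, [])]"]) (simp add: signed_def)
next
  case (Suc j)
  then obtain R where R: "\<forall>c w. (c, w) \<in> set R \<longrightarrow> is_index w" "\<forall>N. harm N ^ j = lincomb (signed (trunc_zeta N)) R"
    by blast
  have "\<exists>R'. (\<forall>c w. (c, w) \<in> set R' \<longrightarrow> is_index w) \<and>
      (\<forall>N. harm N * lincomb (signed (trunc_zeta N)) R = lincomb (signed (trunc_zeta N)) R')"
    using R(1)
  proof (induction R)
    case Nil
    show ?case by (rule exI[of _ "[]"]) simp
  next
    case (Cons a R)
    obtain c w where a: "a = (c, w)" by (cases a)
    have w: "is_index w" using Cons.prems a by simp
    have "\<forall>c w. (c, w) \<in> set R \<longrightarrow> is_index w" using Cons.prems by simp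
    from Cons.IH[OF this] obtain R' where R': "\<forall>c w. (c, w) \<in> set R' \<longrightarrow> is_index w"
      "\<forall>N. harm N * lincomb (signed (trunc_zeta N)) R = lincomb (signed (trunc_zeta N)) R'" by blast
    let ?P = "map (\<lambda>(c', v). (- c * c', v)) (harm_prod w [1])"
    have "harm N * (c * signed (trunc_zeta N) w) = lincomb (signed (trunc_zeta N)) ?P" for N
    proof -
      have "lincomb (signed (trunc_zeta N)) ?P = - c * lincomb (signed (trunc_zeta N)) (harm_prod w [1])"
        by (rule lincomb_map)
      also have "lincomb (signed (trunc_zeta N)) (harm_prod w [1]) = signed (trunc_zeta N) w * signed (trunc_zeta N) [1]"
        using harmonic.f_mult[OF w, of "[1]" N] by simp
      also have "signed (trunc_zeta N) [1] = - harm N"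
        unfolding signed_def trunc_zeta_one by simp
      finally show ?thesis by simp
    qed
    hence "\<forall>N. harm N * lincomb (signed (trunc_zeta N)) (a # R) = lincomb (signed (trunc_zeta N)) (?P @ R')"
      using R'(2) by (simp add: a distrib_left)
    moreover have "\<forall>c v. (c, v) \<in> set (?P @ R') \<longrightarrow> is_index v"
      using R'(1) harm_prod_index[OF w, of "[1]"] by auto
    ultimately show ?case by blast
  qed
  thus ?case using R(2) by simp
qed

text \<open>The graph of \<open>\<rho>\<close>, given by asymptotics: Abel means of polynomials in
  \<open>harm N\<close> are expanded in \<open>abel_zeta m [1]\<close>.\<close>

definition transfers :: "real poly \<Rightarrow> real poly \<Rightarrow> bool" where
  "transfers p q \<longleftrightarrow> small (\<lambda>m. average m (\<lambda>N. poly p (harm N)) - poly q (abel_zeta m [1]))"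

lemma transfers_unique: "transfers p q \<Longrightarrow> transfers p q' \<Longrightarrow> q = q'"
  unfolding transfers_def by (rule abel.poly_eqI_small)

lemma slow_poly_harm: "slow (\<lambda>N. poly p (harm N))"
  by (rule slow_poly[OF slow_harm])

lemma transfers_add:
  assumes "transfers p q" "transfers p' q'"
  shows "transfers (p + p') (q + q')"
  using small_add[OF assms[unfolded transfers_def]]
  by (simp add: transfers_def average_add[OF slow_poly_harm slow_poly_harm] algebra_simps)

lemma transfers_smult:
  assumes "transfers p q"
  shows "transfers (smult c p) (smult c q)"
  using small_cmult[OF assms[unfolded transfers_def], of c]
  by (simp add: transfers_def average_cmult[OF slow_poly_harm] algebra_simps)

lemma transfers_0: "transfers 0 0"
  by (simp add: transfers_def average_const)

lemma ex_transfers: "\<exists>q. transfers p q"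
proof -
  have mon: "\<exists>q. transfers (monom 1 j) q" for j
  proof -
    obtain R where R: "\<forall>c w. (c, w) \<in> set R \<longrightarrow> is_index w" "\<forall>N. harm N ^ j = lincomb (signed (trunc_zeta N)) R"
      using harm_power_lincomb[of j] by blast
    have "small (\<lambda>m. lincomb (signed (abel_zeta m)) R - poly (poly_lincomb abel.reg R) (abel_zeta m [1]))"
      by (rule abel.expands_lincomb, rule abel.expands_reg) (use R(1) in blast)
    moreover have "average m (\<lambda>N. poly (monom 1 j) (harm N)) = lincomb (signed (abel_zeta m)) R" for m
      using average_lincomb[of R m] R by (simp add: poly_monom)
    ultimately show ?thesis unfolding transfers_def by auto
  qed
  have "\<exists>q. transfers (\<Sum>i\<in>A. smult (coeff p i) (monom 1 i)) q" if "finite A" for A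
    using that
  proof (induction A)
    case (insert i A)
    then obtain q where "transfers (\<Sum>i\<in>A. smult (coeff p i) (monom 1 i)) q" by blast
    moreover obtain q' where "transfers (monom 1 i) q'" using mon by blast
    ultimately have "transfers (smult (coeff p i) (monom 1 i) + (\<Sum>i\<in>A. smult (coeff p i) (monom 1 i))) (smult (coeff p i) q' + q)"
      by (intro transfers_add transfers_smult)
    thus ?case using insert.hyps by auto
  qed (auto intro: transfers_0)
  from this[of "{..degree p}"] show ?thesis
    by (simp add: smult_monom poly_as_sum_of_monoms)
qed

definition transfer_map :: "real poly \<Rightarrow> real poly" where
  "transfer_map p = (SOME q. transfers p q)"

lemma transfers_transfer_map: "transfers p (transfer_map p)"
  unfolding transfer_map_def by (rule someI_ex[OF ex_transfers])

lemma transfer_map_eqI: "transfers p q \<Longrightarrow> transfer_map p = q"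
  using transfers_unique transfers_transfer_map by blast

lemma transfer_map_add: "transfer_map (p + q) = transfer_map p + transfer_map q"
  by (intro transfer_map_eqI transfers_add transfers_transfer_map)

lemma transfer_map_smult: "transfer_map (smult c p) = smult c (transfer_map p)"
  by (intro transfer_map_eqI transfers_smult transfers_transfer_map)

lemma transfer_map_0: "transfer_map 0 = 0"
  by (intro transfer_map_eqI transfers_0)

lemma transfer_map_sum: "transfer_map (sum f A) = (\<Sum>i\<in>A. transfer_map (f i))"
  by (induction A rule: infinite_finite_induct) (simp_all add: transfer_map_0 transfer_map_add)

text \<open>The regularization theorem of Ihara, Kaneko and Zagier, without identifying the map explicitly.\<close>

lemma transfer_map_zeta_reg:
  assumes "is_index k"
  shows "transfer_map (zeta_reg Harmonic k) = zeta_reg Shuffle k"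
proof (rule transfer_map_eqI)
  let ?e = "\<lambda>N. trunc_zeta N k - poly (zeta_reg Harmonic k) (harm N)"
  have e: "small ?e"
    using harmonic.zeta_reg_small[OF assms] unfolding trunc_zeta_one .
  \<comment> \<open>Averaging the harmonic expansion turns the truncated value into
    \<open>abel_zeta m k\<close>, and the small error stays small.\<close>
  have av: "average m (\<lambda>N. poly (zeta_reg Harmonic k) (harm N)) = abel_zeta m k - average m ?e" for m
    using average_add[OF slow_poly_harm small_slow[OF e], of m "zeta_reg Harmonic k"]
    by (simp add: abel_zeta_average[OF assms])
  show "transfers (zeta_reg Harmonic k) (zeta_reg Shuffle k)"
    using small_diff[OF abel.zeta_reg_small[OF assms] small_average[OF e]]
    unfolding transfers_def av by (simp add: algebra_simps)
qed

section \<open>The transfer in two variables\<close>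

definition lift_poly :: "real poly \<Rightarrow> real poly poly" where
  "lift_poly = map_poly (\<lambda>c. [:c:])"

lemma coeff_lift_poly: "coeff (lift_poly q) j = [:coeff q j:]"
  by (simp add: lift_poly_def coeff_map_poly)

lemma lift_poly_0: "lift_poly 0 = 0"
  and lift_poly_add: "lift_poly (p + q) = lift_poly p + lift_poly q"
  and lift_poly_smult: "lift_poly (smult c q) = [:[:c:]:] * lift_poly q"
  by (rule poly_eqI; simp add: coeff_lift_poly)+

lemma lift_poly_sum: "lift_poly (sum f A) = (\<Sum>i\<in>A. lift_poly (f i))"
  by (induction A rule: infinite_finite_induct) (simp_all add: lift_poly_0 lift_poly_add)

text \<open>This is \<open>\<rho> \<otimes> \<rho>\<close>: it acts on the coefficients as
  polynomials in \<open>T_1\<close> and on the powers of \<open>T_2\<close>.\<close>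

definition transfer_map2 :: "real poly poly \<Rightarrow> real poly poly" where
  "transfer_map2 P = (\<Sum>j\<le>degree P. [:transfer_map (coeff P j):] * lift_poly (transfer_map (monom 1 j)))"

lemma transfer_map2_altdef:
  assumes "degree P \<le> n"
  shows "transfer_map2 P = (\<Sum>j\<le>n. [:transfer_map (coeff P j):] * lift_poly (transfer_map (monom 1 j)))"
  unfolding transfer_map2_def
  by (rule sum.mono_neutral_left) (use assms in \<open>auto simp: coeff_eq_0 transfer_map_0\<close>)

lemma transfer_map2_add: "transfer_map2 (P + Q) = transfer_map2 P + transfer_map2 Q"
proof -
  define n where "n = max (degree P) (degree Q)"
  have "degree P \<le> n" "degree Q \<le> n" "degree (P + Q) \<le> n"
    unfolding n_def by (auto intro: degree_add_le_max)
  note this[THEN transfer_map2_altdef]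
  moreover have "[:transfer_map (coeff (P + Q) j):] = [:transfer_map (coeff P j):] + [:transfer_map (coeff Q j):]" for j
    by (simp add: transfer_map_add)
  ultimately show ?thesis
    by (simp only: distrib_right sum.distrib)
qed

lemma transfer_map2_0: "transfer_map2 0 = 0"
  by (simp add: transfer_map2_def transfer_map_0)

lemma transfer_map2_diff: "transfer_map2 (P - Q) = transfer_map2 P - transfer_map2 Q"
  using transfer_map2_add[of "P - Q" Q] by simp

text \<open>The coefficients of \<open>zS\<close> are sums of such products, so the transfer can act
  on each of the two factors separately.\<close>

lemma transfer_map2_prod: "transfer_map2 ([:p:] * lift_poly q) = [:transfer_map p:] * lift_poly (transfer_map q)"
proof -
  have co: "coeff ([:p:] * lift_poly q) j = smult (coeff q j) p" for j
    by (simp add: coeff_lift_poly)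
  have "degree ([:p:] * lift_poly q) \<le> degree q"
    by (rule degree_le) (simp only: co, simp add: coeff_eq_0)
  hence "transfer_map2 ([:p:] * lift_poly q)
      = (\<Sum>j\<le>degree q. [:transfer_map (smult (coeff q j) p):] * lift_poly (transfer_map (monom 1 j)))"
    by (simp only: transfer_map2_altdef co)
  also have "\<dots> = (\<Sum>j\<le>degree q. [:transfer_map p:] * lift_poly (transfer_map (smult (coeff q j) (monom 1 j))))"
  proof (rule sum.cong[OF refl])
    fix j
    have "[:smult c r:] = [:r:] * [:[:c:]:]" for c and r :: "real poly" by simp
    thus "[:transfer_map (smult (coeff q j) p):] * lift_poly (transfer_map (monom 1 j))
        = [:transfer_map p:] * lift_poly (transfer_map (smult (coeff q j) (monom 1 j)))"
      by (simp only: transfer_map_smult lift_poly_smult mult.assoc)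
  qed
  also have "\<dots> = [:transfer_map p:] * lift_poly (transfer_map (\<Sum>j\<le>degree q. smult (coeff q j) (monom 1 j)))"
    by (simp only: sum_distrib_left lift_poly_sum transfer_map_sum)
  also have "(\<Sum>j\<le>degree q. smult (coeff q j) (monom 1 j)) = q"
    by (simp add: smult_monom poly_as_sum_of_monoms)
  finally show ?thesis .
qed

section \<open>Separation of the two variables\<close>

definition eval2 :: "real \<Rightarrow> real \<Rightarrow> real poly poly \<Rightarrow> real" where
  "eval2 x y P = poly (poly P [:y:]) x"

lemma eval2_simps:
  "eval2 x y 0 = 0" "eval2 x y (P + Q) = eval2 x y P + eval2 x y Q"
  "eval2 x y (P - Q) = eval2 x y P - eval2 x y Q" "eval2 x y (P * Q) = eval2 x y P * eval2 x y Q"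
  "eval2 x y [:p:] = poly p x"
  by (simp_all add: eval2_def)

lemma eval2_lift_poly: "eval2 x y (lift_poly q) = poly q y"
proof -
  have "poly (lift_poly q) [:y:] = [:poly q y:]"
    unfolding lift_poly_def by (induction q) (simp_all add: map_poly_pCons)
  thus ?thesis by (simp add: eval2_def)
qed

lemma harm_mult_diff_LIMSEQ:
  assumes "c > 0"
  shows "(\<lambda>N. harm (c * N) - harm N :: real) \<longlonglongrightarrow> ln (real c)"
proof -
  let ?g = "\<lambda>n. harm n - ln (real n) :: real"
  have lim: "filterlim (\<lambda>N. c * N) at_top sequentially"
    using assms by (intro filterlim_subseq strict_monoI) simp
  have "(\<lambda>N. ?g (c * N) - ?g N + ln (real c)) \<longlonglongrightarrow> euler_mascheroni - euler_mascheroni + ln (real c)"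
    by (intro tendsto_add tendsto_diff tendsto_const euler_mascheroni_LIMSEQ
        filterlim_compose[OF euler_mascheroni_LIMSEQ lim])
  moreover have "eventually (\<lambda>N. ?g (c * N) - ?g N + ln (real c) = harm (c * N) - harm N) sequentially"
    using eventually_gt_at_top[of 0]
  proof eventually_elim
    case (elim N)
    have "ln (real (c * N)) = ln (real c) + ln (real N)"
      using assms elim by (simp add: ln_mult)
    thus ?case by simp
  qed
  ultimately have "(\<lambda>N. harm (c * N) - harm N) \<longlonglongrightarrow> euler_mascheroni - euler_mascheroni + ln (real c)"
    by (rule Lim_transform_eventually)
  thus ?thesis by simp
qed

lemma poly_over_power_tendsto:
  fixes x :: "nat \<Rightarrow> real"
  assumes "filterlim x at_top sequentially" "degree p \<le> D"
  shows "(\<lambda>n. poly p (x n) / x n ^ D) \<longlonglongrightarrow> coeff p D"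
proof -
  have "(\<lambda>n. x n ^ j / x n ^ D) \<longlonglongrightarrow> (if j = D then 1 else 0)" if "j \<le> D" for j
  proof -
    have ev: "eventually (\<lambda>n. inverse (x n) ^ (D - j) = x n ^ j / x n ^ D) sequentially"
      using filterlim_at_top_dense[THEN iffD1, OF assms(1), rule_format, of 0]
    proof eventually_elim
      case (elim n)
      have "x n ^ D = x n ^ j * x n ^ (D - j)" using that by (simp flip: power_add)
      thus ?case using elim by (simp add: power_inverse divide_inverse)
    qed
    have "(\<lambda>n. inverse (x n)) \<longlonglongrightarrow> 0"
      by (rule tendsto_inverse_0_at_top[OF assms(1)])
    hence "(\<lambda>n. inverse (x n) ^ (D - j)) \<longlonglongrightarrow> 0 ^ (D - j)" by (rule tendsto_power)
    hence "(\<lambda>n. x n ^ j / x n ^ D) \<longlonglongrightarrow> 0 ^ (D - j)"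
      using ev by (rule Lim_transform_eventually)
    moreover have "(0::real) ^ (D - j) = (if j = D then 1 else 0)" using that by (simp add: power_0_left)
    ultimately show ?thesis by (simp only:)
  qed
  hence "(\<lambda>n. \<Sum>j\<le>D. coeff p j * (x n ^ j / x n ^ D)) \<longlonglongrightarrow> (\<Sum>j\<le>D. coeff p j * (if j = D then 1 else 0))"
    by (intro tendsto_sum tendsto_mult tendsto_const) auto
  also have "(\<Sum>j\<le>D. coeff p j * (if j = D then 1 else 0)) = coeff p D"
    by (simp add: if_distrib[of "\<lambda>z. _ * z"] sum.delta cong: if_cong)
  also have "(\<lambda>n. \<Sum>j\<le>D. coeff p j * (x n ^ j / x n ^ D)) = (\<lambda>n. poly p (x n) / x n ^ D)"
  proof
    fix n
    have "poly p (x n) = (\<Sum>j\<le>D. coeff p j * x n ^ j)"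
      unfolding poly_altdef
      by (rule sum.mono_neutral_left) (use assms(2) in \<open>auto simp: coeff_eq_0\<close>)
    thus "(\<Sum>j\<le>D. coeff p j * (x n ^ j / x n ^ D)) = poly p (x n) / x n ^ D"
      by (simp add: sum_divide_distrib)
  qed
  finally show ?thesis .
qed

lemma poly_poly_eval: "poly (poly P r) x = poly (poly P [:poly r x:]) x" for P :: "real poly poly"
  by (induction P) simp_all

text \<open>In the coordinates \<open>x = T\<^sub>1\<close> and \<open>d = T\<^sub>2 - T\<^sub>1\<close>, dividing by the highest power of \<open>x\<close> leaves
  a polynomial in \<open>d\<close> that vanishes at \<open>ln c\<close> for all \<open>c\<close>.\<close>

lemma eval2_harm_eq_0I:
  assumes "\<And>c. c > 0 \<Longrightarrow> (\<lambda>N. eval2 (harm N) (harm (c * N)) P) \<longlonglongrightarrow> 0"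
  shows "P = 0"
proof (rule ccontr)
  assume "P \<noteq> 0"
  \<comment> \<open>Substitutes \<open>T_2 = T_1 + d\<close>, the outer variable now standing for
    \<open>d\<close>. Along \<open>M = c * N\<close> the value of \<open>d\<close> converges to
    \<open>ln c\<close>, while \<open>T_1\<close> diverges.\<close>
  define P' where "P' = pcompose P [:[:0, 1:], 1:]"
  have "P' \<noteq> 0"
    using \<open>P \<noteq> 0\<close> pcompose_eq_0[of P "[:[:0, 1:], 1:]"] unfolding P'_def by auto
  have P': "eval2 x d P' = eval2 x (x + d) P" for x d
    unfolding eval2_def P'_def poly_pcompose using poly_poly_eval[of P "[:d, 1:]" x]
    by (simp add: add.commute)
  let ?S = "{D. \<exists>i. coeff (coeff P' i) D \<noteq> 0}"
  have "?S \<subseteq> (\<Union>i\<le>degree P'. {..degree (coeff P' i)})"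
  proof
    fix D assume "D \<in> ?S"
    then obtain i where i: "coeff (coeff P' i) D \<noteq> 0" by blast
    hence "coeff P' i \<noteq> 0" by auto
    thus "D \<in> (\<Union>i\<le>degree P'. {..degree (coeff P' i)})"
      using i by (auto intro: le_degree)
  qed
  hence fin: "finite ?S" by (rule finite_subset) simp
  have "coeff (lead_coeff P') (degree (lead_coeff P')) \<noteq> 0" using \<open>P' \<noteq> 0\<close> by simp
  hence ne: "?S \<noteq> {}" by blast
  define D where "D = Max ?S"
  have deg: "degree (coeff P' i) \<le> D" for i
  proof (rule degree_le, intro allI impI, rule ccontr)
    fix j assume "D < j" "coeff (coeff P' i) j \<noteq> 0"
    moreover have "j \<le> D" unfolding D_def using calculation(2) by (intro Max_ge fin) blast
    ultimately show False by simp
  qed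
  obtain i0 where i0: "coeff (coeff P' i0) D \<noteq> 0"
    using Max_in[OF fin ne] unfolding D_def by blast
  \<comment> \<open>The coefficient of the highest power \<open>x ^ D\<close>, as a polynomial in
    \<open>d\<close>.\<close>
  define r where "r = (\<Sum>i\<le>degree P'. monom (coeff (coeff P' i) D) i)"
  have "i0 \<le> degree P'" using i0 by (intro le_degree) auto
  hence "coeff r i0 = coeff (coeff P' i0) D"
    unfolding r_def coeff_sum by (simp add: sum.delta)
  hence "r \<noteq> 0" using i0 by auto
  have root: "poly r (ln (real c)) = 0" if c: "c > 0" for c
  proof -
    let ?x = "\<lambda>N. harm N :: real" and ?d = "\<lambda>N. harm (c * N) - harm N :: real"
    have eq: "eval2 (?x N) (?d N) P' / ?x N ^ D = (\<Sum>i\<le>degree P'. (poly (coeff P' i) (?x N) / ?x N ^ D) * ?d N ^ i)" for N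
    proof -
      have "eval2 (?x N) (?d N) P' = (\<Sum>i\<le>degree P'. poly (coeff P' i) (?x N) * ?d N ^ i)"
        unfolding eval2_def poly_altdef[of P'] by (simp add: poly_sum)
      thus ?thesis by (simp add: sum_divide_distrib)
    qed
    have "(\<lambda>N. eval2 (?x N) (?d N) P' / ?x N ^ D) \<longlonglongrightarrow> (\<Sum>i\<le>degree P'. coeff (coeff P' i) D * ln (real c) ^ i)"
      unfolding eq
      by (intro tendsto_sum tendsto_mult tendsto_power poly_over_power_tendsto harm_at_top deg harm_mult_diff_LIMSEQ c)
    moreover have "(\<lambda>N. eval2 (?x N) (?d N) P' / ?x N ^ D) \<longlonglongrightarrow> 0"
    proof (rule tendsto_rabs_zero_cancel, rule tendsto_sandwich[OF _ _ tendsto_const])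
      show "eventually (\<lambda>N. 0 \<le> \<bar>eval2 (?x N) (?d N) P' / ?x N ^ D\<bar>) sequentially" by simp
      show "eventually (\<lambda>N. \<bar>eval2 (?x N) (?d N) P' / ?x N ^ D\<bar> \<le> \<bar>eval2 (harm N) (harm (c * N)) P\<bar>) sequentially"
        using filterlim_at_top_dense[THEN iffD1, OF harm_at_top, rule_format, of 1]
      proof eventually_elim
        case (elim N)
        have "1 \<le> ?x N ^ D" using elim by (intro one_le_power) simp
        hence "\<bar>eval2 (?x N) (?d N) P'\<bar> / ?x N ^ D \<le> \<bar>eval2 (?x N) (?d N) P'\<bar> / 1"
          by (intro divide_left_mono) auto
        thus ?case using elim by (simp add: P' abs_divide)
      qed
      show "(\<lambda>N. \<bar>eval2 (harm N) (harm (c * N)) P\<bar>) \<longlonglongrightarrow> 0"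
        using assms[OF c] by (rule tendsto_rabs_zero)
    qed
    ultimately have "(\<Sum>i\<le>degree P'. coeff (coeff P' i) D * ln (real c) ^ i) = 0"
      by (rule LIMSEQ_unique)
    thus ?thesis by (simp add: r_def poly_sum poly_monom)
  qed
  \<comment> \<open>Distinct \<open>c\<close> give distinct roots \<open>ln c\<close>, so a nonzero
    \<open>r\<close> would have infinitely many.\<close>
  have "(\<lambda>c. ln (real c)) ` {0<..} \<subseteq> {x. poly r x = 0}" using root by auto
  moreover have "finite {x. poly r x = 0}" using \<open>r \<noteq> 0\<close> by (rule poly_roots_finite)
  ultimately have "finite ((\<lambda>c. ln (real c)) ` {0<..})" by (rule finite_subset)
  moreover have "inj_on (\<lambda>c. ln (real c)) {0<..}" by (auto simp: inj_on_def)
  ultimately have "finite {0::nat<..}" by (rule finite_imageD)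
  thus False using infinite_Ioi by blast
qed

section \<open>Coefficients of the cyclic sum formula\<close>

text \<open>The coefficient of \<open>s ^ a * t ^ b\<close> in the symmetric value, with
  \<open>f\<close> and \<open>g\<close> in place of the regularized values at \<open>T_1\<close> and
  \<open>T_2\<close>. The shift by \<open>s\<close> brings \<open>(-1) ^ a\<close>; the shift by
  \<open>-t\<close> brings no sign.\<close>

definition sym_coeff :: "(nat list \<Rightarrow> real) \<Rightarrow> (nat list \<Rightarrow> real) \<Rightarrow> nat list \<Rightarrow> nat \<Rightarrow> nat \<Rightarrow> real" where
  "sym_coeff f g k a b = (\<Sum>i\<le>length k. (-1) ^ (sum_list (drop i k) + a) *
     (shift_sum f (take i k) a * shift_sum g (rev (drop i k)) b))"

definition star_coeff :: "(nat list \<Rightarrow> nat \<Rightarrow> nat \<Rightarrow> 'a) \<Rightarrow> nat list \<Rightarrow> nat \<Rightarrow> nat \<Rightarrow> 'a::comm_monoid_add" where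
  "star_coeff Z k a b = (\<Sum>l\<leftarrow>coarsenings k. Z l a b)"

lemma poly_shift_coef: "poly (shift_coef bt k m) x = shift_sum (\<lambda>l. poly (zeta_reg bt l) x) k m"
  by (simp add: shift_coef_def shift_sum_def poly_sum)

lemma zS_nth:
  "zS bt k $ a $ b = (\<Sum>i\<le>length k. [:smult ((-1) ^ (sum_list (drop i k) + a)) (shift_coef bt (take i k) a):]
     * lift_poly (shift_coef bt (rev (drop i k)) b))"
proof -
  have sign: "((-1) ^ n * F * fps_const G) $ a $ b = (-1) ^ n * (F $ a * G) $ b" for n and F :: ps and G
    by (cases "even n") (simp_all add: mult.commute)
  have "((-1) ^ n * shift_s bt u * shift_mt bt v) $ a $ b
      = [:smult ((-1) ^ (n + a)) (shift_coef bt u a):] * lift_poly (shift_coef bt v b)" for n u v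
    unfolding shift_mt_def sign by (cases "even n") (simp_all add: shift_s_def lift_poly_def power_add)
  thus ?thesis by (simp add: zS_def fps_sum_nth)
qed

lemma eval2_sum: "eval2 x y (sum f A) = (\<Sum>i\<in>A. eval2 x y (f i))"
  by (induction A rule: infinite_finite_induct) (simp_all add: eval2_simps)

lemma eval2_sum_list: "eval2 x y (sum_list (map f A)) = (\<Sum>i\<leftarrow>A. eval2 x y (f i))"
  by (induction A) (simp_all add: eval2_simps)

lemma eval2_zS:
  "eval2 x y (zS bt k $ a $ b)
     = sym_coeff (\<lambda>l. poly (zeta_reg bt l) x) (\<lambda>l. poly (zeta_reg bt l) y) k a b"
  unfolding zS_nth eval2_sum sym_coeff_def eval2_simps eval2_lift_poly poly_smult poly_shift_coef mult.assoc
  by (rule refl)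

lemma is_index_subset: "is_index k \<Longrightarrow> set l \<subseteq> set k \<Longrightarrow> is_index l"
  by (auto simp: is_index_def)

lemma index_take_drop: "is_index k \<Longrightarrow> is_index (take i k)" "is_index k \<Longrightarrow> is_index (drop i k)"
  by (erule is_index_subset, rule set_take_subset, erule is_index_subset, rule set_drop_subset)

lemma is_index_rev [simp]: "is_index (rev k) \<longleftrightarrow> is_index k"
  by (simp add: is_index_def)

lemma index_map2_add: "is_index k \<Longrightarrow> length n = length k \<Longrightarrow> is_index (map2 (+) k n)"
  by (auto simp: is_index_def set_zip)

lemma transfer_map_shift_coef:
  assumes "is_index k"
  shows "transfer_map (shift_coef Harmonic k m) = shift_coef Shuffle k m"
  unfolding shift_coef_def transfer_map_sum transfer_map_smult
  by (intro sum.cong refl) (simp add: transfer_map_zeta_reg index_map2_add assms)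

lemma transfer_map2_sum: "transfer_map2 (sum f A) = (\<Sum>i\<in>A. transfer_map2 (f i))"
  by (induction A rule: infinite_finite_induct) (simp_all add: transfer_map2_0 transfer_map2_add)

lemma transfer_map2_sum_list: "transfer_map2 (sum_list (map f A)) = (\<Sum>i\<leftarrow>A. transfer_map2 (f i))"
  by (induction A) (simp_all add: transfer_map2_0 transfer_map2_add)

lemma transfer_map2_zS:
  assumes "is_index k"
  shows "transfer_map2 (zS Harmonic k $ a $ b) = zS Shuffle k $ a $ b"
  unfolding zS_nth transfer_map2_sum transfer_map2_prod transfer_map_smult
  by (simp only: transfer_map_shift_coef is_index_rev index_take_drop assms)

lemma coarsenings_index: "is_index k \<Longrightarrow> l \<in> set (coarsenings k) \<Longrightarrow> is_index l"
proof (induction k arbitrary: l rule: coarsenings.induct)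
  case (3 k1 k2 ks)
  from "3.prems"(2) obtain l' where l': "l' \<in> set (coarsenings (k2 # ks))" "l = k1 # l' \<or> l = (k1 + hd l') # tl l'"
    by auto
  have "is_index l'" using 3 l'(1) by simp
  moreover have "l' \<noteq> []" using coarsenings_nonempty[OF _ l'(1)] by simp
  ultimately show ?case using l'(2) "3.prems"(1) by (cases l') auto
qed auto

lemma zSstar_nth: "zSstar bt k $ a $ b = star_coeff (\<lambda>l a b. zS bt l $ a $ b) k a b"
proof -
  have "sum_list (map f xs) $ a $ b = (\<Sum>l\<leftarrow>xs. f l $ a $ b)" for f :: "nat list \<Rightarrow> ps" and xs
    by (induction xs) auto
  thus ?thesis by (simp add: zSstar_def star_coeff_def)
qed

lemma pos_val_list:
  "map (pos_val N M) [0..<N + M] = map lift_s (map (geom (-1)) [1..<Suc N])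
     @ map uminus (map fps_const (map (geom 1) (rev [1..<Suc M])))"
  by (rule nth_equalityI) (auto simp: nth_append pos_val_def rev_nth simp del: upt_Suc intro!: arg_cong[where f = "geom 1"])

text \<open>Cutting a chain between the two blocks gives the sum over \<open>i\<close>; reversing
  and negating the second block gives the reversed index and its sign.\<close>

lemma chain_sum_pos_val_nth:
  "chain_sum (map (pos_val N M) [0..<N + M]) k $ a $ b = sym_coeff (trunc_zeta N) (trunc_zeta M) k a b"
proof -
  have tz: "chain_sum (map (\<lambda>m. 1 / real m) [1..<Suc n]) = trunc_zeta n" for n
    by (rule ext) (simp only: trunc_zeta_def)
  have pos: "chain_sum (map lift_s (map (geom (-1)) [1..<Suc N])) u = lift_s (chain_sum (map (geom (-1)) [1..<Suc N]) u)" for u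
    by (rule chain_sum_hom) (simp_all add: lift_s_add lift_s_mult lift_s_1 lift_s_0)
  have neg: "chain_sum (map uminus (map fps_const (map (geom 1) (rev [1..<Suc M])))) u
      = (-1) ^ sum_list u * fps_const (chain_sum (map (geom 1) [1..<Suc M]) (rev u))" for u
  proof -
    have "chain_sum (map fps_const (map (geom 1) (rev [1..<Suc M]))) u
        = (fps_const (chain_sum (map (geom 1) (rev [1..<Suc M])) u) :: real fps fps)"
      by (rule chain_sum_hom) simp_all
    also have "chain_sum (map (geom 1) (rev [1..<Suc M])) u = chain_sum (map (geom 1) [1..<Suc M]) (rev u)"
      using chain_sum_rev[of "map (geom 1) [1..<Suc M]" "rev u"] by (simp only: rev_map rev_rev_ident)
    finally show ?thesis by (simp only: chain_sum_uminus)
  qed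
  have sign: "(lift_s F * ((-1) ^ n * fps_const G)) $ a $ b = (-1) ^ n * (F $ a * G $ b)" for n F G
    by (cases "even n") simp_all
  show ?thesis
    unfolding pos_val_list chain_sum_append pos neg fps_sum_nth sign sym_coeff_def chain_sum_geom_nth tz
    by (simp add: power_add mult_ac)
qed

lemma star_sum_pos_val_nth:
  assumes "N + M > 0"
  shows "star_sum (pos_val N M) 0 (N + M - 1) k $ a $ b = star_coeff (sym_coeff (trunc_zeta N) (trunc_zeta M)) k a b"
proof -
  have "sum_list (map f xs) $ a $ b = (\<Sum>l\<leftarrow>xs. f l $ a $ b)" for f :: "nat list \<Rightarrow> real fps fps" and xs
    by (induction xs) auto
  moreover have "Suc (N + M - 1) = N + M" using assms by simp
  ultimately show ?thesis
    by (simp only: star_sum_coarsenings star_coeff_def chain_sum_pos_val_nth)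
qed

text \<open>The coefficient of \<open>s\<^sup>a t\<^sup>b\<close> in the difference of the two sides of the cyclic sum formula, for an
  arbitrary family \<open>Z\<close> in place of the coefficients of the star values.\<close>

definition defect :: "nat list \<Rightarrow> (nat list \<Rightarrow> nat \<Rightarrow> nat \<Rightarrow> 'a::ab_group_add) \<Rightarrow> nat \<Rightarrow> nat \<Rightarrow> 'a" where
  "defect k Z a b =
     (\<Sum>i=1..length k. \<Sum>j<k ! (i - 1). Z ([j + 1] @ drop i k @ take (i - 1) k @ [k ! (i - 1) - j]) a b)
   - (\<Sum>i=1..length k. \<Sum>j\<le>a + b.
         (if j \<le> b then Z ([j + 1] @ rotation i k) a (b - j) else 0)
       + (if j \<le> a then Z (rotation i k @ [j + 1]) (a - j) b else 0))
   - (\<Sum>j<sum_list k. Z [sum_list k + 1] a b)"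

text \<open>Only sums, differences and 0 occur in \<open>defect\<close>. The lemma serves both the
  evaluation at numbers and \<open>transfer_map2\<close>.\<close>

lemma defect_hom:
  assumes "\<And>x y. h (x + y) = h x + h y" "\<And>x y. h (x - y) = h x - h y" "h 0 = 0"
  shows "h (defect k Z a b) = defect k (\<lambda>l a b. h (Z l a b)) a b"
proof -
  have "h (sum f A) = (\<Sum>i\<in>A. h (f i))" for f and A :: "nat set"
    by (induction A rule: infinite_finite_induct) (simp_all add: assms)
  thus ?thesis by (simp add: defect_def assms if_distrib[of h] cong: if_cong)
qed

lemma index_rotation: "is_index k \<Longrightarrow> is_index (rotation i k)"
  unfolding rotation_def by (rule is_index_subset) (auto dest: in_set_dropD in_set_takeD)

lemma index_cyclic:
  assumes "is_index k" "j < k ! (i - 1)"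
  shows "is_index ([j + 1] @ drop i k @ take (i - 1) k @ [k ! (i - 1) - j])"
  using assms by (simp add: index_take_drop)

lemma defect_cong:
  assumes "is_index k" "\<And>l a b. is_index l \<Longrightarrow> Z l a b = Z' l a b"
  shows "defect k Z a b = defect k Z' a b"
proof -
  have "(\<Sum>i=1..length k. \<Sum>j<k ! (i - 1). Z ([j + 1] @ drop i k @ take (i - 1) k @ [k ! (i - 1) - j]) a b)
      = (\<Sum>i=1..length k. \<Sum>j<k ! (i - 1). Z' ([j + 1] @ drop i k @ take (i - 1) k @ [k ! (i - 1) - j]) a b)"
    by (rule sum.cong[OF refl], rule sum.cong[OF refl], rule assms(2), rule index_cyclic[OF assms(1)]) simp
  moreover have "Z ([j + 1] @ rotation i k) a b = Z' ([j + 1] @ rotation i k) a b"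
    "Z (rotation i k @ [j + 1]) a b = Z' (rotation i k @ [j + 1]) a b" for i j a b
    by (rule assms(2), simp add: index_rotation assms(1))+
  moreover have "Z [sum_list k + 1] a b = Z' [sum_list k + 1] a b"
    by (rule assms(2)) simp
  ultimately show ?thesis by (simp only: defect_def)
qed

lemma defect_diff: "defect k (\<lambda>l a b. Z l a b - Z' l a b) a b = defect k Z a b - defect k Z' a b"
proof -
  have if_diff: "(if P then x - y else 0) = (if P then x else 0) - (if P then y else 0)" for P and x y :: 'a by simp
  show ?thesis by (simp only: defect_def if_diff sum_subtractf sum.distrib) (simp add: algebra_simps)
qed

lemma defect_small:
  assumes "is_index k" "\<And>l a b. is_index l \<Longrightarrow> small (\<lambda>n. Z n l a b)"
  shows "small (\<lambda>n. defect k (Z n) a b)"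
proof -
  have if_small: "small (\<lambda>n. if P then e n else 0)" if "small e" for P e
    using that by (cases P) simp_all
  show ?thesis
    unfolding defect_def
    by (intro small_diff small_sum small_add if_small assms(2) index_cyclic)
       (use assms(1) index_rotation in auto)
qed

lemma nth_mult_tt: "(F * fps_const fps_X ^ j) $ a $ b = (if j \<le> b then F $ a $ (b - j) else 0)"
  for F :: "'a::comm_ring_1 fps fps"
  by (simp add: fps_X_power_mult_right_nth)

lemma nth_mult_ss: "(F * fps_X ^ j) $ a $ b = (if j \<le> a then F $ (a - j) $ b else 0)"
  for F :: "'a::comm_ring_1 fps fps"
  by (simp add: fps_X_power_mult_right_nth)

text \<open>Iterating \<open>d = x + x * d * t\<close> gives the geometric series of
  \<open>x / (1 - x * t)\<close> with an exact remainder.\<close>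

lemma geometric_expansion:
  fixes x :: "'a::comm_ring_1"
  assumes "x * y = 1" "d * (y - t) = 1"
  shows "d = (\<Sum>j\<le>J. x ^ (j + 1) * t ^ j) + x ^ (J + 1) * d * t ^ (J + 1)"
proof -
  have "x = x * (d * (y - t))" by (simp only: assms mult_1_right)
  also have "\<dots> = d * (x * y) - x * d * t" by (simp add: algebra_simps)
  finally have d: "d = x + x * d * t" by (simp add: assms algebra_simps)
  show ?thesis
  proof (induction J)
    case 0
    show ?case using d by simp
  next
    case (Suc J)
    have "x ^ (J + 1) * d * t ^ (J + 1) = x ^ (J + 1) * (x + x * d * t) * t ^ (J + 1)"
      using d by simp
    also have "\<dots> = x ^ (Suc J + 1) * t ^ Suc J + x ^ (Suc J + 1) * d * t ^ (Suc J + 1)"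
      by (simp add: algebra_simps)
    finally show ?case using Suc.IH by (simp add: algebra_simps)
  qed
qed

lemma geometric_expansion_sum:
  fixes x :: "nat \<Rightarrow> 'a::comm_ring_1"
  assumes "\<And>p. p \<in> P \<Longrightarrow> x p * y p = 1" "\<And>p. p \<in> P \<Longrightarrow> d p * (y p - t) = 1"
  shows "(\<Sum>p\<in>P. d p * G p)
     = (\<Sum>j\<le>J. (\<Sum>p\<in>P. x p ^ (j + 1) * G p) * t ^ j) + (\<Sum>p\<in>P. x p ^ (J + 1) * d p * G p) * t ^ (J + 1)"
proof -
  have e: "(S + x p ^ (J + 1) * d p * t ^ (J + 1)) * G p = S * G p + x p ^ (J + 1) * d p * G p * t ^ (J + 1)" for S p
    by (simp add: algebra_simps)
  have e': "(\<Sum>j\<le>J. x p ^ (j + 1) * t ^ j) * G p = (\<Sum>j\<le>J. x p ^ (j + 1) * G p * t ^ j)" for p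
    unfolding sum_distrib_right by (simp only: mult_ac)
  have "(\<Sum>p\<in>P. d p * G p)
      = (\<Sum>p\<in>P. ((\<Sum>j\<le>J. x p ^ (j + 1) * t ^ j) + x p ^ (J + 1) * d p * t ^ (J + 1)) * G p)"
    using assms by (intro sum.cong refl arg_cong2[where f = times] geometric_expansion) auto
  also have "\<dots> = (\<Sum>p\<in>P. \<Sum>j\<le>J. x p ^ (j + 1) * G p * t ^ j) + (\<Sum>p\<in>P. x p ^ (J + 1) * d p * G p * t ^ (J + 1))"
    by (simp only: e e' sum.distrib)
  also have "(\<Sum>p\<in>P. \<Sum>j\<le>J. x p ^ (j + 1) * G p * t ^ j) = (\<Sum>j\<le>J. \<Sum>p\<in>P. x p ^ (j + 1) * G p * t ^ j)"
    by (rule sum.swap)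
  finally show ?thesis by (simp only: sum_distrib_right)
qed

text \<open>The remainder is divisible by \<open>t ^ (J + 1)\<close> and cannot reach the
  coefficient of \<open>t ^ b\<close>, as \<open>J \<ge> b\<close>.\<close>

lemma first_geometric_nth:
  assumes "N + M > 0" "J \<ge> b"
  shows "(\<Sum>p=0..N + M - 1. pos_first N M p * star_sum (pos_val N M) p (N + M - 1) \<kappa>) $ a $ b
    = (\<Sum>j\<le>J. if j \<le> b then star_sum (pos_val N M) 0 (N + M - 1) ([j + 1] @ \<kappa>) $ a $ (b - j) else 0)"
proof -
  have "(\<Sum>p=0..N + M - 1. pos_val N M p ^ (j + 1) * star_sum (pos_val N M) p (N + M - 1) \<kappa>)
      = star_sum (pos_val N M) 0 (N + M - 1) ([j + 1] @ \<kappa>)" for j by simp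
  thus ?thesis
    using assms by (subst geometric_expansion_sum[of _ "pos_val N M" "pos_den N M" _ "fps_const fps_X" _ J])
      (simp_all only: fps_add_nth fps_sum_nth nth_mult_tt pos_val_den pos_first_den, auto simp: pos_val_den pos_first_den)
qed

lemma last_geometric_nth:
  assumes "N + M > 0" "J \<ge> a"
  shows "(\<Sum>p=0..N + M - 1. star_sum (pos_val N M) 0 p \<kappa> * pos_last N M p) $ a $ b
    = (\<Sum>j\<le>J. if j \<le> a then star_sum (pos_val N M) 0 (N + M - 1) (\<kappa> @ [j + 1]) $ (a - j) $ b else 0)"
proof -
  have "(\<Sum>p=0..N + M - 1. pos_val N M p ^ (j + 1) * star_sum (pos_val N M) 0 p \<kappa>)
      = star_sum (pos_val N M) 0 (N + M - 1) (\<kappa> @ [j + 1])" for j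
    unfolding star_sum_snoc by (intro sum.cong refl mult.commute)
  thus ?thesis
    using assms unfolding mult.commute[of "star_sum _ _ _ _" "pos_last _ _ _"]
    by (subst geometric_expansion_sum[of _ "pos_val N M" "pos_den N M" _ "fps_X" _ J])
      (simp_all only: fps_add_nth fps_sum_nth nth_mult_ss pos_val_den pos_last_den, auto simp: pos_val_den pos_last_den)
qed

text \<open>The cyclic identity with \<open>d = pos_first\<close> and \<open>e = pos_last\<close>:
  their geometric expansions are the infinite sums of the formula, so only error terms are
  left.\<close>

lemma truncated_defect:
  assumes "0 < N" "0 < M" "k \<noteq> []"
  shows "defect k (star_coeff (sym_coeff (trunc_zeta N) (trunc_zeta M))) a b
    = (\<Sum>i=1..length k. \<Sum>p=0..N + M - 1. \<Sum>q=p..N + M - 1. pinned_sum (pos_val N M) p q (rotation i k) *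
        pos_error N M p q) $ a $ b"
proof -
  let ?x = "pos_val N M" and ?B = "N + M - 1"
  have NM: "N + M > 0" using assms by simp
  have cyc: "(\<Sum>i=1..length k. \<Sum>j<k ! (i - 1).
           star_sum ?x 0 ?B ([j + 1] @ drop i k @ take (i - 1) k @ [k ! (i - 1) - j]))
     = (\<Sum>i=1..length k. (\<Sum>p=0..?B. pos_first N M p * star_sum ?x p ?B (rotation i k))
          + (\<Sum>p=0..?B. star_sum ?x 0 p (rotation i k) * pos_last N M p))
       + of_nat (sum_list k) * star_sum ?x 0 ?B [sum_list k + 1]
       + (\<Sum>i=1..length k. \<Sum>p=0..?B. \<Sum>q=p..?B. pinned_sum ?x p q (rotation i k) *
            pos_error N M p q)"
    unfolding pos_error_def
    using NM assms(3) by (intro star_sum_cyclic[where y = "pos_den N M"] pos_val_den pos_diff_den) auto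
  have nat: "(of_nat n * F) $ a $ b = (\<Sum>j<n. F $ a $ b)" for n and F :: "real fps fps"
    by (induction n) (simp_all add: algebra_simps)
  define F where "F i = (\<Sum>p=0..?B. pos_first N M p * star_sum ?x p ?B (rotation i k))" for i
  define H where "H i = (\<Sum>p=0..?B. star_sum ?x 0 p (rotation i k) * pos_last N M p)" for i
  have FH: "F i $ a $ b = (\<Sum>j\<le>a + b. if j \<le> b then star_sum ?x 0 ?B ([j + 1] @ rotation i k) $ a $ (b - j) else 0)"
    "H i $ a $ b = (\<Sum>j\<le>a + b. if j \<le> a then star_sum ?x 0 ?B (rotation i k @ [j + 1]) $ (a - j) $ b else 0)" for i
    unfolding F_def H_def by (rule first_geometric_nth[OF NM le_add2], rule last_geometric_nth[OF NM le_add1])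
  have "defect k (\<lambda>l a b. star_sum ?x 0 ?B l $ a $ b) a b
     = ((\<Sum>i=1..length k. \<Sum>j<k ! (i - 1).
           star_sum ?x 0 ?B ([j + 1] @ drop i k @ take (i - 1) k @ [k ! (i - 1) - j]))
     - (\<Sum>i=1..length k. F i + H i) - of_nat (sum_list k) * star_sum ?x 0 ?B [sum_list k + 1]) $ a $ b"
    by (simp only: defect_def fps_sub_nth nat fps_sum_nth fps_add_nth FH sum.distrib)
  also have "\<dots> = (\<Sum>i=1..length k. \<Sum>p=0..?B. \<Sum>q=p..?B. pinned_sum ?x p q (rotation i k) *
        pos_error N M p q) $ a $ b"
    unfolding cyc F_def[symmetric] H_def[symmetric] by simp
  finally show ?thesis unfolding star_sum_pos_val_nth[OF NM] .
qed

section \<open>Passage to the limit\<close>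

lemma bigo_scale:
  assumes "g \<in> O(\<lambda>n. real n powr p)" "c > 0"
  shows "(\<lambda>N. g (c * N)) \<in> O(\<lambda>N. real N powr p)"
proof -
  have "filterlim (\<lambda>N. c * N) at_top sequentially"
    using assms(2) by (intro filterlim_subseq strict_monoI) simp
  with assms(1) have "(\<lambda>N. g (c * N)) \<in> O(\<lambda>N. real (c * N) powr p)" by (rule landau_o.big.compose)
  also have "(\<lambda>N. real (c * N) powr p) = (\<lambda>N. real c powr p * real N powr p)"
    by (rule ext) (simp add: powr_mult)
  finally show ?thesis using assms(2) by simp
qed

lemma slow_scale: "slow g \<Longrightarrow> c > 0 \<Longrightarrow> slow (\<lambda>N. g (c * N))"
  unfolding slow_def using bigo_scale by blast

lemma small_scale: "small g \<Longrightarrow> c > 0 \<Longrightarrow> small (\<lambda>N. g (c * N))"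
  unfolding small_def using bigo_scale by blast

lemma small_inverse: "small (\<lambda>N. 1 / real N)"
  unfolding small_def
proof (intro exI[of _ 1] conjI)
  have "(\<lambda>N. 1 / real N) = (\<lambda>N. real N powr (-1))"
    by (rule ext) (simp add: powr_minus inverse_eq_divide)
  thus "(\<lambda>N. 1 / real N) \<in> O(\<lambda>N. real N powr (-1))" by simp
qed simp

lemma small_error_scale:
  assumes "c > 0"
  shows "small (\<lambda>N. error_scale A N (c * N))"
proof -
  have h: "small (\<lambda>N. harm N * (1 / real N))"
    by (rule small_mult_slow'[OF small_inverse slow_harm])
  have "small (\<lambda>N. (2 * (harm N * (1 / real N)) + norm_bound A * (1 / real (c * N)))
      + (2 * (harm (c * N) * (1 / real (c * N))) + norm_bound A * (1 / real N)))"
    by (intro small_add small_cmult h small_inverse small_scale[OF h assms] small_scale[OF small_inverse assms])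
  thus ?thesis by (simp add: error_scale_def)
qed

lemma small_truncated_defect:
  assumes "is_index k" "\<exists>x\<in>set k. x \<ge> 2" "c > 0"
  shows "small (\<lambda>N. defect k (star_coeff (sym_coeff (trunc_zeta N) (trunc_zeta (c * N)))) a b)"
proof (rule small_bounded[where C = 1])
  \<comment> \<open>Any truncation order at least \<open>a\<close> and \<open>b\<close> controls the
    coefficient in question.\<close>
  let ?A = "a + b"
  let ?bd = "\<lambda>N. \<Sum>i=1..length k. norm_bound ?A ^ sum_list (rotation i k) *
      (error_scale ?A N (c * N) * (harm N + harm (c * N)) ^ length (rotation i k))"
  show "small ?bd"
    by (intro small_sum small_cmult small_mult_slow small_error_scale slow_power slow_add slow_harm
        slow_scale[OF slow_harm] assms(3))
  fix N :: nat assume N: "N > 0"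
  let ?M = "c * N"
  let ?E = "\<lambda>i. \<Sum>p=0..N + ?M - 1. \<Sum>q=p..N + ?M - 1. pinned_sum (pos_val N ?M) p q (rotation i k) *
        pos_error N ?M p q"
  have ne: "k \<noteq> []" using assms(2) by auto
  have ex: "\<exists>x\<in>set (rotation i k). x \<ge> 2" for i
  proof -
    have "set (rotation i k) = set k"
      using set_append[of "take i k" "drop i k"] by (auto simp: rotation_def)
    thus ?thesis using assms(2) by simp
  qed
  have "\<bar>defect k (star_coeff (sym_coeff (trunc_zeta N) (trunc_zeta ?M))) a b\<bar> = \<bar>(\<Sum>i=1..length k. ?E i) $ a $ b\<bar>"
    using truncated_defect[of N ?M k a b] N assms(3) ne by simp
  also have "\<dots> \<le> norm2 ?A (\<Sum>i=1..length k. ?E i)" by (rule nth_le_norm2) auto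
  also have "\<dots> \<le> (\<Sum>i=1..length k. norm2 ?A (?E i))" by (rule ring_seminorm_sum[OF norm2_seminorm])
  also have "\<dots> \<le> ?bd N"
    using N assms ex by (intro sum_mono total_error_bound index_rotation) auto
  finally show "\<bar>defect k (star_coeff (sym_coeff (trunc_zeta N) (trunc_zeta ?M))) a b\<bar> \<le> 1 * ?bd N" by simp
qed

lemma small_shift_sum:
  assumes "is_index k" "\<And>l. is_index l \<Longrightarrow> small (\<lambda>n. f n l - g n l)"
  shows "small (\<lambda>n. shift_sum (f n) k m - shift_sum (g n) k m)"
proof -
  have "small (\<lambda>N. \<Sum>n\<in>{n. length n = length k \<and> sum_list n = m}. bcoef k n * (f N (map2 (+) k n) - g N (map2 (+) k n)))"
    by (intro small_sum small_cmult assms(2) index_map2_add assms(1)) auto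
  thus ?thesis by (simp add: shift_sum_def sum_subtractf right_diff_distrib)
qed

lemma slow_sum: "(\<And>i. i \<in> A \<Longrightarrow> slow (\<lambda>n. e n i)) \<Longrightarrow> slow (\<lambda>n. \<Sum>i\<in>A. e n i)"
  by (induction A rule: infinite_finite_induct) (auto intro: slow_add)

lemma slow_shift_sum:
  assumes "is_index k" "\<And>l. is_index l \<Longrightarrow> slow (\<lambda>n. f n l)"
  shows "slow (\<lambda>n. shift_sum (f n) k m)"
  unfolding shift_sum_def
  by (intro slow_sum slow_mult slow_const assms(2) index_map2_add assms(1)) auto

text \<open>\<open>f * g - f' * g' = (f - f') * g + f' * (g - g')\<close>, so growth is controlled
  for \<open>f'\<close> and \<open>g\<close>.\<close>

lemma small_sym_coeff:
  assumes "is_index k"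
    "\<And>l. is_index l \<Longrightarrow> small (\<lambda>n. f n l - f' n l)" "\<And>l. is_index l \<Longrightarrow> small (\<lambda>n. g n l - g' n l)"
    "\<And>l. is_index l \<Longrightarrow> slow (\<lambda>n. f' n l)" "\<And>l. is_index l \<Longrightarrow> slow (\<lambda>n. g n l)"
  shows "small (\<lambda>n. sym_coeff (f n) (g n) k a b - sym_coeff (f' n) (g' n) k a b)"
proof -
  have ind: "is_index (take i k)" "is_index (rev (drop i k))" for i
    using assms(1) by (simp_all add: index_take_drop)
  have "small (\<lambda>n. \<Sum>i\<le>length k. (-1) ^ (sum_list (drop i k) + a) *
     ((shift_sum (f n) (take i k) a - shift_sum (f' n) (take i k) a) * shift_sum (g n) (rev (drop i k)) b
     + shift_sum (f' n) (take i k) a * (shift_sum (g n) (rev (drop i k)) b - shift_sum (g' n) (rev (drop i k)) b)))"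
    by (intro small_sum small_cmult small_add small_mult_slow small_mult_slow' small_shift_sum slow_shift_sum ind
        assms(2-5))
  thus ?thesis unfolding sym_coeff_def sum_subtractf[symmetric]
    by (simp add: algebra_simps)
qed

lemma small_star_coeff:
  assumes "is_index k" "\<And>l. is_index l \<Longrightarrow> small (\<lambda>n. Z n l a b - Z' n l a b)"
  shows "small (\<lambda>n. star_coeff (Z n) k a b - star_coeff (Z' n) k a b)"
proof -
  have "small (\<lambda>n. \<Sum>l\<leftarrow>coarsenings k. Z n l a b - Z' n l a b)"
    by (intro small_sum_list assms(2) coarsenings_index[OF assms(1)])
  thus ?thesis by (simp add: star_coeff_def sum_list_subtractf)
qed

text \<open>At \<open>T_1 = harm N\<close> and \<open>T_2 = harm (c * N)\<close> the regularized
  values differ from the truncated ones by small errors. The evaluated defect therefore tends to 0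
  for every \<open>c\<close>, which forces the polynomial itself to vanish.\<close>

lemma harmonic_defect:
  assumes "is_index k" "\<exists>x\<in>set k. x \<ge> 2"
  shows "defect k (\<lambda>l a b. zSstar Harmonic l $ a $ b) a b = 0"
proof (rule eval2_harm_eq_0I)
  fix c :: nat assume c: "c > 0"
  let ?Q = "\<lambda>N l. poly (zeta_reg Harmonic l) (harm N)"
  have Q: "small (\<lambda>N. ?Q N l - trunc_zeta N l)" if "is_index l" for l
    using small_uminus[OF harmonic.zeta_reg_small[OF that]] unfolding trunc_zeta_one by simp
  have Qc: "small (\<lambda>N. ?Q (c * N) l - trunc_zeta (c * N) l)" if "is_index l" for l
    by (rule small_scale[OF Q[OF that] c])
  have ev: "eval2 (harm N) (harm (c * N)) (defect k (\<lambda>l a b. zSstar Harmonic l $ a $ b) a b)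
      = defect k (star_coeff (sym_coeff (?Q N) (?Q (c * N)))) a b" for N
  proof -
    have "eval2 (harm N) (harm (c * N)) (zSstar Harmonic l $ a $ b)
        = star_coeff (sym_coeff (?Q N) (?Q (c * N))) l a b" for l a b
      by (simp only: zSstar_nth star_coeff_def eval2_sum_list eval2_zS)
    moreover have "eval2 (harm N) (harm (c * N)) (defect k (\<lambda>l a b. zSstar Harmonic l $ a $ b) a b)
        = defect k (\<lambda>l a b. eval2 (harm N) (harm (c * N)) (zSstar Harmonic l $ a $ b)) a b"
      by (rule defect_hom) (simp_all only: eval2_simps)
    ultimately show ?thesis by (simp only:)
  qed
  have "small (\<lambda>N. defect k (\<lambda>l a b. star_coeff (sym_coeff (?Q N) (?Q (c * N))) l a b
      - star_coeff (sym_coeff (trunc_zeta N) (trunc_zeta (c * N))) l a b) a b)"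
    by (intro defect_small assms(1) small_star_coeff small_sym_coeff Q Qc slow_trunc_zeta
        slow_scale[OF slow_poly_harm c])
  from small_add[OF this small_truncated_defect[OF assms c, of a b]]
  have "small (\<lambda>N. defect k (star_coeff (sym_coeff (?Q N) (?Q (c * N)))) a b)"
    by (simp add: defect_diff)
  thus "(\<lambda>N. eval2 (harm N) (harm (c * N)) (defect k (\<lambda>l a b. zSstar Harmonic l $ a $ b) a b)) \<longlonglongrightarrow> 0"
    unfolding ev by (rule small_tendsto)
qed

text \<open>The defect is additive in the values and only indices occur in it, so
  \<open>transfer_map2\<close> carries the harmonic identity over coefficient by
  coefficient.\<close>

lemma zSstar_defect:
  assumes "is_index k" "\<exists>x\<in>set k. x \<ge> 2"
  shows "defect k (\<lambda>l a b. zSstar bt l $ a $ b) a b = 0"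
proof (cases bt)
  case Harmonic
  thus ?thesis using harmonic_defect[OF assms] by simp
next
  case Shuffle
  have "defect k (\<lambda>l a b. zSstar Shuffle l $ a $ b) a b
      = defect k (\<lambda>l a b. transfer_map2 (zSstar Harmonic l $ a $ b)) a b"
  proof (rule defect_cong[OF assms(1)])
    fix l a b assume l: "is_index l"
    have "(\<Sum>l\<leftarrow>coarsenings l. zS Shuffle l $ a $ b) = (\<Sum>l\<leftarrow>coarsenings l. transfer_map2 (zS Harmonic l $ a $ b))"
      by (rule arg_cong[where f = sum_list], rule map_cong[OF refl])
         (simp add: transfer_map2_zS coarsenings_index[OF l])
    thus "zSstar Shuffle l $ a $ b = transfer_map2 (zSstar Harmonic l $ a $ b)"
      by (simp add: zSstar_nth star_coeff_def transfer_map2_sum_list)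
  qed
  also have "\<dots> = transfer_map2 (defect k (\<lambda>l a b. zSstar Harmonic l $ a $ b) a b)"
    by (rule defect_hom[symmetric]) (simp_all add: transfer_map2_add transfer_map2_diff transfer_map2_0)
  finally show ?thesis
    using harmonic_defect[OF assms] Shuffle by (simp add: transfer_map2_0)
qed

lemma ex_entry_ge_2:
  assumes "sum_list k > length k"
  shows "\<exists>x\<in>set k. x \<ge> (2::nat)"
proof (rule ccontr)
  assume "\<not> ?thesis"
  hence "\<forall>x\<in>set k. x \<le> 1" by (auto simp: not_le less_2_cases_iff)
  hence "sum_list k \<le> length k" by (induction k) auto
  thus False using assms by simp
qed

theorem theorem6p1:
  fixes bt :: prodtype and k :: "nat list"
  assumes "is_index k" and "k \<noteq> []" and "sum_list k > length k"
  shows "(\<Sum>i=1..length k. \<Sum>j<k ! (i - 1).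
            zSstar bt ([j + 1] @ drop i k @ take (i - 1) k @ [k ! (i - 1) - j]))
       = (\<Sum>i=1..length k. sum_st (\<lambda>j.
            zSstar bt ([j + 1] @ drop i k @ take i k) * tt ^ j
          + zSstar bt (drop i k @ take i k @ [j + 1]) * ss ^ j))
         + of_nat (sum_list k) * zSstar bt [sum_list k + 1]"
    (is "?lhs = ?rhs")
proof -
  have of_nat_mult_nth: "(of_nat n * F) $ a $ b = (\<Sum>j<n. F $ a $ b)" for n and F :: ps
    by (induction n) (simp_all add: algebra_simps)
  \<comment> \<open>\<open>sum_st\<close> stops at \<open>j \<le> a + b\<close> just as
    \<open>defect\<close> does, and the powers of \<open>t\<close> and \<open>s\<close> shift
    coefficients as in its case distinctions.\<close>
  have "(?lhs - ?rhs) $ a $ b = defect k (\<lambda>l a b. zSstar bt l $ a $ b) a b" for a b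
    by (simp add: of_nat_mult_nth defect_def sum_st_def fps_sum_nth tt_def ss_def nth_mult_tt nth_mult_ss rotation_def
        del: fps_const_power cong: if_cong)
  hence "(?lhs - ?rhs) $ a $ b = 0" for a b
    using zSstar_defect[OF assms(1) ex_entry_ge_2[OF assms(3)]] by simp
  hence "?lhs - ?rhs = 0" by (intro fps_ext) simp
  thus ?thesis by simp
qed

end
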